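(* Let $C\in\Bbbk$ and let $X$ be a submultiset of $R_{u+C}$. Then, in the Grothendieck group $K_0(\mathcal{S}_u)$, $$[A_C(X)]=[A_C(X^\star)]+\sum_{\beta\in\underline{R_{u+C}}}\varphi_X(\beta)\,[L(\beta)],$$ where $A_C(X^\star)=\mathrm{soc}(A_C(X))$.
   Context: $\Bbbk$ is an algebraically closed field of characteristic zero. Fix a nonzero polynomial $g(h)\in\Bbbk[h]$ and a polynomial $u(h)\in\Bbbk[h]$ with $g(h)=u(h-1)-u(h)$ (such $u$ exists, is unique up to its constant term, and $\deg u=\deg g+1\geq 1$). The Smith algebra $\mathcal{S}_u$ is the unital associative $\Bbbk$-algebra generated by $x,y,h$ with defining relations $[h,y]=y$, $[h,x]=-x$, $[y,x]=g(h)$. $K_0(\mathcal{S}_u)$ is the free abelian group on isomorphism classes $[M]$ of finitely generated (left) $\mathcal{S}_u$-modules modulo the relations $[M]=[M']+[M'']$ for short exact sequences $0\to M'\to M\to M''\to 0$. $R_f$ denotes the multiset of roots of a nonzero polynomial $f$ (with multiplicity), and $\underline{Z}$ the underlying set of a multiset $Z$. Unions and differences of multisets are taken with multiplicity. For $C\in\Bbbk$ and a submultiset $X\subseteq R_{u+C}$, put $q(h)=\prod_{\alpha\in X}(h-\alpha)$ (with multiplicity; empty product $=1$) and $p(h)=\frac{u(h-1)+C}{q(h-1)}\in\Bbbk[h]$. The module $A_C(X)$ is $\Bbbk[h]$ with $h$ acting by multiplication and $x\cdot f(h)=f(h+1)q(h)$, $y\cdot f(h)=f(h-1)p(h)$ for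 all $f\in\Bbbk[h]$. The socle $\mathrm{soc}(M)$ is the sum of the simple submodules of $M$. The socle of $A_C(X)$ is (isomorphic to, and identified with) $A_C(X^\star)$ for a unique submultiset $X^\star\subseteq R_{u+C}$; this is the definition of $X^\star$ needed here. For $\lambda\in\Bbbk$, the Verma module is $V(\lambda)=\mathcal{S}_u\otimes_{\mathfrak{b}}\Bbbk_\lambda$, where $\mathfrak{b}$ is the unital subalgebra generated by $h$ and $y$ and $\Bbbk_\lambda=\Bbbk v_\lambda$ with $hv_\lambda=\lambda v_\lambda$, $yv_\lambda=0$; $V(\lambda)$ has a unique maximal submodule, and $L(\lambda)$ is the corresponding simple quotient. Define a partial order on $\Bbbk$ by $\alpha\preccurlyeq\beta$ iff $\beta-\alpha=n1_\Bbbk$ for some integer $n\geq 0$, and write $\alpha\prec\beta$ if moreover $\alpha\neq\beta$. For a multiset $Z$, $Z_{\prec\beta}=\{\alpha\in Z\mid\alpha\prec\beta\}$ and $Z_{\succcurlyeq\beta}=\{\alpha\in Z\mid\beta\preccurlyeq\alpha\}$ (submultisets), and $|\cdot|$ is cardinality with multiplicity. For a submultiset $Z\subseteq R_{u+C}$ and $\beta\in\underline{R_{u+C}}$, $\varphi_Z(\beta)=\min\{|(R_{u+C}\setminus Z)_{\prec\beta}|,\ |Z_{\succcurlyeq\beta}|\}$. *)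

theory Defs
  imports
    "HOL-Algebra.Algebraic_Closure_Type"
    "HOL-Algebra.Free_Abelian_Groups"
    "HOL-Algebra.Generated_Rings"
    "HOL-Algebra.QuotRing"
    "HOL-Library.Poly_Mapping"
begin

section \<open>Left modules over a noncommutative ring\<close>

text \<open>
  The locale \<^locale>\<open>module\<close> of the library requires a commutative ring of scalars; the record type
  \<^typ>\<open>('r, 'm) module\<close> and the locale \<^locale>\<open>submodule\<close> do not and are reused.  As for
  \<^locale>\<open>module\<close>, the \<open>mult\<close> and \<open>one\<close> fields of a module are irrelevant.
\<close>

locale left_module = R?: ring R + M?: abelian_group M
  for R :: "('r, 'c) ring_scheme" (structure) and M :: "('r, 'm, 'd) module_scheme" (structure) +
  assumes smult_closed [simp, intro]:
      "\<lbrakk>a \<in> carrier R; x \<in> carrier M\<rbrakk> \<Longrightarrow> a \<odot>\<^bsub>M\<^esub> x \<in> carrier M"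
    and smult_l_distr:
      "\<lbrakk>a \<in> carrier R; b \<in> carrier R; x \<in> carrier M\<rbrakk> \<Longrightarrow>
        (a \<oplus>\<^bsub>R\<^esub> b) \<odot>\<^bsub>M\<^esub> x = a \<odot>\<^bsub>M\<^esub> x \<oplus>\<^bsub>M\<^esub> b \<odot>\<^bsub>M\<^esub> x"
    and smult_r_distr:
      "\<lbrakk>a \<in> carrier R; x \<in> carrier M; y \<in> carrier M\<rbrakk> \<Longrightarrow>
        a \<odot>\<^bsub>M\<^esub> (x \<oplus>\<^bsub>M\<^esub> y) = a \<odot>\<^bsub>M\<^esub> x \<oplus>\<^bsub>M\<^esub> a \<odot>\<^bsub>M\<^esub> y"
    and smult_assoc1:
      "\<lbrakk>a \<in> carrier R; b \<in> carrier R; x \<in> carrier M\<rbrakk> \<Longrightarrow>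
        (a \<otimes>\<^bsub>R\<^esub> b) \<odot>\<^bsub>M\<^esub> x = a \<odot>\<^bsub>M\<^esub> (b \<odot>\<^bsub>M\<^esub> x)"
    and smult_one [simp]: "x \<in> carrier M \<Longrightarrow> \<one>\<^bsub>R\<^esub> \<odot>\<^bsub>M\<^esub> x = x"

definition left_module_hom ::
    "('r, 'c) ring_scheme \<Rightarrow> ('r, 'm, 'd) module_scheme \<Rightarrow> ('r, 'n, 'e) module_scheme \<Rightarrow> ('m \<Rightarrow> 'n) set"
  where "left_module_hom R M N =
    {f \<in> carrier M \<rightarrow> carrier N.
      (\<forall>x\<in>carrier M. \<forall>y\<in>carrier M. f (x \<oplus>\<^bsub>M\<^esub> y) = f x \<oplus>\<^bsub>N\<^esub> f y) \<and>
      (\<forall>r\<in>carrier R. \<forall>x\<in>carrier M. f (r \<odot>\<^bsub>M\<^esub> x) = r \<odot>\<^bsub>N\<^esub> f x)}"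

definition module_isomorphic ::
    "('r, 'c) ring_scheme \<Rightarrow> ('r, 'm, 'd) module_scheme \<Rightarrow> ('r, 'n, 'e) module_scheme \<Rightarrow> bool"
  where "module_isomorphic R M N \<longleftrightarrow>
    (\<exists>f\<in>left_module_hom R M N. bij_betw f (carrier M) (carrier N))"

definition finitely_generated :: "('r, 'c) ring_scheme \<Rightarrow> ('r, 'm, 'd) module_scheme \<Rightarrow> bool"
  where "finitely_generated R M \<longleftrightarrow>
    (\<exists>A. finite A \<and> A \<subseteq> carrier M \<and>
      carrier M = {(\<Oplus>\<^bsub>M\<^esub>a\<in>A. c a \<odot>\<^bsub>M\<^esub> a) | c. c \<in> A \<rightarrow> carrier R})"

definition short_exact ::
    "('r, 'c) ring_scheme \<Rightarrow> ('r, 'l, 'd) module_scheme \<Rightarrow> ('l \<Rightarrow> 'm) \<Rightarrow>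
      ('r, 'm, 'e) module_scheme \<Rightarrow> ('m \<Rightarrow> 'n) \<Rightarrow> ('r, 'n, 'f) module_scheme \<Rightarrow> bool"
  where "short_exact R M' i M p M'' \<longleftrightarrow>
    i \<in> left_module_hom R M' M \<and> p \<in> left_module_hom R M M'' \<and>
    inj_on i (carrier M') \<and> i ` carrier M' = a_kernel M M'' p \<and> p ` carrier M = carrier M''"

definition simple_module :: "('r, 'c) ring_scheme \<Rightarrow> ('r, 'm, 'd) module_scheme \<Rightarrow> bool"
  where "simple_module R M \<longleftrightarrow>
    left_module R M \<and> carrier M \<noteq> {\<zero>\<^bsub>M\<^esub>} \<and>
    (\<forall>N. submodule N R M \<longrightarrow> N = {\<zero>\<^bsub>M\<^esub>} \<or> N = carrier M)"

definition socle :: "('r, 'c) ring_scheme \<Rightarrow> ('r, 'm, 'd) module_scheme \<Rightarrow> 'm set"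
  where "socle R M =
    generate (add_monoid M) (\<Union>{N. submodule N R M \<and> simple_module R (M\<lparr>carrier := N\<rparr>)})"

definition maximal_submodule :: "('r, 'c) ring_scheme \<Rightarrow> ('r, 'm, 'd) module_scheme \<Rightarrow> 'm set \<Rightarrow> bool"
  where "maximal_submodule R M N \<longleftrightarrow>
    submodule N R M \<and> N \<noteq> carrier M \<and>
    (\<forall>N'. submodule N' R M \<and> N \<subseteq> N' \<longrightarrow> N' = N \<or> N' = carrier M)"

definition quotient_module :: "('r, 'm, 'd) module_scheme \<Rightarrow> 'm set \<Rightarrow> ('r, 'm set) module"
  where "quotient_module M N =
    \<lparr>carrier = a_rcosets\<^bsub>M\<^esub> N, monoid.mult = undefined, one = undefined,
     ring.zero = N, add = set_add M, module.smult = (\<lambda>r T. \<Union>x\<in>T. N +>\<^bsub>M\<^esub> (r \<odot>\<^bsub>M\<^esub> x))\<rparr>"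

text \<open>
  The tensor product \<open>S \<otimes>\<^sub>B N\<close> of a ring \<open>S\<close>, as a right module over its subring \<open>B\<close>, with a left
  \<open>B\<close>-module \<open>N\<close>: the free abelian group on \<open>S \<times> N\<close> modulo the balanced relations, with
  \<open>s (a \<otimes> n) = s a \<otimes> n\<close>.
\<close>

definition tensor_relations ::
    "('r, 'c) ring_scheme \<Rightarrow> 'r set \<Rightarrow> ('r, 'n, 'd) module_scheme \<Rightarrow> ('r \<times> 'n \<Rightarrow>\<^sub>0 int) set"
  where "tensor_relations S B N =
    {frag_of (s \<oplus>\<^bsub>S\<^esub> t, n) - frag_of (s, n) - frag_of (t, n) | s t n.
      s \<in> carrier S \<and> t \<in> carrier S \<and> n \<in> carrier N} \<union>
    {frag_of (s, m \<oplus>\<^bsub>N\<^esub> n) - frag_of (s, m) - frag_of (s, n) | s m n.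
      s \<in> carrier S \<and> m \<in> carrier N \<and> n \<in> carrier N} \<union>
    {frag_of (s \<otimes>\<^bsub>S\<^esub> b, n) - frag_of (s, b \<odot>\<^bsub>N\<^esub> n) | s b n.
      s \<in> carrier S \<and> b \<in> B \<and> n \<in> carrier N}"

definition induced_module ::
    "('r, 'c) ring_scheme \<Rightarrow> 'r set \<Rightarrow> ('r, 'n, 'd) module_scheme \<Rightarrow> ('r, ('r \<times> 'n \<Rightarrow>\<^sub>0 int) set) module"
  where "induced_module S B N =
    (let F = free_Abelian_group (carrier S \<times> carrier N);
         I = generate F (tensor_relations S B N)
     in \<lparr>carrier = rcosets\<^bsub>F\<^esub> I, monoid.mult = undefined, one = undefined,
         ring.zero = I, add = set_mult F,
         module.smult = (\<lambda>s T. \<Union>t\<in>T. I #>\<^bsub>F\<^esub> frag_extend (\<lambda>(a, n). frag_of (s \<otimes>\<^bsub>S\<^esub> a, n)) t)\<rparr>)"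


section \<open>The Grothendieck group of finitely generated modules\<close>

text \<open>
  Isomorphism classes are formed among the modules with carrier in the type \<^typ>\<open>(nat \<Rightarrow> 'r) set\<close>.
  This loses nothing: every finitely generated module, on whatever type, has an isomorphic copy
  there (lemma \<open>ex_isomorphic_fg_module\<close>), roughly as a quotient of a free module of finite rank.
  \<open>iso_class R M\<close> makes sense for \<open>M\<close> on an arbitrary type.
\<close>

definition fg_modules :: "('r, 'c) ring_scheme \<Rightarrow> ('r, (nat \<Rightarrow> 'r) set) module set"
  where "fg_modules R = {M. left_module R M \<and> finitely_generated R M}"

definition iso_class ::
    "('r, 'c) ring_scheme \<Rightarrow> ('r, 'm, 'd) module_scheme \<Rightarrow> ('r, (nat \<Rightarrow> 'r) set) module set"
  where "iso_class R M = {N \<in> fg_modules R. module_isomorphic R M N}"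

type_synonym 'r K0_free = "('r, (nat \<Rightarrow> 'r) set) module set \<Rightarrow>\<^sub>0 int"

definition K0_free_group :: "('r, 'c) ring_scheme \<Rightarrow> 'r K0_free monoid"
  where "K0_free_group R = free_Abelian_group (iso_class R ` fg_modules R)"

definition K0_relations :: "('r, 'c) ring_scheme \<Rightarrow> 'r K0_free set"
  where "K0_relations R = generate (K0_free_group R)
    {frag_of (iso_class R M) - frag_of (iso_class R M') - frag_of (iso_class R M'') | M' i M p M''.
      M' \<in> fg_modules R \<and> M \<in> fg_modules R \<and> M'' \<in> fg_modules R \<and> short_exact R M' i M p M''}"

text \<open>As a \<^typ>\<open>'a monoid\<close>, the abelian group \<open>K0 R\<close> is written multiplicatively.\<close>

definition K0 :: "('r, 'c) ring_scheme \<Rightarrow> 'r K0_free set monoid"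
  where "K0 R = K0_free_group R Mod K0_relations R"

definition K0_class :: "('r, 'c) ring_scheme \<Rightarrow> ('r, 'm, 'd) module_scheme \<Rightarrow> 'r K0_free set"
  where "K0_class R M = K0_relations R #>\<^bsub>K0_free_group R\<^esub> frag_of (iso_class R M)"

lemma (in left_module) transport_iso:
  fixes F
  assumes inj: "inj_on F (carrier M)"
  defines "G \<equiv> inv_into (carrier M) F"
  defines "N \<equiv> \<lparr>carrier = F ` carrier M, monoid.mult = undefined, one = undefined,
    ring.zero = F \<zero>\<^bsub>M\<^esub>, add = (\<lambda>x y. F (G x \<oplus>\<^bsub>M\<^esub> G y)), module.smult = (\<lambda>r x. F (r \<odot>\<^bsub>M\<^esub> G x))\<rparr>"
  shows "left_module R N" "F \<in> left_module_hom R M N" "bij_betw F (carrier M) (carrier N)"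
proof -
  have GF: "G (F x) = x" if "x \<in> carrier M" for x
    using that inj by (simp add: G_def)
  have ab: "abelian_group N"
  proof (rule abelian_groupI)
    fix x assume "x \<in> carrier N"
    then obtain a where a: "a \<in> carrier M" "x = F a" by (auto simp: N_def)
    show "\<exists>y\<in>carrier N. y \<oplus>\<^bsub>N\<^esub> x = \<zero>\<^bsub>N\<^esub>"
      using a by (intro bexI[of _ "F (\<ominus>\<^bsub>M\<^esub> a)"]) (auto simp: N_def GF M.l_neg)
  qed (auto simp: N_def GF M.a_assoc M.a_comm M.a_lcomm)
  show "left_module R N"
  proof (intro left_module.intro left_module_axioms.intro ab)
    show "ring R" by (rule R.ring_axioms)
  qed (auto simp: N_def GF smult_l_distr smult_r_distr smult_assoc1)
  show "F \<in> left_module_hom R M N"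
    by (auto simp: left_module_hom_def N_def GF)
  show "bij_betw F (carrier M) (carrier N)"
    using inj by (auto simp: bij_betw_def N_def)
qed

lemma left_module_hom_finsum:
  assumes M: "left_module R M" and N: "left_module R N"
    and f: "f \<in> left_module_hom R M N" and "finite A" and g: "g \<in> A \<rightarrow> carrier M"
  shows "f (\<Oplus>\<^bsub>M\<^esub>a\<in>A. g a) = (\<Oplus>\<^bsub>N\<^esub>a\<in>A. f (g a))"
proof -
  interpret M: left_module R M by fact
  interpret N: left_module R N by fact
  have add: "f (x \<oplus>\<^bsub>M\<^esub> y) = f x \<oplus>\<^bsub>N\<^esub> f y" if "x \<in> carrier M" "y \<in> carrier M" for x y
    using f that by (auto simp: left_module_hom_def)
  have cl: "f x \<in> carrier N" if "x \<in> carrier M" for x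
    using f that by (auto simp: left_module_hom_def)
  have "f \<zero>\<^bsub>M\<^esub> \<oplus>\<^bsub>N\<^esub> f \<zero>\<^bsub>M\<^esub> = f \<zero>\<^bsub>M\<^esub>"
    using add[of "\<zero>\<^bsub>M\<^esub>" "\<zero>\<^bsub>M\<^esub>"] by simp
  hence zero: "f \<zero>\<^bsub>M\<^esub> = \<zero>\<^bsub>N\<^esub>"
    by (metis M.M.zero_closed N.M.add.r_cancel_one cl)
  show ?thesis
    using \<open>finite A\<close> g
  proof (induction A rule: finite_induct)
    case empty
    then show ?case by (simp add: zero)
  next
    case (insert a A)
    have g': "g \<in> A \<rightarrow> carrier M" "g a \<in> carrier M" using insert.prems by auto
    have "f (\<Oplus>\<^bsub>M\<^esub>a\<in>insert a A. g a) = f (g a \<oplus>\<^bsub>M\<^esub> (\<Oplus>\<^bsub>M\<^esub>a\<in>A. g a))"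
      using insert.hyps g' by (simp add: M.M.finsum_insert)
    also have "\<dots> = f (g a) \<oplus>\<^bsub>N\<^esub> (\<Oplus>\<^bsub>N\<^esub>a\<in>A. f (g a))"
      using g' insert.IH by (simp add: add M.M.finsum_closed)
    also have "\<dots> = (\<Oplus>\<^bsub>N\<^esub>a\<in>insert a A. f (g a))"
      using insert.hyps g' cl by (subst N.M.finsum_insert) auto
    finally show ?case .
  qed
qed

lemma finitely_generated_image:
  assumes M: "left_module R M" and N: "left_module R N" and fg: "finitely_generated R M"
    and f: "f \<in> left_module_hom R M N" and bij: "bij_betw f (carrier M) (carrier N)"
  shows "finitely_generated R N"
proof -
  interpret M: left_module R M by fact
  interpret N: left_module R N by fact
  obtain A where A: "finite A" "A \<subseteq> carrier M"
    and gen: "carrier M = {(\<Oplus>\<^bsub>M\<^esub>a\<in>A. c a \<odot>\<^bsub>M\<^esub> a) | c. c \<in> A \<rightarrow> carrier R}"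
    using fg by (auto simp: finitely_generated_def)
  have inj: "inj_on f A" using bij A(2) by (meson bij_betw_def inj_on_subset)
  have cl: "f x \<in> carrier N" if "x \<in> carrier M" for x
    using f that by (auto simp: left_module_hom_def)
  have sm: "f (r \<odot>\<^bsub>M\<^esub> x) = r \<odot>\<^bsub>N\<^esub> f x" if "r \<in> carrier R" "x \<in> carrier M" for r x
    using f that by (auto simp: left_module_hom_def)
  have comb: "f (\<Oplus>\<^bsub>M\<^esub>a\<in>A. c a \<odot>\<^bsub>M\<^esub> a) = (\<Oplus>\<^bsub>N\<^esub>a\<in>A. c a \<odot>\<^bsub>N\<^esub> f a)"
    if c: "c \<in> A \<rightarrow> carrier R" for c
  proof -
    have "f (\<Oplus>\<^bsub>M\<^esub>a\<in>A. c a \<odot>\<^bsub>M\<^esub> a) = (\<Oplus>\<^bsub>N\<^esub>a\<in>A. f (c a \<odot>\<^bsub>M\<^esub> a))"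
      using c A by (intro left_module_hom_finsum[OF M N f]) auto
    also have "\<dots> = (\<Oplus>\<^bsub>N\<^esub>a\<in>A. c a \<odot>\<^bsub>N\<^esub> f a)"
      using c A cl by (intro N.M.finsum_cong') (auto simp: sm Pi_iff subset_iff)
    finally show ?thesis .
  qed
  have reindex: "(\<Oplus>\<^bsub>N\<^esub>b\<in>f ` A. d b \<odot>\<^bsub>N\<^esub> b) = (\<Oplus>\<^bsub>N\<^esub>a\<in>A. d (f a) \<odot>\<^bsub>N\<^esub> f a)"
    if d: "d \<in> f ` A \<rightarrow> carrier R" for d
    using d A cl inj by (subst N.M.finsum_reindex) (auto simp: Pi_iff subset_iff)
  have "carrier N = {(\<Oplus>\<^bsub>N\<^esub>b\<in>f ` A. d b \<odot>\<^bsub>N\<^esub> b) | d. d \<in> f ` A \<rightarrow> carrier R}"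
  proof (intro equalityI subsetI)
    fix y assume "y \<in> carrier N"
    then obtain x where "x \<in> carrier M" "y = f x"
      using bij by (auto simp: bij_betw_def)
    then obtain c where c: "c \<in> A \<rightarrow> carrier R" "y = f (\<Oplus>\<^bsub>M\<^esub>a\<in>A. c a \<odot>\<^bsub>M\<^esub> a)"
      using gen by auto
    define d where "d = (\<lambda>b. c (inv_into A f b))"
    have dc: "d (f a) = c a" if "a \<in> A" for a using that inj by (simp add: d_def)
    have d: "d \<in> f ` A \<rightarrow> carrier R" using c dc by auto
    have "(\<Oplus>\<^bsub>N\<^esub>a\<in>A. d (f a) \<odot>\<^bsub>N\<^esub> f a) = (\<Oplus>\<^bsub>N\<^esub>a\<in>A. c a \<odot>\<^bsub>N\<^esub> f a)"
      using c A cl by (intro N.M.finsum_cong') (auto simp: dc Pi_iff subset_iff)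
    hence "y = (\<Oplus>\<^bsub>N\<^esub>b\<in>f ` A. d b \<odot>\<^bsub>N\<^esub> b)"
      using c comb reindex[OF d] by simp
    thus "y \<in> {(\<Oplus>\<^bsub>N\<^esub>b\<in>f ` A. d b \<odot>\<^bsub>N\<^esub> b) | d. d \<in> f ` A \<rightarrow> carrier R}"
      using d by blast
  next
    fix y assume "y \<in> {(\<Oplus>\<^bsub>N\<^esub>b\<in>f ` A. d b \<odot>\<^bsub>N\<^esub> b) | d. d \<in> f ` A \<rightarrow> carrier R}"
    then obtain d where d: "d \<in> f ` A \<rightarrow> carrier R" "y = (\<Oplus>\<^bsub>N\<^esub>b\<in>f ` A. d b \<odot>\<^bsub>N\<^esub> b)" by blast
    show "y \<in> carrier N"
      using d A cl by (auto intro!: N.M.finsum_closed simp: Pi_iff subset_iff)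
  qed
  moreover have "finite (f ` A)" "f ` A \<subseteq> carrier N" using A cl by auto
  ultimately show ?thesis unfolding finitely_generated_def by blast
qed

lemma ex_isomorphic_fg_module:
  assumes M: "left_module R M" and fg: "finitely_generated R M"
  shows "\<exists>N\<in>fg_modules R. module_isomorphic R M N"
proof -
  interpret M: left_module R M by fact
  obtain A where A: "finite A" "A \<subseteq> carrier M"
    and gen: "carrier M = {(\<Oplus>\<^bsub>M\<^esub>a\<in>A. c a \<odot>\<^bsub>M\<^esub> a) | c. c \<in> A \<rightarrow> carrier R}"
    using fg by (auto simp: finitely_generated_def)
  obtain e :: "_ \<Rightarrow> nat" where e: "inj_on e A"
    using finite_imp_inj_to_nat_seg[OF A(1)] by blast
  define F where "F = (\<lambda>m. {c. (\<forall>a\<in>A. c (e a) \<in> carrier R) \<and> m = (\<Oplus>\<^bsub>M\<^esub>a\<in>A. c (e a) \<odot>\<^bsub>M\<^esub> a)})"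
  have ne: "F m \<noteq> {}" if "m \<in> carrier M" for m
  proof -
    have "\<exists>c. m = (\<Oplus>\<^bsub>M\<^esub>a\<in>A. c a \<odot>\<^bsub>M\<^esub> a) \<and> c \<in> A \<rightarrow> carrier R"
      using equalityD1[OF gen, THEN subsetD, OF that] by (rule CollectD)
    then obtain c where c: "c \<in> A \<rightarrow> carrier R" "m = (\<Oplus>\<^bsub>M\<^esub>a\<in>A. c a \<odot>\<^bsub>M\<^esub> a)"
      by (elim exE conjE)
    define d where "d = (\<lambda>i. c (inv_into A e i))"
    have dc: "d (e a) = c a" if "a \<in> A" for a
      using that e by (simp add: d_def)
    have "(\<Oplus>\<^bsub>M\<^esub>a\<in>A. d (e a) \<odot>\<^bsub>M\<^esub> a) = (\<Oplus>\<^bsub>M\<^esub>a\<in>A. c a \<odot>\<^bsub>M\<^esub> a)"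
      using c(1) A by (intro M.M.finsum_cong') (auto simp: dc Pi_iff subset_iff)
    moreover have "\<forall>a\<in>A. d (e a) \<in> carrier R"
      using c(1) dc by auto
    ultimately have "d \<in> F m"
      unfolding F_def c(2) by simp
    thus ?thesis by blast
  qed
  have "inj_on F (carrier M)"
  proof (rule inj_onI)
    fix x y assume "x \<in> carrier M" "y \<in> carrier M" "F x = F y"
    from ne[OF \<open>x \<in> carrier M\<close>] obtain c where "c \<in> F x" by auto
    moreover from this have "c \<in> F y" unfolding \<open>F x = F y\<close> .
    ultimately show "x = y" unfolding F_def mem_Collect_eq by metis
  qed
  note iso = M.transport_iso[OF this]
  show ?thesis
  proof (rule bexI)
    show "module_isomorphic R M
      \<lparr>carrier = F ` carrier M, monoid.mult = undefined, one = undefined, ring.zero = F \<zero>\<^bsub>M\<^esub>,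
       add = (\<lambda>x y. F (inv_into (carrier M) F x \<oplus>\<^bsub>M\<^esub> inv_into (carrier M) F y)),
       module.smult = (\<lambda>r x. F (r \<odot>\<^bsub>M\<^esub> inv_into (carrier M) F x))\<rparr>"
      unfolding module_isomorphic_def by (rule bexI[OF _ iso(2)], rule iso(3))
  next
    show "\<lparr>carrier = F ` carrier M, monoid.mult = undefined, one = undefined, ring.zero = F \<zero>\<^bsub>M\<^esub>,
       add = (\<lambda>x y. F (inv_into (carrier M) F x \<oplus>\<^bsub>M\<^esub> inv_into (carrier M) F y)),
       module.smult = (\<lambda>r x. F (r \<odot>\<^bsub>M\<^esub> inv_into (carrier M) F x))\<rparr> \<in> fg_modules R"
      unfolding fg_modules_def mem_Collect_eq
      by (rule conjI[OF iso(1) finitely_generated_image[OF M iso(1) fg iso(2,3)]])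
  qed
qed


section \<open>Free algebras\<close>

text \<open>
  The free algebra on \<^typ>\<open>'a\<close> is the monoid algebra of the free monoid on \<^typ>\<open>'a\<close>; the convolution
  product of \<^typ>\<open>'m \<Rightarrow>\<^sub>0 'k\<close> needs the monoid to be written additively.
\<close>

datatype 'a free_monoid = Word (letters: "'a list")

instantiation free_monoid :: (type) monoid_add
begin

definition zero_free_monoid :: "'a free_monoid" where "0 = Word []"

definition plus_free_monoid :: "'a free_monoid \<Rightarrow> 'a free_monoid \<Rightarrow> 'a free_monoid"
  where "v + w = Word (letters v @ letters w)"

instance
  by standard (simp_all add: zero_free_monoid_def plus_free_monoid_def)

end

type_synonym ('a, 'k) free_algebra = "'a free_monoid \<Rightarrow>\<^sub>0 'k"

definition free_gen :: "'a \<Rightarrow> ('a, 'k::field) free_algebra"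
  where "free_gen a = Poly_Mapping.single (Word [a]) 1"

definition free_const :: "'k::field \<Rightarrow> ('a, 'k) free_algebra"
  where "free_const c = Poly_Mapping.single 0 c"

text \<open>The action on \<^typ>\<open>'k poly\<close> of the free algebra in which the generator \<open>a\<close> acts as \<open>T a\<close>.\<close>

definition free_act ::
    "('a \<Rightarrow> 'k poly \<Rightarrow> 'k poly) \<Rightarrow> ('a, 'k::field) free_algebra \<Rightarrow> 'k poly \<Rightarrow> 'k poly"
  where "free_act T a f =
    (\<Sum>w\<in>Poly_Mapping.keys a. Polynomial.smult (Poly_Mapping.lookup a w) (foldr T (letters w) f))"


section \<open>The Smith algebra\<close>

datatype smith_gen = Gen_x | Gen_y | Gen_h

abbreviation "gen_x \<equiv> free_gen Gen_x"
abbreviation "gen_y \<equiv> free_gen Gen_y"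
abbreviation "gen_h \<equiv> free_gen Gen_h"

type_synonym 'k smith = "(smith_gen, 'k) free_algebra set"

definition smith_ideal :: "'k::field poly \<Rightarrow> (smith_gen, 'k) free_algebra set"
  where "smith_ideal g = Idl\<^bsub>ring_of_type_algebra\<^esub>
    {gen_h * gen_y - gen_y * gen_h - gen_y,
     gen_h * gen_x - gen_x * gen_h + gen_x,
     gen_y * gen_x - gen_x * gen_y
       - (\<Sum>i\<le>Polynomial.degree g. free_const (Polynomial.coeff g i) * gen_h ^ i)}"

definition smith_algebra :: "'k::field poly \<Rightarrow> 'k smith ring"
  where "smith_algebra g = ring_of_type_algebra Quot smith_ideal g"

definition smith_elem :: "'k::field poly \<Rightarrow> (smith_gen, 'k) free_algebra \<Rightarrow> 'k smith"
  where "smith_elem g a = smith_ideal g +>\<^bsub>ring_of_type_algebra\<^esub> a"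


section \<open>Verma modules\<close>

text \<open>The subalgebra generated by \<open>h\<close> and \<open>y\<close>: the scalars are among the ring generators.\<close>

definition smith_borel :: "'k::field poly \<Rightarrow> 'k smith set"
  where "smith_borel g = generate_ring (smith_algebra g)
    (smith_elem g ` (range free_const \<union> {gen_h, gen_y}))"

text \<open>
  An algebra over \<^typ>\<open>'k::field\<close> acts on a one-dimensional space through an algebra homomorphism to \<^typ>\<open>'k::field\<close>.
  The one below is determined by its values on the generators \<open>h\<close> and \<open>y\<close>.  The basis vector of
  \<open>one_dim_module g \<mu>\<close> is \<open>1\<close>.
\<close>

definition borel_character :: "'k::field poly \<Rightarrow> 'k \<Rightarrow> 'k smith \<Rightarrow> 'k"
  where "borel_character g \<mu> =
    (THE \<chi>. \<chi> \<in> ring_hom ((smith_algebra g)\<lparr>carrier := smith_borel g\<rparr>) ring_of_type_algebra \<and>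
       \<chi> \<in> extensional (smith_borel g) \<and>
       (\<forall>c. \<chi> (smith_elem g (free_const c)) = c) \<and>
       \<chi> (smith_elem g gen_h) = \<mu> \<and> \<chi> (smith_elem g gen_y) = 0)"

definition one_dim_module :: "'k::field poly \<Rightarrow> 'k \<Rightarrow> ('k smith, 'k) module"
  where "one_dim_module g \<mu> =
    \<lparr>carrier = UNIV, monoid.mult = undefined, one = undefined, ring.zero = 0, add = (+),
     module.smult = (\<lambda>b v. borel_character g \<mu> b * v)\<rparr>"

definition verma :: "'k::field poly \<Rightarrow> 'k \<Rightarrow> ('k smith, ('k smith \<times> 'k \<Rightarrow>\<^sub>0 int) set) module"
  where "verma g \<mu> = induced_module (smith_algebra g) (smith_borel g) (one_dim_module g \<mu>)"

definition verma_simple :: "'k::field poly \<Rightarrow> 'k \<Rightarrow> ('k smith, ('k smith \<times> 'k \<Rightarrow>\<^sub>0 int) set set) module"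
  where "verma_simple g \<mu> =
    quotient_module (verma g \<mu>) (THE N. maximal_submodule (smith_algebra g) (verma g \<mu>) N)"


section \<open>The modules \<open>A\<^sub>C(X)\<close>\<close>

abbreviation shift :: "'k::field \<Rightarrow> 'k poly \<Rightarrow> 'k poly"
  where "shift c f \<equiv> pcompose f [:c, 1:]"

definition root_poly :: "'k::field multiset \<Rightarrow> 'k poly"
  where "root_poly Xs = (\<Prod>\<alpha>\<in>#Xs. [:-\<alpha>, 1:])"

text \<open>
  For \<open>Xs \<subseteq># proots (u + [:C:])\<close> the polynomial \<open>root_poly Xs\<close> divides \<open>u + [:C:]\<close>, so the division
  below is exact.
\<close>

fun smith_act :: "'k::field poly \<Rightarrow> 'k \<Rightarrow> 'k multiset \<Rightarrow> smith_gen \<Rightarrow> 'k poly \<Rightarrow> 'k poly"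
  where
    "smith_act u C Xs Gen_x f = shift 1 f * root_poly Xs"
  | "smith_act u C Xs Gen_y f =
      shift (-1) f * ((shift (-1) u + [:C:]) div shift (-1) (root_poly Xs))"
  | "smith_act u C Xs Gen_h f = [:0, 1:] * f"

text \<open>
  An element of the Smith algebra is a coset \<open>T\<close> of the free algebra, all of whose members act in
  the same way.
\<close>

definition A_module :: "'k::field poly \<Rightarrow> 'k \<Rightarrow> 'k multiset \<Rightarrow> ('k smith, 'k poly) module"
  where "A_module u C Xs =
    \<lparr>carrier = UNIV, monoid.mult = undefined, one = undefined, ring.zero = 0, add = (+),
     module.smult = (\<lambda>T f. the_elem ((\<lambda>a. free_act (smith_act u C Xs) a f) ` T))\<rparr>"

definition socle_multiset :: "'k::field poly \<Rightarrow> 'k poly \<Rightarrow> 'k \<Rightarrow> 'k multiset \<Rightarrow> 'k multiset"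
  where "socle_multiset g u C Xs =
    (THE Y. Y \<subseteq># proots (u + [:C:]) \<and>
       module_isomorphic (smith_algebra g)
         ((A_module u C Xs)\<lparr>carrier := socle (smith_algebra g) (A_module u C Xs)\<rparr>)
         (A_module u C Y))"


section \<open>Multiplicities\<close>

definition root_le :: "'k::field_char_0 \<Rightarrow> 'k \<Rightarrow> bool"  (infix \<open>\<preceq>\<close> 50)
  where "\<alpha> \<preceq> \<beta> \<longleftrightarrow> (\<exists>n::nat. \<beta> - \<alpha> = of_nat n)"

definition root_less :: "'k::field_char_0 \<Rightarrow> 'k \<Rightarrow> bool"  (infix \<open>\<prec>\<close> 50)
  where "\<alpha> \<prec> \<beta> \<longleftrightarrow> \<alpha> \<preceq> \<beta> \<and> \<alpha> \<noteq> \<beta>"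

definition varphi :: "'k::field_char_0 poly \<Rightarrow> 'k \<Rightarrow> 'k multiset \<Rightarrow> 'k \<Rightarrow> nat"
  where "varphi u C Z \<beta> =
    min (size {#\<alpha> \<in># proots (u + [:C:]) - Z. \<alpha> \<prec> \<beta>#}) (size {#\<alpha> \<in># Z. \<beta> \<preceq> \<alpha>#})"

end

theory Submission
  imports Defs
begin

text \<open>
  The module \<open>A\<^sub>C(X)\<close> is a polynomial ring, its submodules are ideals, and its composition factors other
  than the socle can be split off from the top one at a time.  Write \<open>R\<close> for the multiset of roots of \<open>u + C\<close>.

  Let \<open>a \<prec> b\<close> be roots with no root strictly between them, \<open>a\<close> in the complement \<open>R - X\<close> and \<open>b\<close> in \<open>X\<close>,
  and let \<open>f\<close> be the product of the \<open>h - c\<close> for \<open>c = a + 1, \<dots>, b\<close>.  Shifting \<open>f\<close> by one replaces only one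
  of its linear factors, and therefore multiplication by \<open>f\<close> embeds \<open>A\<^sub>C(X')\<close> into \<open>A\<^sub>C(X)\<close>, where \<open>X'\<close>
  is \<open>X\<close> with one copy of \<open>b\<close> exchanged for \<open>a\<close>.  The quotient \<open>k[h]/(f)\<close> has the weights
  \<open>a + 1, \<dots>, b\<close>; as none of \<open>a + 1, \<dots>, b - 1\<close> is a root, it is simple, and its top weight
  vector is killed by \<open>y\<close>.  So it is \<open>L(b)\<close>, and \<open>[A\<^sub>C(X)] = [A\<^sub>C(X')] + [L(b)]\<close> (\<open>K0_lowering\<close>).  On
  the combinatorial side \<open>\<phi>\<close> drops by one at \<open>b\<close> and is unchanged at every other root (\<open>varphi_lowering\<close>).

  When there is no such pair, no element of \<open>R - X\<close> lies below an element of \<open>X\<close> at all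
  (\<open>ex_adjacent_pair\<close>).  Then \<open>\<phi>\<close> vanishes, and \<open>A\<^sub>C(X)\<close> is simple: the roots of a generator of a proper
  nonzero submodule would form strings with top in \<open>X\<close> and with the number just below the bottom in
  \<open>R - X\<close> (\<open>A_simple\<close>).  Induction on the sum of the values of \<open>\<phi>\<close> gives the formula with some
  simple submodule \<open>A\<^sub>C(Y)\<close> in place of the socle (\<open>A_filtration\<close>).  Since nonzero ideals of \<open>k[h]\<close>
  meet, there is only one simple submodule, so \<open>A\<^sub>C(Y)\<close> is the socle; and \<open>Y\<close> is determined by it, because
  an isomorphism commutes with \<open>h\<close> and so is multiplication by a constant (\<open>socle_multiset_eq\<close>).

  To recognize \<open>L(\<mu>)\<close> in a simple module \<open>M\<close> with a vector \<open>v\<close> of weight \<open>\<mu>\<close> killed by \<open>y\<close>, map the Verma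
  module onto \<open>M\<close>.  The kernel is a maximal submodule, and it remains to see that there is no other one
  (\<open>maximal_submodule_unique\<close>).  The Verma module is cyclic, and modulo the annihilator of its generator
  every element of the free algebra on \<open>x\<close>, \<open>y\<close>, \<open>h\<close> is a polynomial in \<open>x\<close> (\<open>ex_eval_x\<close>); those in a
  proper left ideal have constant coefficient \<open>0\<close> (\<open>eval_x_constant_coeff\<close>), which is preserved by sums.
\<close>

section \<open>Homomorphisms, submodules and quotients of left modules\<close>

lemma left_module_homI:
  assumes "\<And>x. x \<in> carrier M \<Longrightarrow> f x \<in> carrier N"
    and "\<And>x y. \<lbrakk>x \<in> carrier M; y \<in> carrier M\<rbrakk> \<Longrightarrow> f (x \<oplus>\<^bsub>M\<^esub> y) = f x \<oplus>\<^bsub>N\<^esub> f y"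
    and "\<And>r x. \<lbrakk>r \<in> carrier R; x \<in> carrier M\<rbrakk> \<Longrightarrow> f (r \<odot>\<^bsub>M\<^esub> x) = r \<odot>\<^bsub>N\<^esub> f x"
  shows "f \<in> left_module_hom R M N"
  using assms by (auto simp: left_module_hom_def)

lemma left_module_homD:
  assumes "f \<in> left_module_hom R M N"
  shows "x \<in> carrier M \<Longrightarrow> f x \<in> carrier N"
    and "\<lbrakk>x \<in> carrier M; y \<in> carrier M\<rbrakk> \<Longrightarrow> f (x \<oplus>\<^bsub>M\<^esub> y) = f x \<oplus>\<^bsub>N\<^esub> f y"
    and "\<lbrakk>r \<in> carrier R; x \<in> carrier M\<rbrakk> \<Longrightarrow> f (r \<odot>\<^bsub>M\<^esub> x) = r \<odot>\<^bsub>N\<^esub> f x"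
  using assms by (auto simp: left_module_hom_def)

lemma left_module_hom_zero:
  assumes "left_module R M" "left_module R N" "f \<in> left_module_hom R M N"
  shows "f \<zero>\<^bsub>M\<^esub> = \<zero>\<^bsub>N\<^esub>"
proof -
  interpret M: left_module R M by fact
  interpret N: left_module R N by fact
  have "f \<zero>\<^bsub>M\<^esub> \<oplus>\<^bsub>N\<^esub> f \<zero>\<^bsub>M\<^esub> = f \<zero>\<^bsub>M\<^esub>"
    using left_module_homD(2)[OF assms(3), of "\<zero>\<^bsub>M\<^esub>" "\<zero>\<^bsub>M\<^esub>"] by simp
  then show ?thesis
    by (metis M.M.zero_closed N.M.add.r_cancel_one left_module_homD(1)[OF assms(3)])
qed

lemma left_module_hom_comp:
  assumes "f \<in> left_module_hom R L M" "g \<in> left_module_hom R M N"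
  shows "g \<circ> f \<in> left_module_hom R L N"
  by (rule left_module_homI)
    (simp_all add: left_module_homD[OF assms(1)] left_module_homD[OF assms(2)])

lemma left_module_hom_inv:
  assumes M: "left_module R M" and f: "f \<in> left_module_hom R M N"
    and bij: "bij_betw f (carrier M) (carrier N)"
  shows "inv_into (carrier M) f \<in> left_module_hom R N M"
proof (rule left_module_homI)
  interpret M: left_module R M by fact
  let ?g = "inv_into (carrier M) f"
  have img: "f ` carrier M = carrier N" and inj: "inj_on f (carrier M)"
    using bij by (auto simp: bij_betw_def)
  have gf: "?g (f a) = a" if "a \<in> carrier M" for a
    using that inj by simp
  have ex: "\<exists>a\<in>carrier M. x = f a" if "x \<in> carrier N" for x
    using that img by auto
  show "?g x \<in> carrier M" if "x \<in> carrier N" for x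
    using ex[OF that] gf by auto
  show "?g (x \<oplus>\<^bsub>N\<^esub> y) = ?g x \<oplus>\<^bsub>M\<^esub> ?g y" if xy: "x \<in> carrier N" "y \<in> carrier N" for x y
  proof -
    obtain a b where "a \<in> carrier M" "x = f a" "b \<in> carrier M" "y = f b"
      using ex xy by metis
    then show ?thesis
      by (simp add: left_module_homD(2)[OF f, symmetric] gf)
  qed
  show "?g (r \<odot>\<^bsub>N\<^esub> x) = r \<odot>\<^bsub>M\<^esub> ?g x" if rx: "r \<in> carrier R" "x \<in> carrier N" for r x
  proof -
    obtain a where "a \<in> carrier M" "x = f a"
      using ex rx by metis
    then show ?thesis
      using rx by (simp add: left_module_homD(3)[OF f, symmetric] gf)
  qed
qed

lemma submoduleI:
  assumes M: "left_module R M" and sub: "N \<subseteq> carrier M" and zero: "\<zero>\<^bsub>M\<^esub> \<in> N"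
    and add: "\<And>x y. \<lbrakk>x \<in> N; y \<in> N\<rbrakk> \<Longrightarrow> x \<oplus>\<^bsub>M\<^esub> y \<in> N"
    and smult: "\<And>r x. \<lbrakk>r \<in> carrier R; x \<in> N\<rbrakk> \<Longrightarrow> r \<odot>\<^bsub>M\<^esub> x \<in> N"
  shows "submodule N R M"
proof -
  interpret M: left_module R M by fact
  have neg: "\<ominus>\<^bsub>M\<^esub> x \<in> N" if x: "x \<in> N" for x
  proof -
    have xc: "x \<in> carrier M" using x sub by auto
    have "(\<ominus>\<^bsub>R\<^esub> \<one>\<^bsub>R\<^esub>) \<odot>\<^bsub>M\<^esub> x \<oplus>\<^bsub>M\<^esub> \<one>\<^bsub>R\<^esub> \<odot>\<^bsub>M\<^esub> x = \<zero>\<^bsub>R\<^esub> \<odot>\<^bsub>M\<^esub> x"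
      using xc by (simp only: M.smult_l_distr[symmetric] M.R.one_closed M.R.a_inv_closed M.R.l_neg)
    moreover have "\<zero>\<^bsub>R\<^esub> \<odot>\<^bsub>M\<^esub> x = \<zero>\<^bsub>M\<^esub>"
    proof -
      have "\<zero>\<^bsub>R\<^esub> \<odot>\<^bsub>M\<^esub> x \<oplus>\<^bsub>M\<^esub> \<zero>\<^bsub>R\<^esub> \<odot>\<^bsub>M\<^esub> x = \<zero>\<^bsub>R\<^esub> \<odot>\<^bsub>M\<^esub> x"
        using xc by (simp add: M.smult_l_distr[symmetric])
      then show ?thesis using xc by (metis M.M.add.r_cancel_one M.R.zero_closed M.smult_closed)
    qed
    ultimately have "(\<ominus>\<^bsub>R\<^esub> \<one>\<^bsub>R\<^esub>) \<odot>\<^bsub>M\<^esub> x = \<ominus>\<^bsub>M\<^esub> x"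
      using xc by (simp add: M.M.minus_equality)
    then show ?thesis using smult[OF _ x, of "\<ominus>\<^bsub>R\<^esub> \<one>\<^bsub>R\<^esub>"] by simp
  qed
  show ?thesis
  proof (intro submodule.intro submodule_axioms.intro)
    show "subgroup N (add_monoid M)"
      by (rule subgroup.intro) (use sub zero add neg in \<open>auto simp: a_inv_def\<close>)
  qed (rule smult)
qed

lemma submoduleD:
  assumes "submodule N R M"
  shows "N \<subseteq> carrier M" "\<zero>\<^bsub>M\<^esub> \<in> N"
    and "\<lbrakk>x \<in> N; y \<in> N\<rbrakk> \<Longrightarrow> x \<oplus>\<^bsub>M\<^esub> y \<in> N"
    and "\<lbrakk>r \<in> carrier R; x \<in> N\<rbrakk> \<Longrightarrow> r \<odot>\<^bsub>M\<^esub> x \<in> N"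
    and "subgroup N (add_monoid M)"
proof -
  interpret submodule N R M by fact
  show "N \<subseteq> carrier M" "\<zero>\<^bsub>M\<^esub> \<in> N" 
    and "\<lbrakk>x \<in> N; y \<in> N\<rbrakk> \<Longrightarrow> x \<oplus>\<^bsub>M\<^esub> y \<in> N"
    and "\<lbrakk>r \<in> carrier R; x \<in> N\<rbrakk> \<Longrightarrow> r \<odot>\<^bsub>M\<^esub> x \<in> N"
    using subset one_closed m_closed by auto
  show "subgroup N (add_monoid M)" by (rule subgroup_axioms)
qed

lemma (in left_module) submodule_is_left_module:
  assumes "submodule N R M"
  shows "left_module R (M\<lparr>carrier := N\<rparr>)"
proof (intro left_module.intro left_module_axioms.intro R.ring_axioms)
  note N = submoduleD[OF assms]
  have sub: "x \<in> carrier M" if "x \<in> N" for x using N(1) that by auto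
  show "abelian_group (M\<lparr>carrier := N\<rparr>)"
  proof (rule abelian_groupI)
    fix x assume "x \<in> carrier (M\<lparr>carrier := N\<rparr>)"
    then have x: "x \<in> N" by simp
    have "\<ominus>\<^bsub>M\<^esub> x \<in> N"
      using subgroup.m_inv_closed[OF N(5) x] by (simp add: a_inv_def)
    then show "\<exists>y\<in>carrier (M\<lparr>carrier := N\<rparr>). y \<oplus>\<^bsub>M\<lparr>carrier := N\<rparr>\<^esub> x = \<zero>\<^bsub>M\<lparr>carrier := N\<rparr>\<^esub>"
      using sub[OF x] by (intro bexI[of _ "\<ominus>\<^bsub>M\<^esub> x"]) (auto simp: M.l_neg)
  qed (use N sub in \<open>auto simp: M.a_assoc M.a_comm M.a_lcomm\<close>)
qed (use submoduleD[OF assms] in \<open>auto simp: smult_l_distr smult_r_distr smult_assoc1 subset_iff\<close>)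

lemma submodule_kernel:
  assumes M: "left_module R M" and N: "left_module R N" and f: "f \<in> left_module_hom R M N"
  shows "submodule {x \<in> carrier M. f x = \<zero>\<^bsub>N\<^esub>} R M"
proof -
  interpret M: left_module R M by fact
  interpret N: left_module R N by fact
  have z: "r \<odot>\<^bsub>N\<^esub> \<zero>\<^bsub>N\<^esub> = \<zero>\<^bsub>N\<^esub>" if "r \<in> carrier R" for r
    using that N.smult_r_distr[of r "\<zero>\<^bsub>N\<^esub>" "\<zero>\<^bsub>N\<^esub>"]
    by (metis N.M.add.r_cancel_one N.M.l_zero N.M.zero_closed N.smult_closed)
  show ?thesis
    by (rule submoduleI[OF M])
      (auto simp: left_module_homD[OF f] left_module_hom_zero[OF M N f] z)
qed

lemma submodule_image:
  assumes M: "left_module R M" and N: "left_module R N" and f: "f \<in> left_module_hom R M N"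
    and L: "submodule L R M"
  shows "submodule (f ` L) R N"
proof (rule submoduleI[OF N])
  note L' = submoduleD[OF L]
  show "f ` L \<subseteq> carrier N" using L'(1) left_module_homD(1)[OF f] by auto
  show "\<zero>\<^bsub>N\<^esub> \<in> f ` L" using left_module_hom_zero[OF M N f] L'(2) by (metis imageI)
  show "x \<oplus>\<^bsub>N\<^esub> y \<in> f ` L" if xy: "x \<in> f ` L" "y \<in> f ` L" for x y
  proof -
    obtain a b where ab: "a \<in> L" "x = f a" "b \<in> L" "y = f b" using xy by auto
    then have "x \<oplus>\<^bsub>N\<^esub> y = f (a \<oplus>\<^bsub>M\<^esub> b)" using subsetD[OF L'(1)] by (simp add: left_module_homD(2)[OF f])
    then show ?thesis using L'(3) ab by auto
  qed
  show "r \<odot>\<^bsub>N\<^esub> x \<in> f ` L" if rx: "r \<in> carrier R" "x \<in> f ` L" for r x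
  proof -
    obtain a where a: "a \<in> L" "x = f a" using rx by auto
    then have "r \<odot>\<^bsub>N\<^esub> x = f (r \<odot>\<^bsub>M\<^esub> a)" using subsetD[OF L'(1)] rx by (simp add: left_module_homD(3)[OF f])
    then show ?thesis using L'(4) a rx by auto
  qed
qed

lemma submodule_preimage:
  assumes M: "left_module R M" and f: "f \<in> left_module_hom R M N"
    and N: "left_module R N" and L: "submodule L R N"
  shows "submodule {x \<in> carrier M. f x \<in> L} R M"
proof -
  interpret M: left_module R M by fact
  show ?thesis
    by (rule submoduleI[OF M])
      (auto simp: left_module_homD[OF f] left_module_hom_zero[OF M N f] submoduleD[OF L])
qed

text \<open>
  In the free abelian group underlying a tensor product the scalars act additively, but the other axioms of
  a module hold only modulo the balanced relations.  So they are not asked of \<open>P\<close> itself.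
\<close>

locale operator_quotient = abelian_subgroup N P + R: ring R
  for N and P :: "('r, 'm, 'd) module_scheme" (structure) and R :: "('r, 'c) ring_scheme" +
  assumes operator_closed: "\<lbrakk>r \<in> carrier R; x \<in> carrier P\<rbrakk> \<Longrightarrow> r \<odot> x \<in> carrier P"
    and operator_stable: "\<lbrakk>r \<in> carrier R; x \<in> N\<rbrakk> \<Longrightarrow> r \<odot> x \<in> N"
    and operator_add: "\<lbrakk>r \<in> carrier R; x \<in> carrier P; y \<in> carrier P\<rbrakk> \<Longrightarrow>
      r \<odot> (x \<oplus> y) = r \<odot> x \<oplus> r \<odot> y"
begin

lemma quotient_carrier: "carrier (quotient_module P N) = (\<lambda>x. N +> x) ` carrier P"
  by (auto simp: quotient_module_def A_RCOSETS_def')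

lemma quotient_add:
  "\<lbrakk>x \<in> carrier P; y \<in> carrier P\<rbrakk> \<Longrightarrow> (N +> x) \<oplus>\<^bsub>quotient_module P N\<^esub> (N +> y) = N +> (x \<oplus> y)"
  by (simp add: quotient_module_def a_rcos_sum)

lemma quotient_zero: "\<zero>\<^bsub>quotient_module P N\<^esub> = N"
  by (simp add: quotient_module_def)

lemma coset_eq_iff:
  assumes "x \<in> carrier P" "y \<in> carrier P"
  shows "N +> x = N +> y \<longleftrightarrow> x \<ominus> y \<in> N"
proof
  assume eq: "N +> x = N +> y"
  have "x \<in> N +> y" using a_rcos_self[OF assms(1)] eq by simp
  then show "x \<ominus> y \<in> N"
    using a_rcos_module[OF assms(2,1)] by (simp add: a_minus_def)
next
  assume "x \<ominus> y \<in> N"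
  then have "x \<in> N +> y"
    using a_rcos_module[OF assms(2,1)] by (simp add: a_minus_def)
  then show "N +> x = N +> y"
    using a_repr_independence'[OF _ assms(2)] by simp
qed

lemma quotient_smult:
  assumes r: "r \<in> carrier R" and x: "x \<in> carrier P"
  shows "r \<odot>\<^bsub>quotient_module P N\<^esub> (N +> x) = N +> (r \<odot> x)"
proof -
  have const: "N +> (r \<odot> z) = N +> (r \<odot> x)" if "z \<in> N +> x" for z
  proof -
    obtain n where n: "n \<in> N" "z = n \<oplus> x"
      using \<open>z \<in> N +> x\<close> by (auto simp: a_r_coset_def')
    have nc: "n \<in> carrier P" using n by (simp add: a_Hcarr)
    have "r \<odot> z \<in> N +> (r \<odot> x)"
      using n nc r x by (auto simp: operator_add a_r_coset_def' operator_stable)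
    then show ?thesis
      using a_repr_independence'[of "r \<odot> z" "r \<odot> x"] operator_closed[OF r x] by simp
  qed
  have "r \<odot>\<^bsub>quotient_module P N\<^esub> (N +> x) = (\<Union>z\<in>N +> x. N +> (r \<odot> z))"
    by (simp add: quotient_module_def)
  also have "\<dots> = (\<Union>z\<in>N +> x. N +> (r \<odot> x))"
    by (rule SUP_cong[OF refl const])
  also have "\<dots> = N +> (r \<odot> x)"
    using a_rcos_self[OF x] by auto
  finally show ?thesis .
qed

lemma quotient_left_module:
  assumes "\<And>a b x. \<lbrakk>a \<in> carrier R; b \<in> carrier R; x \<in> carrier P\<rbrakk> \<Longrightarrow>
      N +> ((a \<oplus>\<^bsub>R\<^esub> b) \<odot> x) = N +> (a \<odot> x \<oplus> b \<odot> x)"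
    and "\<And>a b x. \<lbrakk>a \<in> carrier R; b \<in> carrier R; x \<in> carrier P\<rbrakk> \<Longrightarrow>
      N +> ((a \<otimes>\<^bsub>R\<^esub> b) \<odot> x) = N +> (a \<odot> (b \<odot> x))"
    and "\<And>x. x \<in> carrier P \<Longrightarrow> N +> (\<one>\<^bsub>R\<^esub> \<odot> x) = N +> x"
  shows "left_module R (quotient_module P N)"
proof (intro left_module.intro left_module_axioms.intro)
  show "ring R" by (rule R.ring_axioms)
  show "abelian_group (quotient_module P N)"
  proof (rule abelian_groupI)
    have cl: "N +> x \<in> carrier (quotient_module P N)" if "x \<in> carrier P" for x
      using that by (auto simp: quotient_carrier)
    have z: "\<zero>\<^bsub>quotient_module P N\<^esub> = N +> \<zero>"
      by (simp add: quotient_zero a_subset)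
    show "\<zero>\<^bsub>quotient_module P N\<^esub> \<in> carrier (quotient_module P N)"
      by (simp add: z cl)
    fix S assume "S \<in> carrier (quotient_module P N)"
    then obtain x where x: "x \<in> carrier P" "S = N +> x" by (auto simp: quotient_carrier)
    show "\<exists>T\<in>carrier (quotient_module P N). T \<oplus>\<^bsub>quotient_module P N\<^esub> S = \<zero>\<^bsub>quotient_module P N\<^esub>"
      using x by (intro bexI[of _ "N +> (\<ominus> x)"]) (auto simp: z cl quotient_add l_neg)
    show "\<zero>\<^bsub>quotient_module P N\<^esub> \<oplus>\<^bsub>quotient_module P N\<^esub> S = S"
      using x by (simp add: z quotient_add)
  qed (auto simp: quotient_carrier quotient_add a_assoc a_comm a_lcomm)
qed (auto simp: quotient_carrier quotient_add quotient_smult assms operator_closed operator_add)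

lemma quotient_induced_hom:
  assumes M: "left_module R M" and cl: "\<And>x. x \<in> carrier P \<Longrightarrow> f x \<in> carrier M"
    and add: "\<And>x y. \<lbrakk>x \<in> carrier P; y \<in> carrier P\<rbrakk> \<Longrightarrow> f (x \<oplus> y) = f x \<oplus>\<^bsub>M\<^esub> f y"
    and smult: "\<And>r x. \<lbrakk>r \<in> carrier R; x \<in> carrier P\<rbrakk> \<Longrightarrow> f (r \<odot> x) = r \<odot>\<^bsub>M\<^esub> f x"
    and zero: "\<And>x. x \<in> N \<Longrightarrow> f x = \<zero>\<^bsub>M\<^esub>"
  obtains F where "F \<in> left_module_hom R (quotient_module P N) M"
    and "\<And>x. x \<in> carrier P \<Longrightarrow> F (N +> x) = f x"
proof -
  interpret M: left_module R M by fact
  define F where "F = (\<lambda>T. the_elem (f ` T))"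
  have F: "F (N +> x) = f x" if x: "x \<in> carrier P" for x
  proof -
    have const: "f z = f x" if "z \<in> N +> x" for z
    proof -
      obtain n where n: "n \<in> N" "z = n \<oplus> x"
        using \<open>z \<in> N +> x\<close> by (auto simp: a_r_coset_def')
      then show ?thesis
        using x by (simp add: add zero cl a_Hcarr)
    qed
    have "f ` (N +> x) = (\<lambda>_. f x) ` (N +> x)" by (rule image_cong[OF refl const])
    also have "\<dots> = {f x}" using a_rcos_self[OF x] by auto
    finally show ?thesis by (simp add: F_def)
  qed
  have "F \<in> left_module_hom R (quotient_module P N) M"
    by (rule left_module_homI)
      (auto simp: quotient_carrier F cl quotient_add add quotient_smult smult operator_closed)
  then show thesis using F that by blast
qed

lemma quotient_iso:
  assumes M: "left_module R M" and cl: "\<And>x. x \<in> carrier P \<Longrightarrow> f x \<in> carrier M"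
    and add: "\<And>x y. \<lbrakk>x \<in> carrier P; y \<in> carrier P\<rbrakk> \<Longrightarrow> f (x \<oplus> y) = f x \<oplus>\<^bsub>M\<^esub> f y"
    and smult: "\<And>r x. \<lbrakk>r \<in> carrier R; x \<in> carrier P\<rbrakk> \<Longrightarrow> f (r \<odot> x) = r \<odot>\<^bsub>M\<^esub> f x"
    and ker: "\<And>x. x \<in> carrier P \<Longrightarrow> f x = \<zero>\<^bsub>M\<^esub> \<longleftrightarrow> x \<in> N"
    and surj: "f ` carrier P = carrier M"
  shows "\<exists>F\<in>left_module_hom R (quotient_module P N) M.
    bij_betw F (carrier (quotient_module P N)) (carrier M)"
proof -
  interpret M: left_module R M by fact
  have "f x = \<zero>\<^bsub>M\<^esub>" if "x \<in> N" for x
    using that ker a_Hcarr by blast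
  then obtain F where hom: "F \<in> left_module_hom R (quotient_module P N) M"
    and F: "\<And>x. x \<in> carrier P \<Longrightarrow> F (N +> x) = f x"
    using quotient_induced_hom[OF M cl add smult] by blast
  have eq: "N +> x = N +> y" if xy: "x \<in> carrier P" "y \<in> carrier P" "f x = f y" for x y
  proof -
    have "f (x \<ominus> y) \<oplus>\<^bsub>M\<^esub> f y = f x"
      using xy by (simp add: add[symmetric] a_minus_def a_assoc l_neg)
    then have "f (x \<ominus> y) = \<zero>\<^bsub>M\<^esub>"
      using xy cl by (metis M.M.add.r_cancel_one' minus_closed)
    then show ?thesis using xy ker coset_eq_iff by auto
  qed
  have "inj_on F (carrier (quotient_module P N))"
    unfolding quotient_carrier
  proof (rule inj_onI, elim imageE)
    fix S T x y
    assume *: "F S = F T" "S = N +> x" "x \<in> carrier P" "T = N +> y" "y \<in> carrier P"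
    then have "f x = f y" by (simp add: F)
    then show "S = T" using * eq by blast
  qed
  moreover have "F ` carrier (quotient_module P N) = carrier M"
    unfolding quotient_carrier image_image surj[symmetric] by (rule image_cong[OF refl F])
  ultimately show ?thesis using hom by (auto simp: bij_betw_def)
qed

end

lemma (in left_module) operator_quotientI:
  assumes "submodule N R M"
  shows "operator_quotient N M R"
proof (intro operator_quotient.intro operator_quotient_axioms.intro R.ring_axioms)
  show "abelian_subgroup N M"
    by (rule abelian_subgroupI2[OF M.a_comm_group submoduleD(5)[OF assms]])
qed (use submoduleD[OF assms] in \<open>auto simp: smult_r_distr\<close>)

lemma finitely_generated_cyclic:
  assumes M: "left_module R M" and m: "m \<in> carrier M"
    and gen: "carrier M = (\<lambda>r. r \<odot>\<^bsub>M\<^esub> m) ` carrier R"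
  shows "finitely_generated R M"
proof -
  interpret M: left_module R M by fact
  let ?comb = "\<lambda>c. \<Oplus>\<^bsub>M\<^esub>a\<in>{m}. c a \<odot>\<^bsub>M\<^esub> a"
  have comb: "?comb c = c m \<odot>\<^bsub>M\<^esub> m" if "c \<in> {m} \<rightarrow> carrier R" for c
    using that m M.M.finsum_insert[of "{}" m "\<lambda>a. c a \<odot>\<^bsub>M\<^esub> a"] by (simp add: Pi_iff)
  have "carrier M = {?comb c | c. c \<in> {m} \<rightarrow> carrier R}"
  proof (intro equalityI subsetI)
    fix x assume "x \<in> carrier M"
    then obtain r where r: "r \<in> carrier R" "x = r \<odot>\<^bsub>M\<^esub> m" unfolding gen by blast
    then have "x = ?comb (\<lambda>_. r)" by (subst comb) auto
    with r(1) show "x \<in> {?comb c | c. c \<in> {m} \<rightarrow> carrier R}"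
      by (intro CollectI exI[of _ "\<lambda>_. r"]) simp
  next
    fix x assume "x \<in> {?comb c | c. c \<in> {m} \<rightarrow> carrier R}"
    then obtain c where c: "c \<in> {m} \<rightarrow> carrier R" "x = ?comb c" by blast
    then show "x \<in> carrier M" using comb[OF c(1)] m by (auto simp: Pi_iff)
  qed
  moreover have "finite {m}" "{m} \<subseteq> carrier M" using m by auto
  ultimately show ?thesis
    unfolding finitely_generated_def by (intro exI[of _ "{m}"] conjI)
qed

section \<open>The Grothendieck group\<close>

lemma iso_class_cong:
  assumes M: "left_module R M" and f: "f \<in> left_module_hom R M N"
    and bij: "bij_betw f (carrier M) (carrier N)"
  shows "iso_class R N = iso_class R M"
proof -
  have fi: "inv_into (carrier M) f \<in> left_module_hom R N M"
    by (rule left_module_hom_inv[OF M f bij])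
  have bi: "bij_betw (inv_into (carrier M) f) (carrier N) (carrier M)"
    by (rule bij_betw_inv_into[OF bij])
  have "module_isomorphic R M L" if "module_isomorphic R N L" for L :: "('a, (nat \<Rightarrow> 'a) set) module"
  proof -
    obtain g where g: "g \<in> left_module_hom R N L" "bij_betw g (carrier N) (carrier L)"
      using \<open>module_isomorphic R N L\<close> unfolding module_isomorphic_def by blast
    have "g \<circ> f \<in> left_module_hom R M L"
      by (rule left_module_homI) (simp_all add: left_module_homD[OF f] left_module_homD[OF g(1)])
    then show ?thesis
      using bij_betw_trans[OF bij g(2)] unfolding module_isomorphic_def by blast
  qed
  moreover have "module_isomorphic R N L" if "module_isomorphic R M L"
    for L :: "('a, (nat \<Rightarrow> 'a) set) module"
  proof -
    obtain g where g: "g \<in> left_module_hom R M L" "bij_betw g (carrier M) (carrier L)"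
      using \<open>module_isomorphic R M L\<close> unfolding module_isomorphic_def by blast
    show ?thesis
      using left_module_hom_comp[OF fi g(1)] bij_betw_trans[OF bi g(2)]
      unfolding module_isomorphic_def by blast
  qed
  ultimately show ?thesis by (auto simp: iso_class_def)
qed

lemma K0_relations_subgroup: "subgroup (K0_relations R) (K0_free_group R)"
proof -
  have "frag_of a - frag_of b - frag_of c \<in> carrier (K0_free_group R)"
    if "a \<in> iso_class R ` fg_modules R" "b \<in> iso_class R ` fg_modules R"
      "c \<in> iso_class R ` fg_modules R" for a b c
    using that keys_diff[of "frag_of a - frag_of b" "frag_of c"] keys_diff[of "frag_of a" "frag_of b"]
    by (auto simp: K0_free_group_def)
  then show ?thesis
    unfolding K0_relations_def
    by (intro group.generate_is_subgroup) (auto simp: K0_free_group_def)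
qed

lemma K0_comm_group: "comm_group (K0 R)"
  unfolding K0_def
  by (rule comm_group.abelian_FactGroup[OF _ K0_relations_subgroup])
    (simp add: K0_free_group_def abelian_free_Abelian_group)

lemma fg_iso_class:
  assumes "left_module R M" "finitely_generated R M"
  obtains N f where "N \<in> fg_modules R" "f \<in> left_module_hom R M N"
    "bij_betw f (carrier M) (carrier N)" "iso_class R M = iso_class R N"
proof -
  obtain N where N: "N \<in> fg_modules R" "module_isomorphic R M N"
    using ex_isomorphic_fg_module[OF assms] by blast
  obtain f where "f \<in> left_module_hom R M N" "bij_betw f (carrier M) (carrier N)"
    using N(2) by (auto simp: module_isomorphic_def)
  then show thesis
    using that[OF N(1)] iso_class_cong[OF assms(1)] by metis
qed

lemma K0_class_closed:
  assumes "left_module R M" "finitely_generated R M"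
  shows "K0_class R M \<in> carrier (K0 R)"
proof -
  obtain N where N: "N \<in> fg_modules R" "iso_class R M = iso_class R N"
    using fg_iso_class[OF assms] by metis
  then have "frag_of (iso_class R M) \<in> carrier (K0_free_group R)"
    by (auto simp: K0_free_group_def)
  then show ?thesis
    by (auto simp: K0_class_def K0_def FactGroup_def RCOSETS_def)
qed

text \<open>
  The relations of \<open>K0\<close> speak only of modules on one fixed type, so an exact sequence of modules on
  other types has to be moved to isomorphic copies.
\<close>

lemma short_exact_transport:
  assumes M: "left_module R M'" "left_module R M" "left_module R M''"
    and N: "left_module R N'" "left_module R N" "left_module R N''"
    and f': "f' \<in> left_module_hom R M' N'" "bij_betw f' (carrier M') (carrier N')"
    and f: "f \<in> left_module_hom R M N" "bij_betw f (carrier M) (carrier N)"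
    and f'': "f'' \<in> left_module_hom R M'' N''" "bij_betw f'' (carrier M'') (carrier N'')"
    and ex: "short_exact R M' i M p M''"
  shows "short_exact R N' (f \<circ> i \<circ> inv_into (carrier M') f') N (f'' \<circ> p \<circ> inv_into (carrier M) f) N''"
proof -
  let ?g' = "inv_into (carrier M') f'" and ?g = "inv_into (carrier M) f"
  have i: "i \<in> left_module_hom R M' M" and p: "p \<in> left_module_hom R M M''"
    and inj: "inj_on i (carrier M')" and im: "i ` carrier M' = a_kernel M M'' p"
    and surj: "p ` carrier M = carrier M''"
    using ex by (auto simp: short_exact_def)
  have g': "?g' \<in> left_module_hom R N' M'" "bij_betw ?g' (carrier N') (carrier M')"
    by (rule left_module_hom_inv[OF M(1) f'], rule bij_betw_inv_into[OF f'(2)])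
  have g: "?g \<in> left_module_hom R N M" "bij_betw ?g (carrier N) (carrier M)"
    by (rule left_module_hom_inv[OF M(2) f], rule bij_betw_inv_into[OF f(2)])
  have g_im: "?g' ` carrier N' = carrier M'" "?g ` carrier N = carrier M"
    using g g' by (auto simp: bij_betw_def)
  have "f \<circ> i \<in> left_module_hom R M' N"
    by (rule left_module_hom_comp[OF i f(1)])
  then have 1: "f \<circ> i \<circ> ?g' \<in> left_module_hom R N' N"
    by (rule left_module_hom_comp[OF g'(1)])
  have "f'' \<circ> p \<in> left_module_hom R M N''"
    by (rule left_module_hom_comp[OF p f''(1)])
  then have 2: "f'' \<circ> p \<circ> ?g \<in> left_module_hom R N N''"
    by (rule left_module_hom_comp[OF g(1)])
  have icl: "i ` carrier M' \<subseteq> carrier M" using left_module_homD(1)[OF i] by auto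
  have 3: "inj_on (f \<circ> i \<circ> ?g') (carrier N')"
    using g'(2) inj f(2) icl g_im
    by (intro comp_inj_on) (auto simp: bij_betw_def intro: inj_on_subset)
  have z: "f'' y = \<zero>\<^bsub>N''\<^esub> \<longleftrightarrow> y = \<zero>\<^bsub>M''\<^esub>" if "y \<in> carrier M''" for y
  proof -
    interpret M'': left_module R M'' by (rule M(3))
    show ?thesis
      using left_module_hom_zero[OF M(3) N(3) f''(1)] f''(2) that M''.M.zero_closed
      unfolding bij_betw_def by (metis inj_onD)
  qed
  have pcl: "p x \<in> carrier M''" if "x \<in> carrier M" for x
    using left_module_homD(1)[OF p that] .
  have gf: "?g (f x) = x" if "x \<in> carrier M" for x
    using that f(2) by (simp add: bij_betw_def)
  have f_im: "carrier N = f ` carrier M" using f(2) by (simp add: bij_betw_def)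
  have "(f \<circ> i \<circ> ?g') ` carrier N' = f ` (i ` carrier M')"
    by (simp only: image_comp[symmetric] g_im)
  also have "\<dots> = f ` {x \<in> carrier M. p x = \<zero>\<^bsub>M''\<^esub>}"
    by (simp add: im a_kernel_def')
  also have "\<dots> = {y \<in> carrier N. (f'' \<circ> p \<circ> ?g) y = \<zero>\<^bsub>N''\<^esub>}"
    using z pcl left_module_hom_zero[OF M(3) N(3) f''(1)] by (auto simp: f_im gf)
  finally have 4: "(f \<circ> i \<circ> ?g') ` carrier N' = a_kernel N N'' (f'' \<circ> p \<circ> ?g)"
    by (simp add: a_kernel_def')
  have 5: "(f'' \<circ> p \<circ> ?g) ` carrier N = carrier N''"
    using f''(2) by (simp only: image_comp[symmetric] g_im surj) (simp add: bij_betw_def)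
  show ?thesis
    unfolding short_exact_def using 1 2 3 4 5 by simp
qed

lemma K0_short_exact:
  assumes M: "left_module R M'" "left_module R M" "left_module R M''"
    and fg: "finitely_generated R M'" "finitely_generated R M" "finitely_generated R M''"
    and ex: "short_exact R M' i M p M''"
  shows "K0_class R M = K0_class R M' \<otimes>\<^bsub>K0 R\<^esub> K0_class R M''"
proof -
  let ?F = "K0_free_group R" and ?I = "K0_relations R"
  obtain N' f' where N': "N' \<in> fg_modules R" "f' \<in> left_module_hom R M' N'"
    "bij_betw f' (carrier M') (carrier N')" "iso_class R M' = iso_class R N'"
    using fg_iso_class[OF M(1) fg(1)] .
  obtain N f where N: "N \<in> fg_modules R" "f \<in> left_module_hom R M N"
    "bij_betw f (carrier M) (carrier N)" "iso_class R M = iso_class R N"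
    using fg_iso_class[OF M(2) fg(2)] .
  obtain N'' f'' where N'': "N'' \<in> fg_modules R" "f'' \<in> left_module_hom R M'' N''"
    "bij_betw f'' (carrier M'') (carrier N'')" "iso_class R M'' = iso_class R N''"
    using fg_iso_class[OF M(3) fg(3)] .
  let ?m' = "frag_of (iso_class R N')" and ?m = "frag_of (iso_class R N)"
    and ?m'' = "frag_of (iso_class R N'')"
  interpret F: comm_group ?F
    by (simp add: K0_free_group_def abelian_free_Abelian_group)
  interpret I: normal ?I ?F
    by (rule F.subgroup_imp_normal[OF K0_relations_subgroup])
  have "short_exact R N' (f \<circ> i \<circ> inv_into (carrier M') f') N (f'' \<circ> p \<circ> inv_into (carrier M) f) N''"
    by (rule short_exact_transport[OF M _ _ _ N'(2,3) N(2,3) N''(2,3) ex])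
      (use N' N N'' in \<open>auto simp: fg_modules_def\<close>)
  then have rel: "?m - ?m' - ?m'' \<in> ?I"
    unfolding K0_relations_def using N'(1) N(1) N''(1) by (blast intro: generate.incl)
  have c: "?m \<in> carrier ?F" "?m' \<in> carrier ?F" "?m'' \<in> carrier ?F"
    using N'(1) N(1) N''(1) by (auto simp: K0_free_group_def)
  then have c2: "?m' + ?m'' \<in> carrier ?F"
    using F.m_closed[of ?m' ?m''] by (simp add: K0_free_group_def)
  have "?m = (?m - ?m' - ?m'') \<otimes>\<^bsub>?F\<^esub> (?m' + ?m'')" by (simp add: K0_free_group_def)
  then have "?m \<in> ?I #>\<^bsub>?F\<^esub> (?m' + ?m'')"
    using rel unfolding r_coset_def by blast
  then have "?I #>\<^bsub>?F\<^esub> ?m = ?I #>\<^bsub>?F\<^esub> (?m' + ?m'')"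
    using F.repr_independence[OF _ c2 K0_relations_subgroup] by simp
  also have "\<dots> = (?I #>\<^bsub>?F\<^esub> ?m') <#>\<^bsub>?F\<^esub> (?I #>\<^bsub>?F\<^esub> ?m'')"
    using I.rcos_sum[OF c(2,3)] by (simp add: K0_free_group_def)
  finally show ?thesis
    by (simp add: K0_class_def K0_def FactGroup_def N' N N'')
qed

lemma K0_class_iso:
  assumes "left_module R M" "f \<in> left_module_hom R M N" "bij_betw f (carrier M) (carrier N)"
  shows "K0_class R N = K0_class R M"
  using iso_class_cong[OF assms] by (simp add: K0_class_def)

section \<open>Free algebras and the Smith algebra\<close>

lemma ring_of_type_algebra_simps [simp]:
  "carrier ring_of_type_algebra = UNIV"
  "x \<otimes>\<^bsub>ring_of_type_algebra\<^esub> y = x * y"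
  "x \<oplus>\<^bsub>ring_of_type_algebra\<^esub> y = x + y"
  "\<one>\<^bsub>ring_of_type_algebra\<^esub> = 1"
  "\<zero>\<^bsub>ring_of_type_algebra\<^esub> = 0"
  by (simp_all add: ring_of_type_algebra_def)

lemma ring_ring_of_type_algebra: "ring (ring_of_type_algebra :: 'a::ring_1 ring)"
proof (rule ringI)
  show "abelian_group (ring_of_type_algebra :: 'a ring)"
  proof (rule abelian_groupI)
    show "\<exists>y\<in>carrier ring_of_type_algebra. y \<oplus>\<^bsub>ring_of_type_algebra\<^esub> x = \<zero>\<^bsub>ring_of_type_algebra\<^esub>" for x :: 'a
      by (rule bexI[of _ "- x"]) auto
  qed (auto simp: algebra_simps)
  show "Group.monoid (ring_of_type_algebra :: 'a ring)"
    by (rule monoidI) (auto simp: algebra_simps)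
qed (auto simp: algebra_simps)

lemma ring_of_type_algebra_a_inv: "\<ominus>\<^bsub>ring_of_type_algebra\<^esub> x = - (x :: 'a::ring_1)"
proof -
  interpret ring "ring_of_type_algebra :: 'a ring" by (rule ring_ring_of_type_algebra)
  show ?thesis by (rule minus_equality) auto
qed

lemma poly_mapping_single_induct [case_names zero single add]:
  assumes "P 0" and "\<And>w c. P (Poly_Mapping.single w c)" and "\<And>a b. \<lbrakk>P a; P b\<rbrakk> \<Longrightarrow> P (a + b)"
  shows "P (a :: 'w \<Rightarrow>\<^sub>0 'c::comm_monoid_add)"
proof (induction a rule: update_induct)
  case const
  show ?case by (rule assms(1))
next
  case (update f a b)
  have "Poly_Mapping.update a b f = f + Poly_Mapping.single a b"
    using update.hyps
    by (intro poly_mapping_eqI) (auto simp: lookup_update lookup_add lookup_single in_keys_iff when_def)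
  then show ?case using assms update.IH by auto
qed

lemma free_const_simps:
  "free_const 0 = 0" "free_const 1 = 1" "free_const (c + d) = free_const c + free_const d"
  "free_const (c * d) = free_const c * free_const d" "free_const (- c) = - free_const c"
  "free_const (c - d) = free_const c - free_const d"
  by (simp_all add: free_const_def single_add single_uminus single_diff mult_single)

lemma free_const_central: "free_const c * a = a * free_const c"
  by (induction a rule: poly_mapping_single_induct)
    (simp_all add: free_const_def mult_single algebra_simps)

lemma free_algebra_induct [case_names const gen add mult]:
  assumes c: "\<And>c. P (free_const c)" and g: "\<And>x. P (free_gen x)"
    and add: "\<And>a b. \<lbrakk>P a; P b\<rbrakk> \<Longrightarrow> P (a + b)" and mult: "\<And>a b. \<lbrakk>P a; P b\<rbrakk> \<Longrightarrow> P (a * b)"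
  shows "P (a :: ('a, 'k::field) free_algebra)"
proof (induction a rule: poly_mapping_single_induct)
  case zero
  show ?case using c[of 0] by (simp add: free_const_simps)
next
  case (single w c)
  have "P (Poly_Mapping.single (Word l) c)" for l
  proof (induction l)
    case Nil
    show ?case using assms(1)[of c] by (simp add: free_const_def zero_free_monoid_def)
  next
    case (Cons x l)
    have "Poly_Mapping.single (Word (x # l)) c = free_gen x * Poly_Mapping.single (Word l) c"
      by (simp add: free_gen_def mult_single plus_free_monoid_def)
    then show ?case using mult[OF g Cons.IH] by simp
  qed
  then show ?case by (cases w) simp
qed (rule add)

subsection \<open>Actions of the free algebra on polynomials\<close>

lemma free_act_superset:
  assumes "finite S" "Poly_Mapping.keys a \<subseteq> S"
  shows "free_act T a f =
    (\<Sum>w\<in>S. Polynomial.smult (Poly_Mapping.lookup a w) (foldr T (letters w) f))"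
  unfolding free_act_def using assms
  by (intro sum.mono_neutral_left) (auto simp: in_keys_iff)

lemma free_act_add: "free_act T (a + b) f = free_act T a f + free_act T b f"
proof -
  let ?S = "Poly_Mapping.keys a \<union> Poly_Mapping.keys b"
  have "Poly_Mapping.keys (a + b) \<subseteq> ?S" by (rule Poly_Mapping.keys_add)
  then show ?thesis
    by (simp add: free_act_superset[of ?S] lookup_add smult_add_left sum.distrib)
qed

lemma free_act_zero: "free_act T 0 f = 0"
  by (simp add: free_act_def)

lemma free_act_single: "free_act T (Poly_Mapping.single w c) f = Polynomial.smult c (foldr T (letters w) f)"
  by (cases "c = 0") (simp_all add: free_act_def)

lemma free_act_const: "free_act T (free_const c) f = Polynomial.smult c f"
  by (simp add: free_const_def free_act_single zero_free_monoid_def)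

lemma free_act_gen: "free_act T (free_gen x) f = T x f"
  by (simp add: free_gen_def free_act_single)

lemma free_act_diff: "free_act T (a - b) f = free_act T a f - free_act T b f"
  using free_act_add[of T "a - b" b f] by (simp add: algebra_simps)

locale linear_operators =
  fixes T :: "'a \<Rightarrow> 'k::field poly \<Rightarrow> 'k poly"
  assumes T_add: "T x (f + f') = T x f + T x f'"
    and T_smult: "T x (Polynomial.smult c f) = Polynomial.smult c (T x f)"
begin

lemma free_act_poly_add: "free_act T a (f + f') = free_act T a f + free_act T a f'"
proof -
  have "foldr T l (f + f') = foldr T l f + foldr T l f'" for l
    by (induction l) (simp_all add: T_add)
  then show ?thesis by (simp add: free_act_def smult_add_right sum.distrib)
qed

lemma free_act_mult: "free_act T (a * b) f = free_act T a (free_act T b f)"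
proof (induction a rule: poly_mapping_single_induct)
  case (single v c)
  have T0: "foldr T l 0 = 0" for l
  proof (induction l)
    case (Cons x l)
    then show ?case using T_smult[of x 0 0] by simp
  qed simp
  have T_foldr: "foldr T l (f + f') = foldr T l f + foldr T l f'"
    "foldr T l (Polynomial.smult d f) = Polynomial.smult d (foldr T l f)" for l f f' d
    by (induction l) (simp_all add: T_add T_smult)
  show ?case
    by (induction b rule: poly_mapping_single_induct)
      (simp_all add: free_act_zero T0 mult_single free_act_single plus_free_monoid_def T_foldr
        distrib_left free_act_add smult_add_right)
qed (simp_all add: free_act_zero distrib_right free_act_add)

end

subsection \<open>Evaluation of a polynomial in the free algebra\<close>

definition free_eval :: "('a, 'k::field) free_algebra \<Rightarrow> 'k poly \<Rightarrow> ('a, 'k) free_algebra"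
  where "free_eval z p = (\<Sum>i\<le>Polynomial.degree p. free_const (Polynomial.coeff p i) * z ^ i)"

lemma free_eval_altdef:
  assumes "Polynomial.degree p \<le> n"
  shows "free_eval z p = (\<Sum>i\<le>n. free_const (Polynomial.coeff p i) * z ^ i)"
  unfolding free_eval_def using assms
  by (intro sum.mono_neutral_left) (auto simp: coeff_eq_0 free_const_simps)

lemma free_eval_0 [simp]: "free_eval z 0 = 0"
  by (simp add: free_eval_def free_const_simps)

lemma free_eval_add: "free_eval z (p + q) = free_eval z p + free_eval z q"
proof -
  let ?n = "max (Polynomial.degree p) (Polynomial.degree q)"
  show ?thesis
    by (simp add: free_eval_altdef[of _ ?n] degree_add_le free_const_simps distrib_right sum.distrib)
qed

lemma free_eval_smult: "free_eval z (Polynomial.smult c p) = free_const c * free_eval z p"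
  by (simp add: free_eval_altdef[of _ "Polynomial.degree p"] degree_smult_le free_const_simps
      sum_distrib_left mult.assoc)

lemma free_eval_pCons: "free_eval z (pCons c p) = free_const c + z * free_eval z p"
proof -
  have "free_eval z (pCons c p) =
      (\<Sum>i\<le>Suc (Polynomial.degree p). free_const (Polynomial.coeff (pCons c p) i) * z ^ i)"
    by (rule free_eval_altdef[OF degree_pCons_le])
  also have "\<dots> = free_const c + (\<Sum>i\<le>Polynomial.degree p. free_const (Polynomial.coeff p i) * z ^ Suc i)"
    by (subst sum.atMost_Suc_shift) simp
  also have "(\<Sum>i\<le>Polynomial.degree p. free_const (Polynomial.coeff p i) * z ^ Suc i) = z * free_eval z p"
    unfolding free_eval_def sum_distrib_left power_Suc
    by (intro sum.cong refl) (simp add: mult.assoc[symmetric] free_const_central[of _ z])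
  finally show ?thesis .
qed

lemma free_eval_const: "free_eval z [:c:] = free_const c"
  by (simp add: free_eval_pCons)

subsection \<open>The Smith algebra\<close>

lemma smith_ideal_ideal: "ideal (smith_ideal g) ring_of_type_algebra"
  unfolding smith_ideal_def
  by (rule ring.genideal_ideal[OF ring_ring_of_type_algebra]) simp

lemma smith_ideal_minimal:
  assumes "ideal J ring_of_type_algebra"
    and "gen_h * gen_y - gen_y * gen_h - gen_y \<in> J"
    and "gen_h * gen_x - gen_x * gen_h + gen_x \<in> J"
    and "gen_y * gen_x - gen_x * gen_y - free_eval gen_h g \<in> J"
  shows "smith_ideal g \<subseteq> J"
  unfolding smith_ideal_def
  by (rule ring.genideal_minimal[OF ring_ring_of_type_algebra assms(1)])
    (use assms in \<open>simp add: free_eval_def\<close>)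

lemma smith_relations:
  "gen_h * gen_y - gen_y * gen_h - gen_y \<in> smith_ideal g"
  "gen_h * gen_x - gen_x * gen_h + gen_x \<in> smith_ideal g"
  "gen_y * gen_x - gen_x * gen_y - free_eval gen_h g \<in> smith_ideal g"
  using ring.genideal_self[OF ring_ring_of_type_algebra,
      of "{gen_h * gen_y - gen_y * gen_h - gen_y, gen_h * gen_x - gen_x * gen_h + gen_x,
        gen_y * gen_x - gen_x * gen_y - free_eval gen_h g}"]
  unfolding smith_ideal_def free_eval_def by simp_all

lemma smith_ring: "ring (smith_algebra g)"
  unfolding smith_algebra_def by (rule ideal.quotient_is_ring[OF smith_ideal_ideal])

lemma smith_elem_ring_hom: "smith_elem g \<in> ring_hom ring_of_type_algebra (smith_algebra g)"
  using ideal.rcos_ring_hom[OF smith_ideal_ideal] unfolding smith_algebra_def smith_elem_def .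

lemma smith_elem_simps:
  "smith_elem g a \<in> carrier (smith_algebra g)"
  "smith_elem g a \<oplus>\<^bsub>smith_algebra g\<^esub> smith_elem g b = smith_elem g (a + b)"
  "smith_elem g a \<otimes>\<^bsub>smith_algebra g\<^esub> smith_elem g b = smith_elem g (a * b)"
  "\<one>\<^bsub>smith_algebra g\<^esub> = smith_elem g 1"
  using ring_hom_closed[OF smith_elem_ring_hom, of a] ring_hom_add[OF smith_elem_ring_hom, of a b]
    ring_hom_mult[OF smith_elem_ring_hom, of a b] ring_hom_one[OF smith_elem_ring_hom[of g]]
  by simp_all

lemma smith_carrier: "carrier (smith_algebra g) = range (smith_elem g)"
  by (auto simp: smith_algebra_def smith_elem_def FactRing_def A_RCOSETS_def')

lemma smith_elem_eq_iff: "smith_elem g a = smith_elem g b \<longleftrightarrow> a - b \<in> smith_ideal g"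
proof -
  interpret ideal "smith_ideal g" ring_of_type_algebra by (rule smith_ideal_ideal)
  have *: "a \<in> smith_ideal g +>\<^bsub>ring_of_type_algebra\<^esub> b \<longleftrightarrow> a - b \<in> smith_ideal g"
    using a_rcos_module[of b a] by (simp add: ring_of_type_algebra_a_inv)
  show ?thesis
    unfolding smith_elem_def *[symmetric]
    using a_rcos_self[of a] a_repr_independence'[of a b] by auto
qed

lemma smith_elem_zero: "\<zero>\<^bsub>smith_algebra g\<^esub> = smith_elem g 0"
proof -
  interpret ring "smith_algebra g" by (rule smith_ring)
  have "smith_elem g 0 \<oplus>\<^bsub>smith_algebra g\<^esub> smith_elem g 0 = smith_elem g 0"
    by (simp add: smith_elem_simps)
  then show ?thesis by (metis add.r_cancel_one smith_elem_simps(1))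
qed

lemma smith_elem_uminus: "\<ominus>\<^bsub>smith_algebra g\<^esub> smith_elem g a = smith_elem g (- a)"
proof -
  interpret ring "smith_algebra g" by (rule smith_ring)
  show ?thesis by (rule minus_equality) (auto simp: smith_elem_simps smith_elem_zero)
qed

text \<open>
  Elements of the Smith algebra are cosets.  Letting the free algebra act instead makes the scalars elements
  of a ring type, where they can be calculated with.
\<close>

locale smith_module = left_module "smith_algebra g" M
  for g :: "'k::field poly" and M :: "('k smith, 'm, 'd) module_scheme" (structure)
begin

definition act :: "(smith_gen, 'k) free_algebra \<Rightarrow> 'm \<Rightarrow> 'm"  (infixr \<open>\<bullet>\<close> 75)
  where "a \<bullet> m = smith_elem g a \<odot> m"

lemma act_closed [simp]: "m \<in> carrier M \<Longrightarrow> a \<bullet> m \<in> carrier M"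
  by (simp add: act_def smith_elem_simps)

lemma act_plus: "m \<in> carrier M \<Longrightarrow> (a + b) \<bullet> m = a \<bullet> m \<oplus> b \<bullet> m"
  by (simp add: act_def smith_elem_simps(1) smult_l_distr[symmetric] smith_elem_simps(2))

lemma act_times: "m \<in> carrier M \<Longrightarrow> (a * b) \<bullet> m = a \<bullet> b \<bullet> m"
  by (simp add: act_def smith_elem_simps(1) smult_assoc1[symmetric] smith_elem_simps(3))

lemma act_one [simp]: "m \<in> carrier M \<Longrightarrow> 1 \<bullet> m = m"
  using smult_one by (simp add: act_def smith_elem_simps)

lemma act_distrib: "\<lbrakk>m \<in> carrier M; n \<in> carrier M\<rbrakk> \<Longrightarrow> a \<bullet> (m \<oplus> n) = a \<bullet> m \<oplus> a \<bullet> n"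
  by (simp add: act_def smith_elem_simps(1) smult_r_distr)

lemma act_zero [simp]: "a \<bullet> \<zero>\<^bsub>M\<^esub> = \<zero>\<^bsub>M\<^esub>"
  using act_distrib[of "\<zero>\<^bsub>M\<^esub>" "\<zero>\<^bsub>M\<^esub>" a] by (metis M.add.r_cancel_one M.l_zero M.zero_closed act_closed)

lemma zero_act [simp]: "m \<in> carrier M \<Longrightarrow> 0 \<bullet> m = \<zero>\<^bsub>M\<^esub>"
  using act_plus[of m 0 0] by (metis M.add.r_cancel_one act_closed add_0)

lemma act_uminus: "m \<in> carrier M \<Longrightarrow> (- a) \<bullet> m = \<ominus>\<^bsub>M\<^esub> (a \<bullet> m)"
  using act_plus[of m "- a" a] by (simp add: M.minus_equality)

lemma act_minus: "m \<in> carrier M \<Longrightarrow> (a - b) \<bullet> m = a \<bullet> m \<ominus>\<^bsub>M\<^esub> b \<bullet> m"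
  using act_plus[of m a "- b"] by (simp add: act_uminus a_minus_def)

lemma act_ideal: "\<lbrakk>m \<in> carrier M; a \<in> smith_ideal g\<rbrakk> \<Longrightarrow> a \<bullet> m = \<zero>\<^bsub>M\<^esub>"
  using zero_act[of m] smith_elem_eq_iff[of g a 0] by (simp add: act_def)

lemma submodule_act: "\<lbrakk>submodule N (smith_algebra g) M; m \<in> N\<rbrakk> \<Longrightarrow> a \<bullet> m \<in> N"
  using submoduleD(4) unfolding act_def by (metis smith_elem_simps(1))

lemma smith_submoduleI:
  assumes "N \<subseteq> carrier M" "\<zero> \<in> N" "\<And>m n. \<lbrakk>m \<in> N; n \<in> N\<rbrakk> \<Longrightarrow> m \<oplus> n \<in> N"
    and "\<And>a m. m \<in> N \<Longrightarrow> a \<bullet> m \<in> N"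
  shows "submodule N (smith_algebra g) M"
  by (rule submoduleI[OF left_module_axioms])
    (use assms in \<open>auto simp: smith_carrier act_def\<close>)

end

lemma smith_module_hom_act:
  assumes "smith_module g M" "smith_module g N" "f \<in> left_module_hom (smith_algebra g) M N"
    and "m \<in> carrier M"
  shows "f (smith_module.act g M a m) = smith_module.act g N a (f m)"
  using assms left_module_homD(3)[OF assms(3)]
  by (simp add: smith_module.act_def smith_elem_simps(1))

text \<open>
  The elements that act as zero form a two-sided ideal.  If it contains the defining relations, it contains
  the ideal they generate, so all members of a coset act in the same way.
\<close>

lemma smith_moduleI:
  assumes M: "abelian_group M"
    and closed: "\<And>a m. m \<in> carrier M \<Longrightarrow> \<rho> a m \<in> carrier M"
    and one: "\<And>m. m \<in> carrier M \<Longrightarrow> \<rho> 1 m = m"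
    and add: "\<And>a b m. m \<in> carrier M \<Longrightarrow> \<rho> (a + b) m = \<rho> a m \<oplus>\<^bsub>M\<^esub> \<rho> b m"
    and mult: "\<And>a b m. m \<in> carrier M \<Longrightarrow> \<rho> (a * b) m = \<rho> a (\<rho> b m)"
    and distr: "\<And>a m n. \<lbrakk>m \<in> carrier M; n \<in> carrier M\<rbrakk> \<Longrightarrow> \<rho> a (m \<oplus>\<^bsub>M\<^esub> n) = \<rho> a m \<oplus>\<^bsub>M\<^esub> \<rho> a n"
    and rel: "\<And>m. m \<in> carrier M \<Longrightarrow> \<rho> (gen_h * gen_y - gen_y * gen_h - gen_y) m = \<zero>\<^bsub>M\<^esub>"
      "\<And>m. m \<in> carrier M \<Longrightarrow> \<rho> (gen_h * gen_x - gen_x * gen_h + gen_x) m = \<zero>\<^bsub>M\<^esub>"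
      "\<And>m. m \<in> carrier M \<Longrightarrow> \<rho> (gen_y * gen_x - gen_x * gen_y - free_eval gen_h g) m = \<zero>\<^bsub>M\<^esub>"
    and smult: "\<And>T m. m \<in> carrier M \<Longrightarrow> T \<odot>\<^bsub>M\<^esub> m = the_elem ((\<lambda>a. \<rho> a m) ` T)"
  shows "smith_module g M"
    and "\<And>a m. m \<in> carrier M \<Longrightarrow> smith_module.act g M a m = \<rho> a m"
proof -
  interpret M: abelian_group M by fact
  define J where "J = {a. \<forall>m\<in>carrier M. \<rho> a m = \<zero>\<^bsub>M\<^esub>}"
  have zero: "\<rho> 0 m = \<zero>\<^bsub>M\<^esub>" if "m \<in> carrier M" for m
    using add[OF that, of 0 0] closed[OF that, of 0] by (metis M.add.r_cancel_one add_0)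
  have rho_zero: "\<rho> a \<zero>\<^bsub>M\<^esub> = \<zero>\<^bsub>M\<^esub>" for a
    using distr[of "\<zero>\<^bsub>M\<^esub>" "\<zero>\<^bsub>M\<^esub>" a] closed[of "\<zero>\<^bsub>M\<^esub>" a]
    by (metis M.add.r_cancel_one M.l_zero M.zero_closed)
  have neg: "- a \<in> J" if "a \<in> J" for a
  proof -
    have "\<rho> (- a) m = \<zero>\<^bsub>M\<^esub>" if m: "m \<in> carrier M" for m
    proof -
      have "\<rho> (- a) m = \<rho> (- a) m \<oplus>\<^bsub>M\<^esub> \<rho> a m"
        using \<open>a \<in> J\<close> m closed[OF m, of "- a"] by (simp add: J_def)
      also have "\<dots> = \<rho> (- a + a) m" by (rule add[OF m, symmetric])
      finally show ?thesis using zero[OF m] by simp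
    qed
    then show ?thesis by (simp add: J_def)
  qed
  have "ideal J ring_of_type_algebra"
  proof (rule idealI[OF ring_ring_of_type_algebra])
    show "subgroup J (add_monoid ring_of_type_algebra)"
    proof (rule subgroup.intro)
      show "inv\<^bsub>add_monoid ring_of_type_algebra\<^esub> a \<in> J" if "a \<in> J" for a
        unfolding a_inv_def[symmetric] ring_of_type_algebra_a_inv by (rule neg[OF that])
    qed (auto simp: J_def zero add)
  qed (auto simp: J_def mult closed rho_zero)
  then have I: "smith_ideal g \<subseteq> J"
    by (rule smith_ideal_minimal) (auto simp: J_def rel)
  have act: "smith_elem g a \<odot>\<^bsub>M\<^esub> m = \<rho> a m" if m: "m \<in> carrier M" for a m
  proof -
    have "\<rho> b m = \<rho> a m" if "b \<in> smith_elem g a" for b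
    proof -
      obtain i where "i \<in> smith_ideal g" "b = i + a"
        using \<open>b \<in> smith_elem g a\<close> by (auto simp: smith_elem_def a_r_coset_def')
      then show ?thesis
        using m I by (auto simp: add J_def closed)
    qed
    then have "(\<lambda>b. \<rho> b m) ` smith_elem g a = (\<lambda>_. \<rho> a m) ` smith_elem g a"
      by (rule image_cong[OF refl])
    moreover have "a \<in> smith_elem g a"
      unfolding smith_elem_def
      using abelian_subgroup.a_rcos_self[OF ideal.axioms(1)[OF smith_ideal_ideal, THEN
        abelian_subgroupI3[OF _ ring.is_abelian_group[OF ring_ring_of_type_algebra]]], of a g] by simp
    ultimately have "(\<lambda>b. \<rho> b m) ` smith_elem g a = {\<rho> a m}" by auto
    then show ?thesis by (simp add: smult[OF m])
  qed
  show sm: "smith_module g M"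
    unfolding smith_module_def
  proof (intro left_module.intro left_module_axioms.intro smith_ring M)
  qed (auto simp: smith_carrier act closed smith_elem_simps(2-4) add mult distr one)
  show "smith_module.act g M a m = \<rho> a m" if "m \<in> carrier M" for a m
    by (simp add: smith_module.act_def[OF sm] act[OF that])
qed

section \<open>Shifts and root multisets\<close>

lemma shift_shift: "shift a (shift b f) = shift (a + b) f"
proof -
  have "shift a (shift b f) = pcompose f (pcompose [:b, 1:] [:a, 1:])"
    by (simp add: pcompose_assoc)
  then show ?thesis by (simp add: pcompose_pCons add.commute)
qed

lemma shift_linear: "shift c [:a, 1:] = [:a + c, 1:]"
  by (simp add: pcompose_pCons add.commute)

lemma poly_shift: "poly (shift c f) z = poly f (z + c)"
  by (simp add: poly_pcompose add.commute)

lemma shift_eq_0_iff [simp]: "shift c f = 0 \<longleftrightarrow> f = 0"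
  by (simp add: pcompose_eq_0_iff)

lemma root_poly_empty [simp]: "root_poly {#} = 1"
  and root_poly_add_mset [simp]: "root_poly (add_mset a A) = [:-a, 1:] * root_poly A"
  and root_poly_plus: "root_poly (A + B) = root_poly A * root_poly B"
  by (simp_all add: root_poly_def)

lemma root_poly_nonzero [simp]: "root_poly A \<noteq> 0"
  by (induction A) (simp_all del: mult_pCons_left)

lemma poly_root_poly_eq_0_iff: "poly (root_poly A) z = 0 \<longleftrightarrow> z \<in># A"
  by (induction A) auto

lemma proots_root_poly: "proots (root_poly A) = A"
  by (induction A) (simp_all add: proots_mult del: mult_pCons_left)

lemma alg_closed_eq_root_poly:
  fixes p :: "'k::alg_closed_field poly"
  assumes "p \<noteq> 0"
  shows "p = Polynomial.smult (lead_coeff p) (root_poly (proots p))"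
proof -
  obtain A where A: "p = Polynomial.smult (lead_coeff p) (root_poly A)"
    using alg_closed_imp_factorization[OF assms] unfolding root_poly_def by blast
  then have "proots p = proots (root_poly A)"
    using assms by (metis leading_coeff_0_iff proots_smult)
  then show ?thesis using A by (simp add: proots_root_poly)
qed

subsection \<open>Strings of consecutive linear factors\<close>

text \<open>
  The roots are \<open>a + 1, \<dots>, a + n\<close>.  When \<open>a\<close> and \<open>a + n\<close> are neighbouring roots of \<open>u + C\<close>, these are
  the weights of \<open>L(a + n)\<close>.
\<close>

definition string_poly :: "'k::field_char_0 \<Rightarrow> nat \<Rightarrow> 'k poly"
  where "string_poly a n = (\<Prod>i<n. [:- (a + of_nat (Suc i)), 1:])"

lemma string_poly_Suc: "string_poly a (Suc n) = string_poly a n * [:- (a + of_nat (Suc n)), 1:]"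
  by (simp add: string_poly_def)

lemma string_poly_nonzero [simp]: "string_poly a n \<noteq> 0"
  by (simp add: string_poly_def)

lemma degree_string_poly: "Polynomial.degree (string_poly a n) = n"
proof (induction n)
  case (Suc n)
  then show ?case
    by (simp add: string_poly_Suc degree_mult_eq del: mult_pCons_right)
qed (simp add: string_poly_def)

lemma poly_string_poly_eq_0_iff: "poly (string_poly a n) z = 0 \<longleftrightarrow> (\<exists>i<n. z = a + of_nat (Suc i))"
  by (auto simp: string_poly_def poly_prod algebra_simps)

text \<open>
  A shift moves the string by one place, so only the factors at its two ends change.
\<close>

lemma shift_up_string_poly:
  "shift 1 (string_poly a n) * [:- (a + of_nat n), 1:] = string_poly a n * [:- a, 1:]"
proof (induction n)
  case (Suc n)
  have "shift 1 (string_poly a (Suc n)) * [:- (a + of_nat (Suc n)), 1:] =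
      (shift 1 (string_poly a n) * [:- (a + of_nat n), 1:]) * [:- (a + of_nat (Suc n)), 1:]"
  proof -
    have "shift 1 [:- (a + of_nat (Suc n)), 1:] = [:- (a + of_nat n), 1:]"
      by (simp add: shift_linear)
    then show ?thesis by (simp only: string_poly_Suc pcompose_mult)
  qed
  also have "\<dots> = string_poly a (Suc n) * [:- a, 1:]"
    by (simp only: Suc.IH string_poly_Suc mult.assoc mult.commute[of "[:- a, 1:]"])
  finally show ?case .
qed (simp add: string_poly_def pcompose_1)

lemma shift_down_string_poly:
  "shift (- 1) (string_poly a n) * [:- (a + 1), 1:] = string_poly a n * [:- (a + of_nat n + 1), 1:]"
proof (induction n)
  case (Suc n)
  have "shift (- 1) (string_poly a (Suc n)) * [:- (a + 1), 1:] =
      (shift (- 1) (string_poly a n) * [:- (a + 1), 1:]) * [:- (a + of_nat (Suc n) + 1), 1:]"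
  proof -
    have "shift (- 1) [:- (a + of_nat (Suc n)), 1:] = [:- (a + of_nat (Suc n) + 1), 1:]"
      by (simp add: shift_linear del: of_nat_Suc)
    then show ?thesis by (simp only: string_poly_Suc pcompose_mult mult_ac)
  qed
  also have "\<dots> = string_poly a (Suc n) * [:- (a + of_nat (Suc n) + 1), 1:]"
    unfolding Suc.IH string_poly_Suc by (simp add: add_ac mult_ac)
  finally show ?case .
qed (simp add: string_poly_def pcompose_1)

lemma string_poly_dvdI:
  assumes "\<And>i. i < n \<Longrightarrow> poly d (a + of_nat (Suc i)) = 0"
  shows "string_poly a n dvd d"
  using assms
proof (induction n)
  case (Suc n)
  then obtain e where e: "d = string_poly a n * e" by (auto simp: dvd_def)
  have "poly (string_poly a n) (a + of_nat (Suc n)) \<noteq> 0"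
    by (simp add: poly_string_poly_eq_0_iff)
  then have "poly e (a + of_nat (Suc n)) = 0"
    using Suc.prems[of n] by (simp add: e)
  then have "[:- (a + of_nat (Suc n)), 1:] dvd e" by (simp only: poly_eq_0_iff_dvd)
  then show ?case unfolding e string_poly_Suc by (rule mult_dvd_mono[OF dvd_refl])
qed (simp add: string_poly_def)

text \<open>
  In characteristic zero the numbers \<open>b\<close>, \<open>b + s\<close>, \<open>b + 2 s\<close>, \<dots> are distinct, and only finitely many of them
  are roots.
\<close>

lemma ex_last_root:
  fixes d :: "'k::field_char_0 poly"
  assumes "d \<noteq> 0" "poly d b = 0" "s \<noteq> 0"
  obtains n :: nat where "poly d (b + of_nat n * s) = 0" "poly d (b + of_nat (Suc n) * s) \<noteq> 0"
proof -
  have "\<exists>n. poly d (b + of_nat n * s) \<noteq> 0"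
  proof (rule ccontr)
    assume "\<not> ?thesis"
    then have "range (\<lambda>n. b + of_nat n * s) \<subseteq> {z. poly d z = 0}" by auto
    moreover have "inj (\<lambda>n. b + of_nat n * s)" using \<open>s \<noteq> 0\<close> by (auto simp: inj_on_def)
    ultimately show False
      using poly_roots_finite[OF \<open>d \<noteq> 0\<close>] finite_subset range_inj_infinite by blast
  qed
  then obtain n where n: "poly d (b + of_nat n * s) \<noteq> 0"
    and least: "\<And>m. m < n \<Longrightarrow> poly d (b + of_nat m * s) = 0"
    using exists_least_iff[of "\<lambda>n. poly d (b + of_nat n * s) \<noteq> 0"] by auto
  have "n \<noteq> 0" using n assms(2) by (intro notI) simp
  then obtain m where "n = Suc m" using not0_implies_Suc by blast
  then show thesis using that[of m] n least by simp
qed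

lemma poly_ideal_principal:
  fixes N :: "'k::field poly set"
  assumes zero: "0 \<in> N" and add: "\<And>a b. \<lbrakk>a \<in> N; b \<in> N\<rbrakk> \<Longrightarrow> a + b \<in> N"
    and mult: "\<And>r a. a \<in> N \<Longrightarrow> r * a \<in> N"
  obtains d where "N = {f. d dvd f}"
proof (cases "N = {0}")
  case True
  then show ?thesis using that[of 0] by auto
next
  case False
  then obtain a where a: "a \<in> N" "a \<noteq> 0" using zero by auto
  obtain d where d: "d \<in> N" "d \<noteq> 0"
    and least: "\<And>f. \<lbrakk>f \<in> N; f \<noteq> 0\<rbrakk> \<Longrightarrow> Polynomial.degree d \<le> Polynomial.degree f"
    using ex_has_least_nat[of "\<lambda>f. f \<in> N \<and> f \<noteq> 0" a Polynomial.degree] a by blast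
  have "d dvd f" if f: "f \<in> N" for f
  proof (rule ccontr)
    assume "\<not> d dvd f"
    then have nz: "f mod d \<noteq> 0" by (simp add: dvd_eq_mod_eq_0)
    have "f mod d = f + (- (f div d)) * d"
      by (metis add.commute add_diff_cancel_right' div_mult_mod_eq mult_minus_left uminus_add_conv_diff)
    then have "f mod d \<in> N" using add[OF f mult[OF d(1), of "- (f div d)"]] by (simp only:)
    then show False
      using least[OF _ nz] degree_mod_less'[OF d(2) nz] by simp
  qed
  then have "N = {f. d dvd f}" using mult[OF d(1)] by (auto simp: dvd_def mult.commute)
  then show ?thesis by (rule that)
qed

section \<open>The modules of polynomials\<close>

locale smith_data =
  fixes g u :: "'k::{alg_closed_field, field_char_0} poly" and C :: 'k
  assumes g_nonzero: "g \<noteq> 0" and g_eq: "g = shift (- 1) u - u"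
begin

abbreviation roots :: "'k multiset"
  where "roots \<equiv> proots (u + [:C:])"

lemma uC_nonzero: "u + [:C:] \<noteq> 0"
proof
  assume "u + [:C:] = 0"
  then have "u = - [:C:]" by (simp only: eq_neg_iff_add_eq_0)
  then show False using g_nonzero g_eq by simp
qed

lemma lead_coeff_uC: "lead_coeff (u + [:C:]) \<noteq> 0"
  using uC_nonzero by (simp only: leading_coeff_0_iff not_False_eq_True)

text \<open>
  The polynomial \<open>p(h)\<close> through which \<open>y\<close> acts on \<open>A\<^sub>C(X)\<close> is \<open>lower_factor Xs\<close> evaluated at \<open>h - 1\<close>.  Without this shift
  its roots are exactly the complement of \<open>X\<close>.
\<close>

definition lower_factor :: "'k multiset \<Rightarrow> 'k poly"
  where "lower_factor Xs = Polynomial.smult (lead_coeff (u + [:C:])) (root_poly (roots - Xs))"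

lemma lower_factor_nonzero [simp]: "lower_factor Xs \<noteq> 0"
  using lead_coeff_uC by (simp add: lower_factor_def del: coeff_add)

lemma poly_lower_factor_eq_0_iff: "poly (lower_factor Xs) z = 0 \<longleftrightarrow> z \<in># roots - Xs"
  using lead_coeff_uC by (simp add: lower_factor_def poly_root_poly_eq_0_iff del: coeff_add)

lemma lower_factor_times_root_poly:
  assumes "Xs \<subseteq># roots"
  shows "lower_factor Xs * root_poly Xs = u + [:C:]"
proof -
  have "u + [:C:] = Polynomial.smult (lead_coeff (u + [:C:])) (root_poly ((roots - Xs) + Xs))"
    using alg_closed_eq_root_poly[OF uC_nonzero] assms by simp
  then show ?thesis by (simp add: lower_factor_def root_poly_plus)
qed

lemma smith_act_y:
  assumes "Xs \<subseteq># roots"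
  shows "smith_act u C Xs Gen_y f = shift (- 1) f * shift (- 1) (lower_factor Xs)"
proof -
  have "shift (- 1) u + [:C:] = shift (- 1) (u + [:C:])"
    by (simp add: pcompose_add)
  also have "\<dots> = shift (- 1) (lower_factor Xs) * shift (- 1) (root_poly Xs)"
    unfolding lower_factor_times_root_poly[OF assms, symmetric] pcompose_mult ..
  finally show ?thesis by simp
qed

lemma linear_operators_smith_act: "linear_operators (smith_act u C Xs)"
proof
  fix x :: smith_gen and f f' :: "'k poly" and c :: 'k
  show "smith_act u C Xs x (f + f') = smith_act u C Xs x f + smith_act u C Xs x f'"
    by (cases x) (simp_all add: pcompose_add algebra_simps)
  show "smith_act u C Xs x (Polynomial.smult c f) = Polynomial.smult c (smith_act u C Xs x f)"
    by (cases x) (simp_all add: pcompose_smult)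
qed

lemma free_act_eval_h: "free_act (smith_act u C Xs) (free_eval gen_h r) f = r * f"
proof -
  interpret linear_operators "smith_act u C Xs" by (rule linear_operators_smith_act)
  show ?thesis
    by (induction r)
      (simp_all add: free_act_zero free_eval_pCons free_act_add free_act_const free_act_mult free_act_gen)
qed

context
  fixes Xs :: "'k multiset"
  assumes Xs: "Xs \<subseteq># roots"
begin

text \<open>
  The product \<open>x y\<close> acts as \<open>u + C\<close> and \<open>y x\<close> as \<open>u(h - 1) + C\<close>, whose difference is \<open>g\<close>.
\<close>

lemma A_module_smith:
  shows A_smith_module: "smith_module g (A_module u C Xs)"
    and A_act: "smith_module.act g (A_module u C Xs) a f = free_act (smith_act u C Xs) a f"
proof -
  interpret T: linear_operators "smith_act u C Xs" by (rule linear_operators_smith_act)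
  let ?M = "A_module u C Xs"
  have ab: "abelian_group ?M"
  proof (rule abelian_groupI)
    show "\<exists>f'\<in>carrier ?M. f' \<oplus>\<^bsub>?M\<^esub> f = \<zero>\<^bsub>?M\<^esub>" for f
      by (rule bexI[of _ "- f"]) (simp_all add: A_module_def)
  qed (simp_all add: A_module_def algebra_simps)
  have one: "free_act (smith_act u C Xs) 1 f = f" for f
    using free_act_const[of "smith_act u C Xs" 1] by (simp add: free_const_simps)
  have up: "lower_factor Xs * root_poly Xs = u + [:C:]"
    by (rule lower_factor_times_root_poly[OF Xs])
  have yx: "smith_act u C Xs Gen_y (smith_act u C Xs Gen_x f) = shift (- 1) (u + [:C:]) * f" for f
    unfolding smith_act_y[OF Xs] up[symmetric]
    by (simp add: pcompose_mult shift_shift mult_ac)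
  have xy: "smith_act u C Xs Gen_x (smith_act u C Xs Gen_y f) = (u + [:C:]) * f" for f
    unfolding smith_act_y[OF Xs] up[symmetric]
    by (simp add: pcompose_mult shift_shift mult_ac)
  have yx_xy: "shift (- 1) (u + [:C:]) * f - (u + [:C:]) * f = g * f" for f
    by (simp add: g_eq pcompose_add algebra_simps)
  have hy: "[:0, 1:] * smith_act u C Xs Gen_y f - smith_act u C Xs Gen_y ([:0, 1:] * f) =
      smith_act u C Xs Gen_y f" for f
    unfolding smith_act_y[OF Xs] by (simp add: pcompose_pCons pcompose_mult algebra_simps)
  have hx: "[:0, 1:] * smith_act u C Xs Gen_x f - smith_act u C Xs Gen_x ([:0, 1:] * f) =
      - smith_act u C Xs Gen_x f" for f
    by (simp add: pcompose_pCons pcompose_mult algebra_simps)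
  note smithI = smith_moduleI[where \<rho> = "free_act (smith_act u C Xs)" and M = ?M and g = g]
  have *: "smith_module g ?M \<and> (\<forall>a f. f \<in> carrier ?M \<longrightarrow> smith_module.act g ?M a f = free_act (smith_act u C Xs) a f)"
  proof (intro conjI allI impI smithI ab)
  qed (use hx hy yx xy yx_xy in \<open>simp_all add: A_module_def one free_act_add T.free_act_mult T.free_act_poly_add
      free_act_diff free_act_gen free_act_eval_h del: smith_act.simps(1,2)\<close>)
  show "smith_module g ?M" using * by blast
  show "smith_module.act g ?M a f = free_act (smith_act u C Xs) a f"
    using * by (simp add: A_module_def)
qed

lemma A_simps [simp]:
  "carrier (A_module u C Xs) = UNIV" "\<zero>\<^bsub>A_module u C Xs\<^esub> = 0" "f \<oplus>\<^bsub>A_module u C Xs\<^esub> f' = f + f'"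
  by (simp_all add: A_module_def)

lemma A_act_simps:
  "smith_module.act g (A_module u C Xs) (free_const c) f = Polynomial.smult c f"
  "smith_module.act g (A_module u C Xs) gen_x f = shift 1 f * root_poly Xs"
  "smith_module.act g (A_module u C Xs) gen_y f = shift (- 1) f * shift (- 1) (lower_factor Xs)"
  "smith_module.act g (A_module u C Xs) gen_h f = [:0, 1:] * f"
  "smith_module.act g (A_module u C Xs) (free_eval gen_h r) f = r * f"
  by (simp_all add: A_act free_act_const free_act_gen smith_act_y[OF Xs] free_act_eval_h
      del: smith_act.simps(2) mult_pCons_left)

lemma A_left_module: "left_module (smith_algebra g) (A_module u C Xs)"
  using A_smith_module by (simp add: smith_module_def)

lemma A_finitely_generated: "finitely_generated (smith_algebra g) (A_module u C Xs)"
proof (rule finitely_generated_cyclic[OF A_left_module, of 1])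
  have "\<exists>r. f = smith_elem g r \<odot>\<^bsub>A_module u C Xs\<^esub> 1" for f
    using A_act_simps(5)[of f 1] unfolding smith_module.act_def[OF A_smith_module] by (metis mult.right_neutral)
  then show "carrier (A_module u C Xs) = (\<lambda>r. r \<odot>\<^bsub>A_module u C Xs\<^esub> 1) ` carrier (smith_algebra g)"
    unfolding smith_carrier image_image by (simp add: full_SetCompr_eq[symmetric] surj_def)
qed simp

lemma A_submodule_principal:
  assumes "submodule N (smith_algebra g) (A_module u C Xs)"
  obtains d where "N = {f. d dvd f}" "d dvd shift 1 d * root_poly Xs"
    "d dvd shift (- 1) d * shift (- 1) (lower_factor Xs)"
proof -
  note N = submoduleD[OF assms, simplified]
  note act = smith_module.submodule_act[OF A_smith_module assms]
  obtain d where d: "N = {f. d dvd f}"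
  proof (rule poly_ideal_principal)
    show "r * f \<in> N" if "f \<in> N" for r f
      using act[OF that, of "free_eval gen_h r"] by (simp add: A_act_simps)
  qed (use N in auto)
  have "d \<in> N" by (simp add: d)
  then show thesis
    using that[OF d] act[of d gen_x] act[of d gen_y] by (simp add: A_act_simps d)
qed

text \<open>
  As \<open>d\<close> divides \<open>x \<cdot> d = d(h + 1) q(h)\<close>, at a root \<open>b\<close> of \<open>d\<close> either \<open>d(b + 1)\<close> or \<open>q(b)\<close> vanishes; the second
  part comes from \<open>y\<close> in the same way.
\<close>

lemma A_submodule_roots:
  assumes d: "d dvd shift 1 d * root_poly Xs" "d dvd shift (- 1) d * shift (- 1) (lower_factor Xs)"
    and b: "poly d b = 0"
  shows "poly d (b + 1) \<noteq> 0 \<Longrightarrow> b \<in># Xs" and "poly d (b - 1) \<noteq> 0 \<Longrightarrow> b - 1 \<in># roots - Xs"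
proof -
  have "poly (shift 1 d * root_poly Xs) b = 0"
    using d(1) b by (metis dvdE mult_zero_left poly_mult)
  then show "poly d (b + 1) \<noteq> 0 \<Longrightarrow> b \<in># Xs"
    by (simp add: poly_shift poly_root_poly_eq_0_iff del: poly_pcompose)
  have "poly (shift (- 1) d * shift (- 1) (lower_factor Xs)) b = 0"
    using d(2) b by (metis dvdE mult_zero_left poly_mult)
  then show "poly d (b - 1) \<noteq> 0 \<Longrightarrow> b - 1 \<in># roots - Xs"
    using poly_lower_factor_eq_0_iff[of Xs "b - 1"]
    by (simp add: poly_shift del: poly_pcompose)
qed

text \<open>
  A generator \<open>d\<close> of a proper nonzero submodule has a root, and going up and down from it in steps of one
  leads to an element of \<open>X\<close> at the top of the string of roots and to an element of the complement
  of \<open>X\<close> just below its bottom.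
\<close>

lemma A_simple:
  assumes "\<And>a b. \<lbrakk>a \<in># roots - Xs; b \<in># Xs\<rbrakk> \<Longrightarrow> \<not> a \<prec> b"
  shows "simple_module (smith_algebra g) (A_module u C Xs)"
  unfolding simple_module_def
proof (intro conjI allI impI A_left_module)
  have "1 \<in> carrier (A_module u C Xs)" "1 \<notin> {\<zero>\<^bsub>A_module u C Xs\<^esub>}" by simp_all
  then show "carrier (A_module u C Xs) \<noteq> {\<zero>\<^bsub>A_module u C Xs\<^esub>}" by metis
  fix N assume "submodule N (smith_algebra g) (A_module u C Xs)"
  then obtain d where N: "N = {f. d dvd f}" and d: "d dvd shift 1 d * root_poly Xs"
    "d dvd shift (- 1) d * shift (- 1) (lower_factor Xs)"
    by (rule A_submodule_principal)
  consider "d = 0" | b where "d \<noteq> 0" "poly d b = 0" | "d \<noteq> 0" "\<And>b. poly d b \<noteq> 0" by blast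
  then show "N = {\<zero>\<^bsub>A_module u C Xs\<^esub>} \<or> N = carrier (A_module u C Xs)"
  proof cases
    case 1
    then show ?thesis by (auto simp: N)
  next
    case 2
    obtain m where m: "poly d (b + of_nat m * 1) = 0" "poly d (b + of_nat (Suc m) * 1) \<noteq> 0"
      by (rule ex_last_root[OF 2, of 1]) simp
    obtain n where n: "poly d (b + of_nat n * (- 1)) = 0" "poly d (b + of_nat (Suc n) * (- 1)) \<noteq> 0"
      by (rule ex_last_root[OF 2, of "- 1"]) simp
    have top: "b + of_nat m \<in># Xs"
      using A_submodule_roots(1)[OF d, of "b + of_nat m"] m by (simp add: algebra_simps)
    have bot: "b - of_nat n - 1 \<in># roots - Xs"
      using A_submodule_roots(2)[OF d, of "b - of_nat n"] n by (simp add: algebra_simps)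
    have "(b + of_nat m) - (b - of_nat n - 1) = of_nat (m + n + 1)" by simp
    moreover have "of_nat (m + n + 1) \<noteq> (0 :: 'k)" by (simp only: of_nat_eq_0_iff)
    ultimately have "b - of_nat n - 1 \<prec> b + of_nat m"
      unfolding root_less_def root_le_def by (metis right_minus_eq)
    then show ?thesis using assms top bot by blast
  next
    case 3
    then have "Polynomial.degree d = 0"
      using alg_closed_imp_poly_has_root[of d] by blast
    then have "is_unit d" using 3(1) by (simp add: is_unit_iff_degree)
    then show ?thesis by (auto simp: N intro: unit_imp_dvd)
  qed
qed

end

lemma A_hom_of_generators:
  assumes X: "Xs \<subseteq># roots" and Y: "Ys \<subseteq># roots"
    and x: "f * root_poly Ys = shift 1 f * root_poly Xs"
    and y: "f * shift (- 1) (lower_factor Ys) = shift (- 1) f * shift (- 1) (lower_factor Xs)"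
  shows "(*) f \<in> left_module_hom (smith_algebra g) (A_module u C Ys) (A_module u C Xs)"
proof (rule left_module_homI)
  let ?X = "smith_module.act g (A_module u C Xs)" and ?Y = "smith_module.act g (A_module u C Ys)"
  have *: "f * ?Y a m = ?X a (f * m)" for a m
  proof (induction a arbitrary: m rule: free_algebra_induct)
    case (const c)
    show ?case by (simp add: A_act_simps X Y)
  next
    case (gen t)
    show ?case
    proof (cases t)
      case Gen_x
      then show ?thesis using x by (simp add: A_act_simps X Y pcompose_mult mult_ac)
    next
      case Gen_y
      then show ?thesis using y by (simp add: A_act_simps X Y pcompose_mult mult_ac)
    next
      case Gen_h
      then show ?thesis by (simp add: A_act_simps X Y mult_ac)
    qed
  next
    case (add a b)
    then show ?case
      using smith_module.act_plus[OF A_smith_module[OF X]] smith_module.act_plus[OF A_smith_module[OF Y]]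
      by (simp add: X Y algebra_simps)
  next
    case (mult a b)
    then show ?case
      using smith_module.act_times[OF A_smith_module[OF X]] smith_module.act_times[OF A_smith_module[OF Y]]
      by (simp add: X Y)
  qed
  fix r m assume "r \<in> carrier (smith_algebra g)"
  then obtain a where "r = smith_elem g a" by (auto simp: smith_carrier)
  then show "f * (r \<odot>\<^bsub>A_module u C Ys\<^esub> m) = r \<odot>\<^bsub>A_module u C Xs\<^esub> (f * m)"
    using * by (simp add: smith_module.act_def A_smith_module X Y)
qed (simp_all add: X Y algebra_simps)

end

section \<open>Highest weight left ideals of the free algebra\<close>

text \<open>
  The annihilator of a vector of weight \<open>\<mu>\<close> killed by \<open>y\<close> is such a left ideal, and so is every left ideal
  above it.  In this form submodules of the Verma module can be studied inside a ring type.
\<close>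

locale highest_weight_ideal =
  fixes g :: "'k::field_char_0 poly" and \<mu> :: 'k and L :: "(smith_gen, 'k) free_algebra set"
  assumes L_zero: "0 \<in> L" and L_add: "\<lbrakk>a \<in> L; b \<in> L\<rbrakk> \<Longrightarrow> a + b \<in> L"
    and L_mult: "a \<in> L \<Longrightarrow> r * a \<in> L"
    and L_smith: "smith_ideal g \<subseteq> L"
    and L_h: "gen_h - free_const \<mu> \<in> L" and L_y: "gen_y \<in> L"
begin

lemma L_uminus: "a \<in> L \<Longrightarrow> - a \<in> L"
  using L_mult[of a "- 1"] by simp

lemma L_minus: "\<lbrakk>a \<in> L; b \<in> L\<rbrakk> \<Longrightarrow> a - b \<in> L"
  using L_add[OF _ L_uminus] by fastforce

lemma L_rel: "\<lbrakk>a \<in> smith_ideal g\<rbrakk> \<Longrightarrow> a * b \<in> L"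
  using ideal.I_r_closed[OF smith_ideal_ideal, of a g b] L_smith by auto

text \<open>
  Since \<open>x\<close> lowers weights by one, \<open>h\<close> acts on polynomials in \<open>x\<close> as \<open>\<mu> - x d/dx\<close>.
\<close>

lemma h_times_eval_x:
  "gen_h * free_eval gen_x p - free_eval gen_x (Polynomial.smult \<mu> p - pCons 0 (pderiv p)) \<in> L"
proof (induction p)
  case 0
  show ?case by (simp add: L_zero)
next
  case (pCons c p)
  let ?e = "free_eval gen_x :: 'k poly \<Rightarrow> _" and ?c = "free_const :: 'k \<Rightarrow> (smith_gen, 'k) free_algebra"
  let ?q = "Polynomial.smult \<mu> p - pCons 0 (pderiv p)"
  have q: "Polynomial.smult \<mu> (pCons c p) - pCons 0 (pderiv (pCons c p)) = pCons (c * \<mu>) (?q - p)"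
    by (simp add: pderiv_pCons algebra_simps)
  have diff: "?e (?q - p) = ?e ?q - ?e p"
    using free_eval_add[of gen_x "?q - p" p] by (simp add: algebra_simps)
  have "gen_h * ?e (pCons c p) - ?e (pCons (c * \<mu>) (?q - p)) =
      (gen_h * gen_x - gen_x * gen_h + gen_x) * ?e p + gen_x * (gen_h * ?e p - ?e ?q)
        + ?c c * (gen_h - ?c \<mu>)"
    unfolding free_eval_pCons diff free_const_simps
    by (simp add: algebra_simps free_const_central[of c gen_h])
  moreover have "\<dots> \<in> L"
    by (intro L_add L_mult pCons.IH L_h L_rel smith_relations)
  ultimately show ?case by (simp only: q)
qed

text \<open>
  Modulo \<open>L\<close> every element is a polynomial in \<open>x\<close> alone: \<open>y\<close> and \<open>h\<close> can be moved to the right, where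
  they act by scalars.
\<close>

lemma ex_eval_x: "\<exists>p. a - free_eval gen_x p \<in> L"
proof -
  define T where "T = {a. \<exists>p. a - free_eval gen_x p \<in> L}"
  have TI: "a \<in> T" if ab: "a - b \<in> L" "b \<in> T" for a b
  proof -
    obtain p where "b - free_eval gen_x p \<in> L" using ab(2) by (auto simp: T_def)
    then have "(a - b) + (b - free_eval gen_x p) \<in> L" by (rule L_add[OF ab(1)])
    then show ?thesis by (auto simp: T_def)
  qed
  have T_eval: "free_eval gen_x p \<in> T" for p
    using L_zero by (auto simp: T_def intro!: exI[of _ p])
  have T_add: "a + b \<in> T" if "a \<in> T" "b \<in> T" for a b
  proof -
    obtain p q where "a - free_eval gen_x p \<in> L" "b - free_eval gen_x q \<in> L"
      using \<open>a \<in> T\<close> \<open>b \<in> T\<close> by (auto simp: T_def)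
    then have "(a + b) - free_eval gen_x (p + q) \<in> L"
      using L_add[of "a - free_eval gen_x p" "b - free_eval gen_x q"]
      by (simp add: free_eval_add algebra_simps)
    then show ?thesis by (auto simp: T_def)
  qed
  have T_mult: "r * a \<in> T" if "a \<in> T" and r: "\<And>p. r * free_eval gen_x p \<in> T" for r a
  proof -
    obtain p where "a - free_eval gen_x p \<in> L" using \<open>a \<in> T\<close> by (auto simp: T_def)
    then have "r * a - r * free_eval gen_x p \<in> L"
      using L_mult[of "a - free_eval gen_x p" r] by (simp add: right_diff_distrib)
    then show ?thesis using TI r by blast
  qed
  have const: "free_const c * a \<in> T" if "a \<in> T" for c a
    by (rule T_mult[OF that]) (simp add: T_eval free_eval_smult[symmetric])
  have x: "gen_x * a \<in> T" if "a \<in> T" for a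
  proof (rule T_mult[OF that])
    show "gen_x * free_eval gen_x p \<in> T" for p :: "'k poly"
      using T_eval[of "pCons 0 p"] by (simp add: free_eval_pCons free_const_simps)
  qed
  have h: "gen_h * a \<in> T" if "a \<in> T" for a
    by (rule T_mult[OF that]) (rule TI[OF h_times_eval_x T_eval])
  have eval_h: "free_eval gen_h r * a \<in> T" if "a \<in> T" for r a
  proof (induction r)
    case 0
    show ?case using T_eval[of 0] by simp
  next
    case (pCons c r)
    then show ?case
      using T_add[OF const[OF that, of c] h[OF pCons.IH]]
      by (simp add: free_eval_pCons distrib_right mult.assoc)
  qed
  have y: "gen_y * a \<in> T" if "a \<in> T" for a
  proof (rule T_mult[OF that])
    show "gen_y * free_eval gen_x p \<in> T" for p :: "'k poly"
    proof (induction p)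
      case 0
      show ?case using T_eval[of 0] by simp
    next
      case (pCons c p)
      let ?e = "free_eval gen_x p" and ?c = "free_const c :: (smith_gen, 'k) free_algebra"
      have "gen_y * free_eval gen_x (pCons c p) - (gen_x * (gen_y * ?e) + free_eval gen_h g * ?e) =
          ?c * gen_y + (gen_y * gen_x - gen_x * gen_y - free_eval gen_h g) * ?e"
        unfolding free_eval_pCons by (simp add: algebra_simps free_const_central[of c gen_y])
      moreover have "\<dots> \<in> L"
        by (intro L_add L_mult L_y L_rel smith_relations)
      ultimately show ?case
        using TI T_add[OF x[OF pCons.IH] eval_h[OF T_eval]] by metis
    qed
  qed
  have "r * a \<in> T" if "a \<in> T" for r a
    using that
  proof (induction r arbitrary: a rule: free_algebra_induct)
    case (const c)
    then show ?case using \<open>\<And>c a. a \<in> T \<Longrightarrow> free_const c * a \<in> T\<close> by blast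
  next
    case (gen t)
    then show ?case using x y h by (cases t) auto
  next
    case (add r s)
    then show ?case by (simp add: distrib_right T_add)
  next
    case (mult r s)
    then show ?case by (simp add: mult.assoc)
  qed
  moreover have "1 \<in> T" using T_eval[of "[:1:]"] by (simp add: free_eval_const free_const_simps)
  ultimately have "a * 1 \<in> T" by blast
  then show ?thesis by (simp add: T_def)
qed

text \<open>
  Multiplication by \<open>h - \<mu> + d\<close> turns a polynomial of degree \<open>d\<close> in \<open>x\<close> into one of smaller degree and
  multiplies its constant coefficient by \<open>d\<close>.  After finitely many steps only a constant is left.
\<close>

lemma eval_x_constant_coeff:
  assumes "1 \<notin> L" "free_eval gen_x p \<in> L"
  shows "Polynomial.coeff p 0 = 0"
  using assms(2)
proof (induction "Polynomial.degree p" arbitrary: p rule: less_induct)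
  case less
  show ?case
  proof (cases "Polynomial.degree p = 0")
    case True
    then obtain c where p: "p = [:c:]" by (rule degree_eq_zeroE)
    have "c = 0"
    proof (rule ccontr)
      assume "c \<noteq> 0"
      have "free_const (1 / c) * free_const c \<in> L"
        using less.prems by (intro L_mult) (simp add: p free_eval_const)
      then show False using \<open>c \<noteq> 0\<close> assms(1) by (simp add: free_const_simps(1,2,4)[symmetric])
    qed
    then show ?thesis by (simp add: p)
  next
    case False
    let ?d = "of_nat (Polynomial.degree p) :: 'k"
    define q where "q = Polynomial.smult ?d p - pCons 0 (pderiv p)"
    have coeff_q: "Polynomial.coeff q i = (?d - of_nat i) * Polynomial.coeff p i" for i
      by (cases i) (simp_all add: q_def coeff_pderiv algebra_simps)
    have "Polynomial.coeff q i = 0" if "i \<ge> Polynomial.degree p" for i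
      using that by (cases "i = Polynomial.degree p") (simp_all add: coeff_q coeff_eq_0)
    then have deg: "Polynomial.degree q < Polynomial.degree p"
      using False by (metis degree_0 gr0I leading_coeff_0_iff not_le)
    let ?r = "Polynomial.smult \<mu> p - pCons 0 (pderiv p)"
    have "q = ?r + Polynomial.smult (?d - \<mu>) p" by (simp add: q_def smult_diff_left)
    then have "free_eval gen_x q = free_eval gen_x ?r + free_const (?d - \<mu>) * free_eval gen_x p"
      by (simp only: free_eval_add free_eval_smult)
    also have "\<dots> = gen_h * free_eval gen_x p
        - (gen_h * free_eval gen_x p - free_eval gen_x ?r) + free_const (?d - \<mu>) * free_eval gen_x p"
      by simp
    also have "\<dots> \<in> L"
      by (intro L_add L_minus L_mult less.prems h_times_eval_x)
    finally have "Polynomial.coeff q 0 = 0" by (rule less.hyps[OF deg])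
    then show ?thesis using False by (simp add: coeff_q)
  qed
qed

lemma left_ideal_superset:
  assumes "L \<subseteq> L'" "0 \<in> L'" "\<And>a b. \<lbrakk>a \<in> L'; b \<in> L'\<rbrakk> \<Longrightarrow> a + b \<in> L'" "\<And>r a. a \<in> L' \<Longrightarrow> r * a \<in> L'"
  shows "highest_weight_ideal g \<mu> L'"
  by unfold_locales (use assms L_smith L_h L_y in auto)

text \<open>
  Modulo \<open>L\<close> both summands are polynomials in \<open>x\<close> with constant coefficient zero, and so is their sum.
  Hence the sum of two proper left ideals above \<open>L\<close> is proper, and there is only one maximal one.
\<close>

lemma sum_of_proper_left_ideals:
  assumes 1: "highest_weight_ideal g \<mu> L1" "L \<subseteq> L1" "1 \<notin> L1"
    and 2: "highest_weight_ideal g \<mu> L2" "L \<subseteq> L2" "1 \<notin> L2"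
    and ab: "a \<in> L1" "b \<in> L2"
  shows "a + b - 1 \<notin> L"
proof
  interpret L1: highest_weight_ideal g \<mu> L1 by fact
  interpret L2: highest_weight_ideal g \<mu> L2 by fact
  let ?e = "free_eval gen_x :: 'k poly \<Rightarrow> _"
  assume "a + b - 1 \<in> L"
  obtain p where p: "a - ?e p \<in> L" using ex_eval_x by blast
  obtain q where q: "b - ?e q \<in> L" using ex_eval_x by blast
  have "a - (a - ?e p) \<in> L1" using L1.L_minus[OF ab(1)] p 1(2) by blast
  then have p0: "Polynomial.coeff p 0 = 0" using L1.eval_x_constant_coeff[OF 1(3)] by simp
  have "b - (b - ?e q) \<in> L2" using L2.L_minus[OF ab(2)] q 2(2) by blast
  then have q0: "Polynomial.coeff q 0 = 0" using L2.eval_x_constant_coeff[OF 2(3)] by simp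
  have "(a + b - 1) - (a - ?e p) - (b - ?e q) \<in> L"
    by (intro L_minus \<open>a + b - 1 \<in> L\<close> p q)
  also have "(a + b - 1) - (a - ?e p) - (b - ?e q) = ?e (p + q + [:- 1:])"
    by (simp add: free_eval_add free_eval_const free_const_simps)
  finally have "?e (p + q + [:- 1:]) \<in> L1" using 1(2) by blast
  then have "Polynomial.coeff (p + q + [:- 1:]) 0 = 0" by (rule L1.eval_x_constant_coeff[OF 1(3)])
  then show False using p0 q0 by simp
qed

end

section \<open>Characters of the Borel subalgebra\<close>

locale highest_weight_vector = smith_module g M
  for g :: "'k::field_char_0 poly" and M :: "('k smith, 'm, 'd) module_scheme" (structure) +
  fixes \<mu> :: 'k and v :: 'm
  assumes v_carrier: "v \<in> carrier M" and v_nonzero: "v \<noteq> \<zero>"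
    and h_v: "gen_h \<bullet> v = free_const \<mu> \<bullet> v" and y_v: "gen_y \<bullet> v = \<zero>"
begin

lemma const_act_inj:
  assumes "free_const c \<bullet> v = free_const d \<bullet> v"
  shows "c = d"
proof (rule ccontr)
  assume "c \<noteq> d"
  have "free_const (c - d) \<bullet> v = \<zero>"
    using assms v_carrier by (simp add: free_const_simps act_minus M.r_neg a_minus_def)
  then have "(free_const (1 / (c - d)) * free_const (c - d)) \<bullet> v = \<zero>"
    using v_carrier by (simp add: act_times)
  moreover have "free_const (1 / (c - d)) * free_const (c - d) = (1 :: (smith_gen, 'k) free_algebra)"
    using \<open>c \<noteq> d\<close> by (simp add: free_const_simps(4)[symmetric] free_const_simps(2))
  ultimately show False
    using v_carrier v_nonzero by simp
qed

abbreviation S :: "'k smith ring" where "S \<equiv> smith_algebra g"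
abbreviation B :: "'k smith set" where "B \<equiv> smith_borel g"

lemma borel_gens: "smith_elem g (free_const c) \<in> B" "smith_elem g gen_h \<in> B" "smith_elem g gen_y \<in> B"
  unfolding smith_borel_def by (auto intro: generate_ring.incl)

text \<open>
  The scalar \<open>d\<close> is needed for products: \<open>b b'\<close> acts on \<open>v\<close> through the action of \<open>b\<close> on a multiple of \<open>v\<close>.
\<close>

lemma borel_act:
  assumes "b \<in> B"
  shows "\<exists>a c. b = smith_elem g a \<and> (\<forall>d. a \<bullet> free_const d \<bullet> v = free_const (c * d) \<bullet> v)"
  using assms unfolding smith_borel_def
proof (induction b rule: generate_ring.induct)
  case one
  show ?case
    by (rule exI[of _ 1], rule exI[of _ 1]) (simp add: smith_elem_simps v_carrier)
next
  case (incl b)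
  have const: "a \<bullet> free_const d \<bullet> v = free_const d \<bullet> a \<bullet> v" for a d
    using free_const_central[of d a] v_carrier by (simp add: act_times[symmetric])
  consider c where "b = smith_elem g (free_const c)" | "b = smith_elem g gen_h" | "b = smith_elem g gen_y"
    using incl by auto
  then show ?case
  proof cases
    case (1 c)
    then show ?thesis
      using v_carrier by (intro exI[of _ "free_const c"] exI[of _ c]) (simp add: act_times[symmetric] free_const_simps)
  next
    case 2
    have "gen_h \<bullet> free_const d \<bullet> v = free_const (\<mu> * d) \<bullet> v" for d
      unfolding const[of gen_h] h_v
      using v_carrier by (simp add: act_times[symmetric] free_const_simps(4)[symmetric] mult.commute)
    then show ?thesis using 2 by blast
  next
    case 3
    then show ?thesis
      using v_carrier by (intro exI[of _ gen_y] exI[of _ 0]) (simp add: const[of gen_y] y_v free_const_simps)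
  qed
next
  case (a_inv b)
  then obtain a c where a: "b = smith_elem g a" "\<And>d. a \<bullet> free_const d \<bullet> v = free_const (c * d) \<bullet> v" by blast
  then show ?case
    using v_carrier by (intro exI[of _ "- a"] exI[of _ "- c"])
      (simp add: smith_elem_uminus act_uminus free_const_simps)
next
  case (eng_add b b')
  then obtain a c a' c' where
    "b = smith_elem g a" "\<And>d. a \<bullet> free_const d \<bullet> v = free_const (c * d) \<bullet> v"
    "b' = smith_elem g a'" "\<And>d. a' \<bullet> free_const d \<bullet> v = free_const (c' * d) \<bullet> v" by blast
  then show ?case
    using v_carrier by (intro exI[of _ "a + a'"] exI[of _ "c + c'"])
      (simp add: smith_elem_simps act_plus free_const_simps distrib_right)
next
  case (eng_mult b b')
  then obtain a c a' c' where
    "b = smith_elem g a" "\<And>d. a \<bullet> free_const d \<bullet> v = free_const (c * d) \<bullet> v"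
    "b' = smith_elem g a'" "\<And>d. a' \<bullet> free_const d \<bullet> v = free_const (c' * d) \<bullet> v" by blast
  then show ?case
    using v_carrier by (intro exI[of _ "a * a'"] exI[of _ "c * c'"])
      (simp add: smith_elem_simps act_times mult.assoc)
qed

lemma borel_carrier: "B \<subseteq> carrier S"
  using borel_act smith_elem_simps(1) by fastforce

text \<open>
  That the Borel subalgebra has a character with the prescribed values cannot be read off from its
  generators, since relations among them have to be respected.  The action on the line spanned by \<open>v\<close> provides one.
\<close>

definition weight_char :: "'k smith \<Rightarrow> 'k"
  where "weight_char = restrict (\<lambda>b. THE c. b \<odot> v = free_const c \<bullet> v) B"

lemma weight_char_eqI:
  assumes "b \<in> B" "b \<odot> v = free_const c \<bullet> v"
  shows "weight_char b = c"
  using assms const_act_inj by (auto simp: weight_char_def)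

lemma weight_char:
  assumes "b \<in> B"
  shows "b \<odot> free_const d \<bullet> v = free_const (weight_char b * d) \<bullet> v"
proof -
  obtain a c where a: "b = smith_elem g a" "\<And>d. a \<bullet> free_const d \<bullet> v = free_const (c * d) \<bullet> v"
    using borel_act[OF assms] by blast
  have "weight_char b = c"
    using a(2)[of 1] v_carrier by (intro weight_char_eqI[OF assms]) (simp add: a(1) act_def[symmetric] free_const_simps)
  then show ?thesis using a by (simp add: act_def[symmetric])
qed

lemma weight_char_1: "b \<in> B \<Longrightarrow> b \<odot> v = free_const (weight_char b) \<bullet> v"
  using weight_char[of b 1] v_carrier by (simp add: free_const_simps)

lemma borel_character_eq: "borel_character g \<mu> = weight_char"
  unfolding borel_character_def
proof (rule the_equality)
  have hom: "weight_char \<in> ring_hom (S\<lparr>carrier := B\<rparr>) ring_of_type_algebra"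
  proof (rule ring_hom_memI)
    fix b b' assume "b \<in> carrier (S\<lparr>carrier := B\<rparr>)" "b' \<in> carrier (S\<lparr>carrier := B\<rparr>)"
    then have b: "b \<in> B" "b' \<in> B" "b \<in> carrier S" "b' \<in> carrier S" using borel_carrier by auto
    have "b \<otimes>\<^bsub>S\<^esub> b' \<in> B" "b \<oplus>\<^bsub>S\<^esub> b' \<in> B"
      using b(1,2) unfolding smith_borel_def by (auto intro: generate_ring.intros)
    moreover have "(b \<otimes>\<^bsub>S\<^esub> b') \<odot> v = free_const (weight_char b * weight_char b') \<bullet> v"
      using b v_carrier by (simp add: smult_assoc1 weight_char_1[of b'] weight_char)
    moreover have "(b \<oplus>\<^bsub>S\<^esub> b') \<odot> v = free_const (weight_char b + weight_char b') \<bullet> v"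
      using b v_carrier by (simp add: smult_l_distr weight_char_1 free_const_simps act_plus)
    ultimately show "weight_char (b \<otimes>\<^bsub>S\<lparr>carrier := B\<rparr>\<^esub> b') =
        weight_char b \<otimes>\<^bsub>ring_of_type_algebra\<^esub> weight_char b'"
      "weight_char (b \<oplus>\<^bsub>S\<lparr>carrier := B\<rparr>\<^esub> b') = weight_char b \<oplus>\<^bsub>ring_of_type_algebra\<^esub> weight_char b'"
      by (simp_all add: weight_char_eqI)
  next
    have "\<one>\<^bsub>S\<^esub> \<in> B" unfolding smith_borel_def by (rule generate_ring.one)
    then show "weight_char \<one>\<^bsub>S\<lparr>carrier := B\<rparr>\<^esub> = \<one>\<^bsub>ring_of_type_algebra\<^esub>"
      using v_carrier by (simp add: weight_char_eqI free_const_simps)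
  qed simp
  have const: "weight_char (smith_elem g (free_const c)) = c" for c
    by (rule weight_char_eqI) (simp_all add: borel_gens act_def)
  have h: "weight_char (smith_elem g gen_h) = \<mu>"
    by (rule weight_char_eqI) (use h_v in \<open>simp_all add: borel_gens act_def\<close>)
  have y: "weight_char (smith_elem g gen_y) = 0"
    using y_v v_carrier by (intro weight_char_eqI) (simp_all add: borel_gens act_def[symmetric] free_const_simps)
  show "weight_char \<in> ring_hom (S\<lparr>carrier := B\<rparr>) ring_of_type_algebra \<and> weight_char \<in> extensional B \<and>
      (\<forall>c. weight_char (smith_elem g (free_const c)) = c) \<and>
      weight_char (smith_elem g gen_h) = \<mu> \<and> weight_char (smith_elem g gen_y) = 0"
    using hom const h y by (auto simp: weight_char_def)
  fix \<chi> :: "'k smith \<Rightarrow> 'k"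
  assume "\<chi> \<in> ring_hom (S\<lparr>carrier := B\<rparr>) ring_of_type_algebra \<and> \<chi> \<in> extensional B \<and>
      (\<forall>c. \<chi> (smith_elem g (free_const c)) = c) \<and> \<chi> (smith_elem g gen_h) = \<mu> \<and> \<chi> (smith_elem g gen_y) = 0"
  then have \<chi>: "\<chi> \<in> ring_hom (S\<lparr>carrier := B\<rparr>) ring_of_type_algebra" "\<chi> \<in> extensional B"
    "\<And>c. \<chi> (smith_elem g (free_const c)) = c" "\<chi> (smith_elem g gen_h) = \<mu>" "\<chi> (smith_elem g gen_y) = 0"
    by auto
  have uminus: "\<psi> (\<ominus>\<^bsub>S\<^esub> b) = - \<psi> b"
    if \<psi>: "\<psi> \<in> ring_hom (S\<lparr>carrier := B\<rparr>) ring_of_type_algebra" "\<And>c. \<psi> (smith_elem g (free_const c)) = c"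
      and b: "b \<in> B" for \<psi> :: "'k smith \<Rightarrow> 'k" and b
  proof -
    have b': "\<ominus>\<^bsub>S\<^esub> b \<in> B" using b unfolding smith_borel_def by (rule generate_ring.a_inv)
    have "\<ominus>\<^bsub>S\<^esub> b \<oplus>\<^bsub>S\<^esub> b = smith_elem g (free_const 0)"
      using b borel_carrier by (simp add: R.l_neg free_const_simps smith_elem_zero subset_iff)
    then have "\<psi> (\<ominus>\<^bsub>S\<^esub> b) + \<psi> b = 0"
      using ring_hom_add[OF \<psi>(1), of "\<ominus>\<^bsub>S\<^esub> b" b] b b' \<psi>(2) by simp
    then show ?thesis by (simp add: eq_neg_iff_add_eq_0)
  qed
  have "\<chi> b = weight_char b" if "b \<in> B" for b
    using that unfolding smith_borel_def
  proof (induction b rule: generate_ring.induct)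
    case one
    show ?case using ring_hom_one[OF \<chi>(1)] ring_hom_one[OF hom] by simp
  next
    case (incl b)
    then show ?case using \<chi> const h y by auto
  next
    case (a_inv b)
    then show ?case using uminus[OF \<chi>(1,3)] uminus[OF hom const] by (simp add: smith_borel_def)
  next
    case (eng_add b b')
    then show ?case
      using ring_hom_add[OF \<chi>(1), of b b'] ring_hom_add[OF hom, of b b'] by (simp add: smith_borel_def)
  next
    case (eng_mult b b')
    then show ?case
      using ring_hom_mult[OF \<chi>(1), of b b'] ring_hom_mult[OF hom, of b b'] by (simp add: smith_borel_def)
  qed
  then show "\<chi> = weight_char"
    using \<chi>(2) by (intro extensionalityI[of _ B]) (auto simp: weight_char_def)
qed

end

section \<open>Verma modules\<close>

text \<open>
  The action of a scalar on the generators extends to the free abelian group, but a sum of scalars acts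
  as the sum of their actions only modulo the balanced relations.
\<close>

definition tensor_operators ::
    "('r, 'c) ring_scheme \<Rightarrow> ('r, 'n, 'd) module_scheme \<Rightarrow> ('r, 'r \<times> 'n \<Rightarrow>\<^sub>0 int) module"
  where "tensor_operators S N =
    \<lparr>carrier = {t. Poly_Mapping.keys t \<subseteq> carrier S \<times> carrier N}, monoid.mult = undefined, one = undefined,
     ring.zero = 0, add = (+), module.smult = (\<lambda>s t. frag_extend (\<lambda>(a, n). frag_of (s \<otimes>\<^bsub>S\<^esub> a, n)) t)\<rparr>"

definition tensor_kernel ::
    "('r, 'c) ring_scheme \<Rightarrow> 'r set \<Rightarrow> ('r, 'n, 'd) module_scheme \<Rightarrow> ('r \<times> 'n \<Rightarrow>\<^sub>0 int) set"
  where "tensor_kernel S B N = generate (free_Abelian_group (carrier S \<times> carrier N)) (tensor_relations S B N)"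

lemma induced_module_eq_quotient:
  "induced_module S B N = quotient_module (tensor_operators S N) (tensor_kernel S B N)"
  by (simp add: induced_module_def quotient_module_def Let_def tensor_operators_def tensor_kernel_def
      A_RCOSETS_def RCOSETS_def r_coset_def a_r_coset_def set_add_def set_mult_def free_Abelian_group_def
      fun_eq_iff)

locale tensor_data = ring S for S :: "('r, 'c) ring_scheme" (structure) +
  fixes B :: "'r set" and N :: "('r, 'n, 'd) module_scheme"
  assumes B_carrier: "B \<subseteq> carrier S"
    and N_add: "\<lbrakk>m \<in> carrier N; n \<in> carrier N\<rbrakk> \<Longrightarrow> m \<oplus>\<^bsub>N\<^esub> n \<in> carrier N"
    and N_smult: "\<lbrakk>b \<in> B; n \<in> carrier N\<rbrakk> \<Longrightarrow> b \<odot>\<^bsub>N\<^esub> n \<in> carrier N"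
begin

abbreviation P where "P \<equiv> tensor_operators S N"
abbreviation I where "I \<equiv> tensor_kernel S B N"
abbreviation F where "F \<equiv> free_Abelian_group (carrier S \<times> carrier N)"

lemma P_simps [simp]:
  "carrier P = {t. Poly_Mapping.keys t \<subseteq> carrier S \<times> carrier N}"
  "\<zero>\<^bsub>P\<^esub> = 0" "t \<oplus>\<^bsub>P\<^esub> t' = t + t'"
  "s \<odot>\<^bsub>P\<^esub> t = frag_extend (\<lambda>(a, n). frag_of (s \<otimes> a, n)) t"
  by (simp_all add: tensor_operators_def)

lemma keys_minus_closed:
  "\<lbrakk>Poly_Mapping.keys t \<subseteq> A; Poly_Mapping.keys t' \<subseteq> A\<rbrakk> \<Longrightarrow> Poly_Mapping.keys (t - t' :: 'x \<Rightarrow>\<^sub>0 int) \<subseteq> A"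
  using keys_diff[of t t'] by blast

lemma keys_plus_closed:
  "\<lbrakk>Poly_Mapping.keys t \<subseteq> A; Poly_Mapping.keys t' \<subseteq> A\<rbrakk> \<Longrightarrow> Poly_Mapping.keys (t + t' :: 'x \<Rightarrow>\<^sub>0 int) \<subseteq> A"
  using Poly_Mapping.keys_add[of t t'] by blast

lemma P_abelian_group: "abelian_group P"
proof (rule abelian_groupI)
  show "\<exists>t'\<in>carrier P. t' \<oplus>\<^bsub>P\<^esub> t = \<zero>\<^bsub>P\<^esub>" if "t \<in> carrier P" for t
    using that by (intro bexI[of _ "- t"]) auto
qed (auto simp: algebra_simps dest: keys_plus_closed[THEN subsetD, rotated 2])

lemma P_a_inv: "t \<in> carrier P \<Longrightarrow> \<ominus>\<^bsub>P\<^esub> t = - t"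
  by (rule abelian_group.minus_equality[OF P_abelian_group]) auto

lemma relations_carrier: "tensor_relations S B N \<subseteq> carrier F"
  using B_carrier N_add N_smult
  by (auto simp: tensor_relations_def subset_iff dest!: keys_diff[THEN subsetD])

lemma I_generates:
  shows I_zero: "0 \<in> I"
    and I_rel: "t \<in> tensor_relations S B N \<Longrightarrow> t \<in> I"
    and I_add: "\<lbrakk>t \<in> I; t' \<in> I\<rbrakk> \<Longrightarrow> t + t' \<in> I"
    and I_uminus: "t \<in> I \<Longrightarrow> - t \<in> I"
    and I_carrier: "t \<in> I \<Longrightarrow> Poly_Mapping.keys t \<subseteq> carrier S \<times> carrier N"
proof -
  have sub: "subgroup I F"
    unfolding tensor_kernel_def by (rule group.generate_is_subgroup) (simp_all add: relations_carrier)
  show carr: "Poly_Mapping.keys t \<subseteq> carrier S \<times> carrier N" if "t \<in> I" for t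
    using subgroup.subset[OF sub, THEN subsetD, OF that] by simp
  show "0 \<in> I" "\<lbrakk>t \<in> I; t' \<in> I\<rbrakk> \<Longrightarrow> t + t' \<in> I"
    using subgroup.one_closed[OF sub] subgroup.m_closed[OF sub] by simp_all
  show "t \<in> I \<Longrightarrow> - t \<in> I"
    using subgroup.m_inv_closed[OF sub, of t] carr by simp
  show "t \<in> tensor_relations S B N \<Longrightarrow> t \<in> I"
    unfolding tensor_kernel_def by (rule generate.incl)
qed

lemma I_minus: "\<lbrakk>t \<in> I; t' \<in> I\<rbrakk> \<Longrightarrow> t - t' \<in> I"
  using I_add[OF _ I_uminus] by fastforce

lemma I_induct [consumes 1, case_names rel diff]:
  assumes t: "t \<in> I" and rel: "\<And>t. t \<in> tensor_relations S B N \<Longrightarrow> Q t"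
    and diff: "\<And>t t'. \<lbrakk>t \<in> I; t' \<in> I; Q t; Q t'\<rbrakk> \<Longrightarrow> Q (t - t')" and zero: "Q 0"
  shows "Q t"
proof -
  have gen: "generate F (tensor_relations S B N) = I" by (simp add: tensor_kernel_def)
  have neg: "Q (- t)" if "t \<in> I" "Q t" for t
    using diff[OF I_zero that(1) zero that(2)] by simp
  show ?thesis
    using t unfolding tensor_kernel_def
  proof (induction t rule: generate.induct)
    case (inv t)
    then have "- t = inv\<^bsub>F\<^esub> t" using relations_carrier by auto
    then show ?case using neg[OF I_rel rel] inv by metis
  next
    case (eng t t')
    then have "Q (t - - t')" using diff neg I_uminus unfolding gen by blast
    then show ?case by simp
  qed (use zero rel in auto)
qed

lemma tensor_rel:
  "\<lbrakk>s \<in> carrier S; t \<in> carrier S; n \<in> carrier N\<rbrakk> \<Longrightarrow>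
    frag_of (s \<oplus> t, n) - frag_of (s, n) - frag_of (t, n) \<in> tensor_relations S B N"
  "\<lbrakk>s \<in> carrier S; m \<in> carrier N; n \<in> carrier N\<rbrakk> \<Longrightarrow>
    frag_of (s, m \<oplus>\<^bsub>N\<^esub> n) - frag_of (s, m) - frag_of (s, n) \<in> tensor_relations S B N"
  "\<lbrakk>s \<in> carrier S; b \<in> B; n \<in> carrier N\<rbrakk> \<Longrightarrow>
    frag_of (s \<otimes> b, n) - frag_of (s, b \<odot>\<^bsub>N\<^esub> n) \<in> tensor_relations S B N"
  unfolding tensor_relations_def by blast+

lemma relations_cases:
  assumes "t \<in> tensor_relations S B N"
  obtains s s' n where "s \<in> carrier S" "s' \<in> carrier S" "n \<in> carrier N"
      "t = frag_of (s \<oplus> s', n) - frag_of (s, n) - frag_of (s', n)"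
  | s m n where "s \<in> carrier S" "m \<in> carrier N" "n \<in> carrier N"
      "t = frag_of (s, m \<oplus>\<^bsub>N\<^esub> n) - frag_of (s, m) - frag_of (s, n)"
  | s b n where "s \<in> carrier S" "b \<in> B" "n \<in> carrier N"
      "t = frag_of (s \<otimes> b, n) - frag_of (s, b \<odot>\<^bsub>N\<^esub> n)"
  using assms unfolding tensor_relations_def by (elim UnE CollectE exE conjE) (rule that; assumption)+

lemma smult_closed: "\<lbrakk>s \<in> carrier S; t \<in> carrier P\<rbrakk> \<Longrightarrow> s \<odot>\<^bsub>P\<^esub> t \<in> carrier P"
proof -
  assume st: "s \<in> carrier S" "t \<in> carrier P"
  have "Poly_Mapping.keys (case x of (a, n) \<Rightarrow> frag_of (s \<otimes> a, n)) \<subseteq> carrier S \<times> carrier N"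
    if "x \<in> Poly_Mapping.keys t" for x
    using that st by (cases x) auto
  then have "(\<Union>x\<in>Poly_Mapping.keys t. Poly_Mapping.keys (case x of (a, n) \<Rightarrow> frag_of (s \<otimes> a, n)))
      \<subseteq> carrier S \<times> carrier N"
    by (rule UN_least)
  then show ?thesis
    using keys_frag_extend[of "\<lambda>(a, n). frag_of (s \<otimes> a, n)" t] by simp
qed

lemma smult_stable:
  assumes s: "s \<in> carrier S" and t: "t \<in> I"
  shows "s \<odot>\<^bsub>P\<^esub> t \<in> I"
  using t
proof (induction t rule: I_induct)
  case (rel t)
  then show ?case
  proof (cases rule: relations_cases)
    case (1 a a' n)
    then show ?thesis
      using s I_rel[OF tensor_rel(1)[of "s \<otimes> a" "s \<otimes> a'" n]] by (simp add: frag_extend_diff r_distr)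
  next
    case (2 a m n)
    then show ?thesis
      using s I_rel[OF tensor_rel(2)[of "s \<otimes> a" m n]] by (simp add: frag_extend_diff)
  next
    case (3 a b n)
    then show ?thesis
      using s B_carrier I_rel[OF tensor_rel(3)[of "s \<otimes> a" b n]]
      by (simp add: frag_extend_diff m_assoc subset_iff)
  qed
qed (simp_all add: frag_extend_diff I_minus I_zero)

lemma operator_quotient_tensor: "operator_quotient I P S"
proof (intro operator_quotient.intro operator_quotient_axioms.intro ring_axioms)
  have "subgroup I (add_monoid P)"
  proof (rule subgroup.intro)
    show "inv\<^bsub>add_monoid P\<^esub> t \<in> I" if "t \<in> I" for t
      unfolding a_inv_def[symmetric] using that by (simp add: P_a_inv I_carrier I_uminus)
  qed (auto simp: I_zero I_add dest: I_carrier[THEN subsetD, rotated])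
  then show "abelian_subgroup I P"
    by (rule abelian_subgroupI2[OF abelian_group.a_comm_group[OF P_abelian_group]])
  show "s \<odot>\<^bsub>P\<^esub> t \<in> carrier P" if "s \<in> carrier S" "t \<in> carrier P" for s t
    using that by (rule smult_closed)
  show "s \<odot>\<^bsub>P\<^esub> t \<in> I" if "s \<in> carrier S" "t \<in> I" for s t
    using that by (rule smult_stable)
qed (simp add: frag_extend_add)

lemma tensor_coset_eq_iff:
  assumes "t \<in> carrier P" "t' \<in> carrier P"
  shows "I +>\<^bsub>P\<^esub> t = I +>\<^bsub>P\<^esub> t' \<longleftrightarrow> t - t' \<in> I"
  using operator_quotient.coset_eq_iff[OF operator_quotient_tensor assms] assms
  by (simp add: a_minus_def P_a_inv)

lemma induced_left_module: "left_module S (induced_module S B N)"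
  unfolding induced_module_eq_quotient
proof (rule operator_quotient.quotient_left_module[OF operator_quotient_tensor])
  fix t assume t: "t \<in> carrier P"
  then have keys: "Poly_Mapping.keys t \<subseteq> carrier S \<times> carrier N" by simp
  fix a b assume a: "a \<in> carrier S" and b: "b \<in> carrier S"
  note closed = smult_closed[OF a t] smult_closed[OF b t] 
  have "(a \<oplus> b) \<odot>\<^bsub>P\<^esub> t - (a \<odot>\<^bsub>P\<^esub> t + b \<odot>\<^bsub>P\<^esub> t) \<in> I"
    using keys
  proof (induction t rule: frag_induction)
    case (one x)
    then obtain c n where "x = (c, n)" "c \<in> carrier S" "n \<in> carrier N" by auto
    then show ?case
      using a b I_rel[OF tensor_rel(1)[of "a \<otimes> c" "b \<otimes> c" n]] by (simp add: l_distr algebra_simps)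
  next
    case (diff t t')
    show ?case using I_minus[OF diff] by (simp add: frag_extend_diff algebra_simps)
  qed (simp add: I_zero)
  then show "I +>\<^bsub>P\<^esub> ((a \<oplus> b) \<odot>\<^bsub>P\<^esub> t) = I +>\<^bsub>P\<^esub> (a \<odot>\<^bsub>P\<^esub> t \<oplus>\<^bsub>P\<^esub> b \<odot>\<^bsub>P\<^esub> t)"
    using smult_closed[OF a_closed[OF a b] t] closed
    by (subst tensor_coset_eq_iff) (auto dest: keys_plus_closed[THEN subsetD, rotated 2])
  have "(a \<otimes> b) \<odot>\<^bsub>P\<^esub> t = a \<odot>\<^bsub>P\<^esub> (b \<odot>\<^bsub>P\<^esub> t)"
    using keys
  proof (induction t rule: frag_induction)
    case (one x)
    then show ?case using a b by (auto simp: m_assoc)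
  qed (simp_all add: frag_extend_diff)
  then show "I +>\<^bsub>P\<^esub> ((a \<otimes> b) \<odot>\<^bsub>P\<^esub> t) = I +>\<^bsub>P\<^esub> (a \<odot>\<^bsub>P\<^esub> (b \<odot>\<^bsub>P\<^esub> t))" by simp
next
  fix t assume "t \<in> carrier P"
  then have keys: "Poly_Mapping.keys t \<subseteq> carrier S \<times> carrier N" by simp
  have "\<one> \<odot>\<^bsub>P\<^esub> t = t"
    using keys by (induction t rule: frag_induction) (auto simp: frag_extend_diff)
  then show "I +>\<^bsub>P\<^esub> (\<one> \<odot>\<^bsub>P\<^esub> t) = I +>\<^bsub>P\<^esub> t" by simp
qed

lemma induced_hom:
  assumes M: "left_module S M"
    and cl: "\<And>s n. \<lbrakk>s \<in> carrier S; n \<in> carrier N\<rbrakk> \<Longrightarrow> f (s, n) \<in> carrier M"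
    and smult: "\<And>r s n. \<lbrakk>r \<in> carrier S; s \<in> carrier S; n \<in> carrier N\<rbrakk> \<Longrightarrow> f (r \<otimes> s, n) = r \<odot>\<^bsub>M\<^esub> f (s, n)"
    and add1: "\<And>s t n. \<lbrakk>s \<in> carrier S; t \<in> carrier S; n \<in> carrier N\<rbrakk> \<Longrightarrow>
      f (s \<oplus> t, n) = f (s, n) \<oplus>\<^bsub>M\<^esub> f (t, n)"
    and add2: "\<And>s m n. \<lbrakk>s \<in> carrier S; m \<in> carrier N; n \<in> carrier N\<rbrakk> \<Longrightarrow>
      f (s, m \<oplus>\<^bsub>N\<^esub> n) = f (s, m) \<oplus>\<^bsub>M\<^esub> f (s, n)"
    and bal: "\<And>s b n. \<lbrakk>s \<in> carrier S; b \<in> B; n \<in> carrier N\<rbrakk> \<Longrightarrow> f (s \<otimes> b, n) = f (s, b \<odot>\<^bsub>N\<^esub> n)"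
  obtains H where "H \<in> left_module_hom S (induced_module S B N) M"
    and "\<And>s n. \<lbrakk>s \<in> carrier S; n \<in> carrier N\<rbrakk> \<Longrightarrow> H (I +>\<^bsub>P\<^esub> frag_of (s, n)) = f (s, n)"
proof -
  interpret M: left_module S M by fact
  have "f ` (carrier S \<times> carrier N) \<subseteq> carrier (add_monoid M)" using cl by auto
  then obtain h where h: "h \<in> hom F (add_monoid M)"
    and h_of: "\<And>x. x \<in> carrier S \<times> carrier N \<Longrightarrow> h (frag_of x) = f x"
    using comm_group.free_Abelian_group_universal[OF M.M.a_comm_group] by blast
  have h_closed: "h t \<in> carrier M" if "t \<in> carrier P" for t
    using h that by (auto simp: hom_def Pi_iff)
  have h_add: "h (t + t') = h t \<oplus>\<^bsub>M\<^esub> h t'" if "t \<in> carrier P" "t' \<in> carrier P" for t t'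
    using hom_mult[OF h, of t t'] that by simp
  have h_zero: "h 0 = \<zero>\<^bsub>M\<^esub>"
    using h_add[of 0 0] h_closed[of 0] by simp
  have h_diff: "h (t - t') = h t \<ominus>\<^bsub>M\<^esub> h t'" if t: "t \<in> carrier P" "t' \<in> carrier P" for t t'
  proof -
    have d: "t - t' \<in> carrier P" using t keys_minus_closed[of t _ t'] by simp
    have "h t = h (t - t') \<oplus>\<^bsub>M\<^esub> h t'" using h_add[OF d t(2)] by simp
    then show ?thesis
      using h_closed[OF d] h_closed[OF t(2)] by (simp add: a_minus_def M.M.a_assoc M.M.r_neg)
  qed
  have smult_zero: "r \<odot>\<^bsub>M\<^esub> \<zero>\<^bsub>M\<^esub> = \<zero>\<^bsub>M\<^esub>" if "r \<in> carrier S" for r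
    using M.smult_r_distr[OF that, of "\<zero>\<^bsub>M\<^esub>" "\<zero>\<^bsub>M\<^esub>"] that by simp
  have smult_minus: "r \<odot>\<^bsub>M\<^esub> (m \<ominus>\<^bsub>M\<^esub> n) = r \<odot>\<^bsub>M\<^esub> m \<ominus>\<^bsub>M\<^esub> r \<odot>\<^bsub>M\<^esub> n"
    if "r \<in> carrier S" "m \<in> carrier M" "n \<in> carrier M" for r m n
  proof -
    have "r \<odot>\<^bsub>M\<^esub> (m \<ominus>\<^bsub>M\<^esub> n) \<oplus>\<^bsub>M\<^esub> r \<odot>\<^bsub>M\<^esub> n = r \<odot>\<^bsub>M\<^esub> m"
      using that by (simp add: M.smult_r_distr[symmetric] a_minus_def M.M.a_assoc M.M.l_neg)
    then show ?thesis
      using that by (metis M.M.add.inv_solve_right M.M.minus_closed M.smult_closed a_minus_def)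
  qed
  have h_smult: "h (r \<odot>\<^bsub>P\<^esub> t) = r \<odot>\<^bsub>M\<^esub> h t" if r: "r \<in> carrier S" and t: "t \<in> carrier P" for r t
  proof -
    have "r \<odot>\<^bsub>P\<^esub> t \<in> carrier P \<and> t \<in> carrier P \<and> h (r \<odot>\<^bsub>P\<^esub> t) = r \<odot>\<^bsub>M\<^esub> h t"
      using t[simplified]
    proof (induction t rule: frag_induction)
      case (diff t t')
      have "t - t' \<in> carrier P" using diff keys_minus_closed[of t _ t'] by simp
      moreover have "h (r \<odot>\<^bsub>P\<^esub> (t - t')) = h (r \<odot>\<^bsub>P\<^esub> t - r \<odot>\<^bsub>P\<^esub> t')" by (simp add: frag_extend_diff)
      moreover have "\<dots> = r \<odot>\<^bsub>M\<^esub> h (t - t')"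
        using diff r h_closed by (simp only: h_diff smult_minus)
      ultimately show ?case using smult_closed[OF r] by metis
    qed (use r in \<open>auto simp: h_of smult h_zero smult_zero\<close>)
    then show ?thesis by blast
  qed
  have h_frag2: "h (frag_of x - frag_of y) = f x \<ominus>\<^bsub>M\<^esub> f y"
    if "x \<in> carrier S \<times> carrier N" "y \<in> carrier S \<times> carrier N" for x y
    using that by (simp add: h_diff h_of)
  have h_frag3: "h (frag_of x - frag_of y - frag_of z) = \<zero>\<^bsub>M\<^esub>"
    if x: "x \<in> carrier S \<times> carrier N" "y \<in> carrier S \<times> carrier N" "z \<in> carrier S \<times> carrier N"
      and f: "f x = f y \<oplus>\<^bsub>M\<^esub> f z" for x y z
  proof -
    have d: "frag_of x - frag_of y \<in> carrier P"
      using x keys_minus_closed[of "frag_of x" _ "frag_of y"] by simp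
    have c: "f y \<in> carrier M" "f z \<in> carrier M" using x cl by auto
    have "h (frag_of x - frag_of y - frag_of z) = (f x \<ominus>\<^bsub>M\<^esub> f y) \<ominus>\<^bsub>M\<^esub> f z"
      using x h_diff[OF d, of "frag_of z"] by (simp add: h_frag2 h_of)
    also have "\<dots> = (f y \<oplus>\<^bsub>M\<^esub> f z) \<oplus>\<^bsub>M\<^esub> \<ominus>\<^bsub>M\<^esub> (f y \<oplus>\<^bsub>M\<^esub> f z)"
      using c by (simp add: f a_minus_def M.M.minus_add M.M.a_assoc)
    finally show ?thesis
      using c by (simp add: M.M.r_neg)
  qed
  have h_I: "h t = \<zero>\<^bsub>M\<^esub>" if "t \<in> I" for t
    using that
  proof (induction t rule: I_induct)
    case (rel t)
    then show ?case
    proof (cases rule: relations_cases)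
      case (1 s s' n)
      then show ?thesis by (auto intro!: h_frag3 simp: add1)
    next
      case (2 s m n)
      then show ?thesis by (auto intro!: h_frag3 simp: add2 N_add)
    next
      case (3 s b n)
      then show ?thesis
        using B_carrier N_smult[of b n] cl by (simp add: h_frag2 bal subset_iff a_minus_def M.M.r_neg)
    qed
  qed (simp_all add: h_diff I_carrier h_zero a_minus_def)
  obtain H where "H \<in> left_module_hom S (quotient_module P I) M"
    and "\<And>t. t \<in> carrier P \<Longrightarrow> H (I +>\<^bsub>P\<^esub> t) = h t"
  proof (rule operator_quotient.quotient_induced_hom[OF operator_quotient_tensor M h_closed])
    show "h (t \<oplus>\<^bsub>P\<^esub> t') = h t \<oplus>\<^bsub>M\<^esub> h t'" if "t \<in> carrier P" "t' \<in> carrier P" for t t'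
      using h_add[OF that] by simp
  qed (use h_smult h_I in blast)+
  then show thesis
    using that[of H] by (simp add: induced_module_eq_quotient h_of)
qed

end

context highest_weight_vector
begin

abbreviation K :: "('k smith, 'k) module" where "K \<equiv> one_dim_module g \<mu>"
abbreviation W where "W \<equiv> verma g \<mu>"

lemma K_simps [simp]:
  "carrier K = UNIV" "c \<oplus>\<^bsub>K\<^esub> d = c + d" "b \<odot>\<^bsub>K\<^esub> c = weight_char b * c"
  by (simp_all add: one_dim_module_def borel_character_eq)

lemma tensor_data_verma: "tensor_data S B K"
  by (intro tensor_data.intro tensor_data_axioms.intro smith_ring borel_carrier) auto

sublocale T: tensor_data S B K
  by (rule tensor_data_verma)

lemma verma_eq_quotient: "W = quotient_module T.P T.I"
  by (simp add: verma_def induced_module_eq_quotient)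

lemma W_smith_module: "smith_module g W"
  using T.induced_left_module by (simp add: smith_module_def verma_def)

sublocale W: smith_module g W
  by (rule W_smith_module)

definition pure_tensor :: "'k smith \<Rightarrow> 'k \<Rightarrow> ('k smith \<times> 'k \<Rightarrow>\<^sub>0 int) set"
  where "pure_tensor s c = T.I +>\<^bsub>T.P\<^esub> frag_of (s, c)"

abbreviation w where "w \<equiv> pure_tensor \<one>\<^bsub>S\<^esub> 1"

lemma W_carrier: "carrier W = (\<lambda>t. T.I +>\<^bsub>T.P\<^esub> t) ` carrier T.P"
  unfolding verma_eq_quotient by (rule operator_quotient.quotient_carrier[OF T.operator_quotient_tensor])

lemma pure_tensor_closed [simp]: "s \<in> carrier S \<Longrightarrow> pure_tensor s c \<in> carrier W"
  by (auto simp: pure_tensor_def W_carrier)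

lemma act_pure_tensor: "s \<in> carrier S \<Longrightarrow> W.act a (pure_tensor s c) = pure_tensor (smith_elem g a \<otimes>\<^bsub>S\<^esub> s) c"
  unfolding W.act_def pure_tensor_def unfolding verma_eq_quotient
  by (subst operator_quotient.quotient_smult[OF T.operator_quotient_tensor]) (simp_all add: smith_elem_simps)

lemma act_w: "W.act a w = pure_tensor (smith_elem g a) 1"
  by (simp add: act_pure_tensor smith_elem_simps)

lemma pure_tensor_balanced: "\<lbrakk>s \<in> carrier S; b \<in> B\<rbrakk> \<Longrightarrow> pure_tensor (s \<otimes>\<^bsub>S\<^esub> b) c = pure_tensor s (weight_char b * c)"
  unfolding pure_tensor_def using T.I_rel[OF T.tensor_rel(3)[of s b c]] borel_carrier
  by (subst T.tensor_coset_eq_iff) (auto simp: subset_iff)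

lemma borel_weights:
  "weight_char (smith_elem g (free_const c)) = c" "weight_char (smith_elem g gen_h) = \<mu>"
  "weight_char (smith_elem g gen_y) = 0"
  by (rule weight_char_eqI; use h_v y_v v_carrier borel_gens in \<open>simp add: act_def[symmetric] free_const_simps\<close>)+

lemma act_borel_w:
  assumes "smith_elem g a \<in> B"
  shows "W.act a w = W.act (free_const (weight_char (smith_elem g a))) w"
proof -
  have *: "W.act a w = pure_tensor \<one>\<^bsub>S\<^esub> (weight_char (smith_elem g a))" if "smith_elem g a \<in> B" for a
    using pure_tensor_balanced[OF _ that, of "\<one>\<^bsub>S\<^esub>" 1] unfolding act_w by (simp add: smith_elem_simps(1))
  show ?thesis
    using *[OF assms] *[OF borel_gens(1)] by (simp add: borel_weights)
qed

text \<open>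
  A pure tensor \<open>s \<otimes> c\<close> equals \<open>s c \<otimes> 1\<close>, and sums of tensors \<open>s \<otimes> 1\<close> can be collected in the first factor.
\<close>

lemma W_cyclic: "carrier W = range (\<lambda>a. W.act a w)"
proof (intro equalityI subsetI)
  fix m assume "m \<in> carrier W"
  then obtain t where t: "t \<in> carrier T.P" "m = T.I +>\<^bsub>T.P\<^esub> t" by (auto simp: W_carrier)
  have "\<exists>a. t - frag_of (smith_elem g a, 1) \<in> T.I"
    using t(1)[simplified]
  proof (induction t rule: frag_induction)
    case zero
    \<comment> \<open>The relation for \<open>0 + 0\<close> is \<open>- (0 \<otimes> 1)\<close>.\<close>
    have "frag_of (smith_elem g 0, 1) - frag_of (smith_elem g 0, 1) - frag_of (smith_elem g 0, 1)
        \<in> tensor_relations S B K"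
      using T.tensor_rel(1)[of "smith_elem g 0" "smith_elem g 0" 1] by (simp add: smith_elem_simps)
    then show ?case using T.I_rel by (intro exI[of _ 0]) simp
  next
    case (one x)
    then obtain b c where x: "x = (smith_elem g b, c)" by (auto simp: smith_carrier)
    have "frag_of (smith_elem g (b * free_const c), 1) - frag_of x \<in> T.I"
      using T.I_rel[OF T.tensor_rel(3)[of "smith_elem g b" "smith_elem g (free_const c)" 1]]
      by (simp add: smith_elem_simps borel_gens borel_weights x)
    then show ?case using T.I_uminus by fastforce
  next
    case (diff t t')
    then obtain a a' where a: "t - frag_of (smith_elem g a, 1) \<in> T.I" "t' - frag_of (smith_elem g a', 1) \<in> T.I"
      by blast
    have "frag_of (smith_elem g a, 1) - frag_of (smith_elem g (a - a'), 1) - frag_of (smith_elem g a', 1) \<in> T.I"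
      using T.I_rel[OF T.tensor_rel(1)[of "smith_elem g (a - a')" "smith_elem g a'" 1]]
      by (simp add: smith_elem_simps)
    from T.I_add[OF T.I_minus[OF a] this]
    show ?case by (intro exI[of _ "a - a'"]) (simp add: algebra_simps)
  qed
  then obtain a where "t - frag_of (smith_elem g a, 1) \<in> T.I" ..
  then have "m = W.act a w"
    unfolding act_w t(2) unfolding pure_tensor_def using t(1)
    by (subst T.tensor_coset_eq_iff) (auto simp: smith_elem_simps)
  then show "m \<in> range (\<lambda>a. W.act a w)" by blast
qed (auto simp: smith_elem_simps)

definition w_annihilator :: "(smith_gen, 'k) free_algebra set"
  where "w_annihilator = {a. W.act a w = \<zero>\<^bsub>W\<^esub>}"

lemma w_carrier [simp]: "w \<in> carrier W"
  by simp

lemma w_annihilator: "highest_weight_ideal g \<mu> w_annihilator"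
proof
  have "W.act gen_h w = W.act (free_const \<mu>) w"
    using act_borel_w[OF borel_gens(2)] by (simp only: borel_weights)
  then show "gen_h - free_const \<mu> \<in> w_annihilator"
    by (simp add: w_annihilator_def W.act_minus a_minus_def W.M.r_neg del: pure_tensor_closed)
  have "W.act gen_y w = W.act (free_const 0) w"
    using act_borel_w[OF borel_gens(3)] by (simp only: borel_weights)
  then show "gen_y \<in> w_annihilator"
    by (simp add: w_annihilator_def free_const_simps)
qed (auto simp: w_annihilator_def W.act_plus W.act_times W.act_ideal)

lemma submodule_left_ideal:
  assumes "submodule L S W"
  shows "highest_weight_ideal g \<mu> {a. W.act a w \<in> L}" "w_annihilator \<subseteq> {a. W.act a w \<in> L}"
proof -
  show sub: "w_annihilator \<subseteq> {a. W.act a w \<in> L}"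
    using submoduleD(2)[OF assms] by (auto simp: w_annihilator_def)
  show "highest_weight_ideal g \<mu> {a. W.act a w \<in> L}"
    by (rule highest_weight_ideal.left_ideal_superset[OF w_annihilator sub])
      (simp_all add: submoduleD[OF assms] W.act_plus W.act_times W.submodule_act[OF assms])
qed

lemma submodule_eq_W_iff:
  assumes "submodule L S W"
  shows "w \<in> L \<longleftrightarrow> L = carrier W"
  using W.submodule_act[OF assms] submoduleD(1)[OF assms] W_cyclic w_carrier by auto

text \<open>
  Sending a submodule \<open>L\<close> to the left ideal of those \<open>a\<close> with \<open>a w \<in> L\<close> turns this into the statement about
  highest weight left ideals.
\<close>

lemma sum_of_proper_submodules:
  assumes L: "submodule L S W" "L \<noteq> carrier W" and L': "submodule L' S W" "L' \<noteq> carrier W"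
  shows "submodule {m \<oplus>\<^bsub>W\<^esub> m' | m m'. m \<in> L \<and> m' \<in> L'} S W" (is "submodule ?N S W")
    and "{m \<oplus>\<^bsub>W\<^esub> m' | m m'. m \<in> L \<and> m' \<in> L'} \<noteq> carrier W"
proof -
  note D = submoduleD[OF L(1)] submoduleD[OF L'(1)]
  have sub: "m \<in> carrier W" if "m \<in> L \<or> m \<in> L'" for m using that D(1) D(6) by blast
  show "submodule ?N S W"
  proof (rule W.smith_submoduleI)
    show "?N \<subseteq> carrier W" using sub by auto
    show "\<zero>\<^bsub>W\<^esub> \<in> ?N" using D(2) D(7) by (intro CollectI exI[of _ "\<zero>\<^bsub>W\<^esub>"]) simp
    show "n \<oplus>\<^bsub>W\<^esub> n' \<in> ?N" if "n \<in> ?N" "n' \<in> ?N" for n n'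
    proof -
      obtain m m' k k' where n: "n = m \<oplus>\<^bsub>W\<^esub> m'" "m \<in> L" "m' \<in> L'" "n' = k \<oplus>\<^bsub>W\<^esub> k'" "k \<in> L" "k' \<in> L'"
        using \<open>n \<in> ?N\<close> \<open>n' \<in> ?N\<close> by blast
      then have "n \<oplus>\<^bsub>W\<^esub> n' = (m \<oplus>\<^bsub>W\<^esub> k) \<oplus>\<^bsub>W\<^esub> (m' \<oplus>\<^bsub>W\<^esub> k')"
        using sub by (simp add: W.M.a_ac)
      then show ?thesis using D(3)[OF n(2,5)] D(8)[OF n(3,6)] by blast
    qed
    show "W.act a n \<in> ?N" if "n \<in> ?N" for a n
    proof -
      obtain m m' where n: "n = m \<oplus>\<^bsub>W\<^esub> m'" "m \<in> L" "m' \<in> L'" using \<open>n \<in> ?N\<close> by blast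
      then have "W.act a n = W.act a m \<oplus>\<^bsub>W\<^esub> W.act a m'" using sub by (simp add: W.act_distrib)
      then show ?thesis using W.submodule_act[OF L(1) n(2)] W.submodule_act[OF L'(1) n(3)] by blast
    qed
  qed
  show "?N \<noteq> carrier W"
  proof
    assume "?N = carrier W"
    then have "w \<in> ?N" using w_carrier by simp
    then obtain m m' where m: "w = m \<oplus>\<^bsub>W\<^esub> m'" "m \<in> L" "m' \<in> L'" by blast
    have "m \<in> range (\<lambda>a. W.act a w)" "m' \<in> range (\<lambda>a. W.act a w)"
      unfolding W_cyclic[symmetric] using sub m(2,3) by blast+
    then obtain a a' where a: "m = W.act a w" "m' = W.act a' w" by (elim rangeE)
    have aL: "W.act a w \<in> L" "W.act a' w \<in> L'" using m(2,3) a by simp_all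
    have "W.act a w \<oplus>\<^bsub>W\<^esub> W.act a' w = w" using m(1) by (simp only: a)
    then have "W.act (a + a' - 1) w = \<zero>\<^bsub>W\<^esub>"
      by (simp only: W.act_minus W.act_plus W.act_one w_carrier a_minus_def W.M.r_neg)
    then have "a + a' - 1 \<in> w_annihilator" by (simp add: w_annihilator_def)
    moreover have "1 \<notin> {a. W.act a w \<in> L}" "1 \<notin> {a. W.act a w \<in> L'}"
      using submodule_eq_W_iff[OF L(1)] submodule_eq_W_iff[OF L'(1)] L(2) L'(2)
      by (simp_all only: mem_Collect_eq W.act_one w_carrier not_False_eq_True)
    ultimately show False
      using highest_weight_ideal.sum_of_proper_left_ideals[OF w_annihilator submodule_left_ideal[OF L(1)] _
          submodule_left_ideal[OF L'(1)], of a a'] aL by blast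
  qed
qed

lemma maximal_submodule_unique:
  assumes "maximal_submodule S W L" "maximal_submodule S W L'"
  shows "L = L'"
proof -
  have L: "submodule L S W" "L \<noteq> carrier W" and L': "submodule L' S W" "L' \<noteq> carrier W"
    using assms by (auto simp: maximal_submodule_def)
  let ?N = "{m \<oplus>\<^bsub>W\<^esub> m' | m m'. m \<in> L \<and> m' \<in> L'}"
  note D = submoduleD[OF L(1)] submoduleD[OF L'(1)]
  have "L \<subseteq> ?N"
  proof
    fix m assume "m \<in> L"
    then have "m = m \<oplus>\<^bsub>W\<^esub> \<zero>\<^bsub>W\<^esub>" using D(1) by auto
    then show "m \<in> ?N" using D(7) \<open>m \<in> L\<close> by blast
  qed
  moreover have "L' \<subseteq> ?N"
  proof
    fix m assume "m \<in> L'"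
    then have "m = \<zero>\<^bsub>W\<^esub> \<oplus>\<^bsub>W\<^esub> m" using D(6) by auto
    then show "m \<in> ?N" using D(2) \<open>m \<in> L'\<close> by blast
  qed
  moreover note N = sum_of_proper_submodules[OF L L']
  moreover have max: "N' = J" if "maximal_submodule S W J" "submodule N' S W" "J \<subseteq> N'" "N' \<noteq> carrier W" for J N'
    using that unfolding maximal_submodule_def by blast
  ultimately have "?N = L" "?N = L'"
    using max[OF assms(1) N(1) _ N(2)] max[OF assms(2) N(1) _ N(2)] by (simp_all only:)
  then show ?thesis by (simp only:)
qed

lemma verma_hom:
  obtains H where "H \<in> left_module_hom S W M" "H w = v"
proof -
  let ?f = "\<lambda>(s, c). s \<odot> free_const c \<bullet> v"
  obtain H where "H \<in> left_module_hom S (induced_module S B K) M"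
    and "\<And>s c. \<lbrakk>s \<in> carrier S; c \<in> carrier K\<rbrakk> \<Longrightarrow> H (T.I +>\<^bsub>T.P\<^esub> frag_of (s, c)) = ?f (s, c)"
  proof (rule T.induced_hom[of M ?f])
    show "left_module S M" by (rule left_module_axioms)
  qed (use v_carrier borel_carrier in \<open>auto simp: smult_assoc1 smult_l_distr smult_r_distr free_const_simps act_plus
      weight_char subset_iff\<close>)
  then show thesis
    using v_carrier by (intro that[of H]) (simp_all add: verma_def pure_tensor_def free_const_simps)
qed

text \<open>
  The map from the Verma module to \<open>M\<close> is onto because \<open>M\<close> is simple, and for the same reason its kernel is a
  maximal submodule, hence the only one.
\<close>

lemma K0_verma_simple:
  assumes simple: "simple_module S M"
  shows "K0_class S (verma_simple g \<mu>) = K0_class S M"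
proof -
  obtain H where H: "H \<in> left_module_hom S W M" "H w = v" by (rule verma_hom)
  note hom = left_module_homD[OF H(1)] and W = W.left_module_axioms and M = left_module_axioms
  define N where "N = {m \<in> carrier W. H m = \<zero>}"
  have N: "submodule N S W" unfolding N_def by (rule submodule_kernel[OF W M H(1)])
  have image: "H ` L = {\<zero>} \<or> H ` L = carrier M" if "submodule L S W" for L
    using simple submodule_image[OF W M H(1) that] unfolding simple_module_def by blast
  have W_sub: "submodule (carrier W) S W"
    by (rule W.smith_submoduleI) auto
  have surj: "H ` carrier W = carrier M"
  proof -
    have "v \<in> H ` carrier W" using w_carrier H(2) by (metis imageI)
    then show ?thesis using image[OF W_sub] v_nonzero by auto
  qed
  have "maximal_submodule S W N"
    unfolding maximal_submodule_def
  proof (intro conjI allI impI N)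
    show "N \<noteq> carrier W"
    proof
      assume "N = carrier W"
      then have "w \<in> N" using w_carrier by (simp only:)
      then show False using H(2) v_nonzero by (simp add: N_def)
    qed
    fix L assume "submodule L S W \<and> N \<subseteq> L"
    then have L: "submodule L S W" "N \<subseteq> L" by auto
    show "L = N \<or> L = carrier W"
    proof (cases "H ` L = {\<zero>}")
      case True
      then have "L \<subseteq> N" using submoduleD(1)[OF L(1)] by (auto simp: N_def)
      then show ?thesis using L by auto
    next
      case False
      then have HL: "H ` L = carrier M" using image[OF L(1)] by blast
      have "m \<in> L" if m: "m \<in> carrier W" for m
      proof -
        have "H m \<in> H ` L" unfolding HL by (rule hom(1)[OF m])
        then obtain l where l: "H m = H l" "l \<in> L" by (rule imageE)
        have lc: "l \<in> carrier W" using l submoduleD(1)[OF L(1)] by blast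
        have "H (m \<ominus>\<^bsub>W\<^esub> l) \<oplus> H l = H m"
          using m lc by (simp add: hom(2)[symmetric] a_minus_def W.M.a_assoc W.M.l_neg)
        then have "H (m \<ominus>\<^bsub>W\<^esub> l) = \<zero>"
          using l(1) hom(1)[OF W.M.minus_closed[OF m lc]] hom(1)[OF lc] M.add.r_cancel_one'[of "H l" "H (m \<ominus>\<^bsub>W\<^esub> l)"]
          by simp
        then have "m \<ominus>\<^bsub>W\<^esub> l \<in> L" using L(2) m lc by (auto simp: N_def)
        then have "(m \<ominus>\<^bsub>W\<^esub> l) \<oplus>\<^bsub>W\<^esub> l \<in> L" using submoduleD(3)[OF L(1)] l(2) by blast
        then show ?thesis using m lc by (simp add: a_minus_def W.M.a_assoc W.M.l_neg)
      qed
      then show ?thesis using submoduleD(1)[OF L(1)] by auto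
    qed
  qed
  note max = this
  have the_N: "(THE L. maximal_submodule S W L) = N"
    by (rule the_equality, rule max, rule maximal_submodule_unique[OF _ max])
  interpret Q: operator_quotient N W S by (rule W.operator_quotientI[OF N])
  have QM: "left_module S (quotient_module W N)"
    by (rule Q.quotient_left_module) (simp_all add: W.smult_l_distr W.smult_assoc1)
  have "\<exists>F\<in>left_module_hom S (quotient_module W N) M.
      bij_betw F (carrier (quotient_module W N)) (carrier M)"
  proof (rule Q.quotient_iso[where f = H, OF M hom(1,2,3) _ surj])
    show "H m = \<zero> \<longleftrightarrow> m \<in> N" if "m \<in> carrier W" for m
      using that by (simp only: N_def mem_Collect_eq simp_thms)
  qed
  then obtain F where "F \<in> left_module_hom S (quotient_module W N) M"
    "bij_betw F (carrier (quotient_module W N)) (carrier M)" by blast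
  then have "K0_class S M = K0_class S (quotient_module W N)"
    by (rule K0_class_iso[OF QM])
  then show ?thesis by (simp add: verma_simple_def the_N)
qed

end

section \<open>Lowering one element of the multiset\<close>

lemma root_le_iff: "a \<preceq> b \<longleftrightarrow> (\<exists>n. b = a + of_nat n)"
  by (auto simp: root_le_def algebra_simps)

lemma root_less_iff: "(a :: 'k::field_char_0) \<prec> b \<longleftrightarrow> (\<exists>n. n \<noteq> 0 \<and> b = a + of_nat n)"
  unfolding root_less_def root_le_iff by (metis add_cancel_left_right of_nat_eq_0_iff)

lemma root_less_trans: "\<lbrakk>(a :: 'k::field_char_0) \<prec> b; b \<prec> c\<rbrakk> \<Longrightarrow> a \<prec> c"
  unfolding root_less_iff by (metis add.assoc add_is_0 of_nat_add)

text \<open>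
  Two neighbouring roots, the lower one outside \<open>X\<close> and the upper one in \<open>X\<close>.  Exchanging the upper one in \<open>X\<close>
  for the lower one will split off the simple module whose highest weight is the upper one.
\<close>

locale lowering = smith_data g u C
  for g u :: "'k::{alg_closed_field, field_char_0} poly" and C +
  fixes Xs :: "'k multiset" and a :: 'k and n :: nat
  assumes Xs: "Xs \<subseteq># roots" and n: "n \<noteq> 0"
    and a: "a \<in># roots - Xs" and b: "a + of_nat n \<in># Xs"
    and adjacent: "\<And>i. \<lbrakk>i \<noteq> 0; i < n\<rbrakk> \<Longrightarrow> a + of_nat i \<notin># roots"
begin

abbreviation top :: 'k where "top \<equiv> a + of_nat n"
abbreviation f :: "'k poly" where "f \<equiv> string_poly a n"

definition Ys :: "'k multiset" where "Ys = add_mset a (Xs - {#top#})"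

lemma Xs_eq: "Xs = add_mset top (Xs - {#top#})"
  using b by simp

lemma top_in_roots: "top \<in># roots"
  using b Xs by (meson mset_subset_eqD)

lemma complement_Xs: "roots - Xs = add_mset a (roots - Xs - {#a#})"
  by (rule insert_DiffM[OF a, symmetric])

lemma roots_split: "roots = add_mset a (add_mset top ((roots - Xs - {#a#}) + (Xs - {#top#})))"
proof -
  have "roots = (roots - Xs) + Xs" using Xs by simp
  also have "\<dots> = add_mset a (roots - Xs - {#a#}) + add_mset top (Xs - {#top#})"
    using complement_Xs Xs_eq by presburger
  finally show ?thesis
    by (simp only: union_mset_add_mset_left union_mset_add_mset_right add_mset_commute)
qed

lemma Ys: "Ys \<subseteq># roots" and complement_Ys: "roots - Ys = add_mset top (roots - Xs - {#a#})"
proof -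
  have eq: "roots = Ys + add_mset top (roots - Xs - {#a#})"
    by (subst roots_split) (simp add: Ys_def)
  show "Ys \<subseteq># roots" by (subst eq) simp
  show "roots - Ys = add_mset top (roots - Xs - {#a#})" by (subst eq) simp
qed

lemma f_root_poly: "f * root_poly Ys = shift 1 f * root_poly Xs"
proof -
  have "shift 1 f * root_poly Xs = (shift 1 f * [:- top, 1:]) * root_poly (Xs - {#top#})"
    by (subst Xs_eq) (simp only: root_poly_add_mset mult_ac)
  also have "\<dots> = f * root_poly Ys"
    by (simp only: shift_up_string_poly Ys_def root_poly_add_mset mult.assoc)
  finally show ?thesis ..
qed

lemma f_lower_factor:
  "f * shift (- 1) (lower_factor Ys) = shift (- 1) f * shift (- 1) (lower_factor Xs)"
proof -
  let ?c = "lead_coeff (u + [:C:])" and ?r = "shift (- 1) (root_poly (roots - Xs - {#a#}))"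
  have "shift (- 1) (lower_factor Xs) = Polynomial.smult ?c ([:- (a + 1), 1:] * ?r)"
    unfolding lower_factor_def
    by (subst complement_Xs) (simp only: root_poly_add_mset pcompose_smult pcompose_mult shift_linear minus_add_distrib)
  moreover have "shift (- 1) (lower_factor Ys) = Polynomial.smult ?c ([:- (top + 1), 1:] * ?r)"
    unfolding lower_factor_def complement_Ys
    by (simp only: root_poly_add_mset pcompose_smult pcompose_mult shift_linear minus_add_distrib)
  moreover have "shift (- 1) f * ([:- (a + 1), 1:] * ?r) = f * ([:- (top + 1), 1:] * ?r)"
    by (simp only: mult.assoc[symmetric] shift_down_string_poly)
  ultimately show ?thesis by (simp only: mult_smult_right)
qed

lemma f_hom: "(*) f \<in> left_module_hom (smith_algebra g) (A_module u C Ys) (A_module u C Xs)"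
  by (rule A_hom_of_generators[OF Xs Ys f_root_poly f_lower_factor])

abbreviation "S \<equiv> smith_algebra g"
abbreviation "A \<equiv> A_module u C Xs"
abbreviation "N \<equiv> {m. f dvd m}"
abbreviation "Q \<equiv> quotient_module A N"

lemmas AX_simps [simp] = A_simps[OF Xs]

lemma f_range: "range ((*) f) = N"
  by (auto simp: dvd_def)

sublocale A: smith_module g A
  by (rule A_smith_module[OF Xs])

lemma N_submodule: "submodule N S A"
proof -
  have "submodule UNIV S (A_module u C Ys)"
    using smith_module.smith_submoduleI[OF A_smith_module[OF Ys], of UNIV] by (simp add: A_simps[OF Ys])
  then show ?thesis
    using submodule_image[OF A_left_module[OF Ys] A_left_module[OF Xs] f_hom, of UNIV] f_range by simp
qed

sublocale quot: operator_quotient N A S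
  by (rule A.operator_quotientI[OF N_submodule])

definition proj :: "'k poly \<Rightarrow> 'k poly set"
  where "proj m = N +>\<^bsub>A\<^esub> m"

lemma Q_left_module: "left_module S Q"
  by (rule quot.quotient_left_module) (simp_all only: A.smult_l_distr A.smult_assoc1 A.smult_one)

sublocale Q: smith_module g Q
  using Q_left_module by (simp add: smith_module_def)

lemma proj_hom: "proj \<in> left_module_hom S A Q"
  by (rule left_module_homI)
    (auto simp: proj_def quot.quotient_carrier quot.quotient_add quot.quotient_smult)

lemma Q_carrier: "carrier Q = range proj"
  by (simp add: quot.quotient_carrier proj_def)

lemma proj_eq_zero_iff: "proj m = \<zero>\<^bsub>Q\<^esub> \<longleftrightarrow> f dvd m"
proof -
  have "m \<in> N" if "proj m = N"
    using quot.a_rcos_self[of m] that by (simp only: proj_def AX_simps UNIV_I simp_thms)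
  moreover have "proj m = N" if "m \<in> N"
    unfolding proj_def by (rule quot.a_rcos_const[OF that])
  ultimately show ?thesis by (auto simp only: quot.quotient_zero mem_Collect_eq)
qed

text \<open>
  The roots of \<open>f\<close> are \<open>a + 1, \<dots>, top\<close>.  Only the last of them is a root of \<open>u + C\<close>, and only the first has
  a root of \<open>u + C\<close> one step below it.  So the roots of a divisor of \<open>f\<close> that generates a submodule can stop
  nowhere in between: it has all of these roots or none.
\<close>

lemma Q_simple: "simple_module S Q"
  unfolding simple_module_def
proof (intro conjI allI impI Q_left_module)
  have "\<not> f dvd 1" using n by (auto simp: is_unit_iff_degree degree_string_poly)
  then have "proj 1 \<in> carrier Q" "proj 1 \<noteq> \<zero>\<^bsub>Q\<^esub>" by (auto simp: Q_carrier proj_eq_zero_iff)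
  then show "carrier Q \<noteq> {\<zero>\<^bsub>Q\<^esub>}" by (metis singletonD)
  fix L assume L: "submodule L S Q"
  let ?L = "{m \<in> carrier A. proj m \<in> L}"
  have "submodule ?L S A"
    by (rule submodule_preimage[OF A_left_module[OF Xs] proj_hom Q_left_module L])
  then obtain d where d: "?L = {m. d dvd m}" "d dvd shift 1 d * root_poly Xs"
    "d dvd shift (- 1) d * shift (- 1) (lower_factor Xs)"
    by (rule A_submodule_principal[OF Xs])
  have "f \<in> ?L" using proj_eq_zero_iff[of f] submoduleD(2)[OF L] by simp
  then have df: "d dvd f" using d(1) by auto
  then have d0: "d \<noteq> 0" by auto
  have L_eq: "L = proj ` {m. d dvd m}"
    using submoduleD(1)[OF L] unfolding d(1)[symmetric] Q_carrier by auto
  have root_d: "\<exists>i. i \<noteq> 0 \<and> i \<le> n \<and> z = a + of_nat i" if z: "poly d z = 0" for z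
  proof -
    have "poly f z = 0" using df z by (metis dvdE mult_zero_left poly_mult)
    then obtain i where "i < n" "z = a + of_nat (Suc i)" unfolding poly_string_poly_eq_0_iff by blast
    then show ?thesis by (intro exI[of _ "Suc i"]) simp
  qed
  show "L = {\<zero>\<^bsub>Q\<^esub>} \<or> L = carrier Q"
  proof (cases "\<exists>z. poly d z = 0")
    case True
    have up: "poly d (a + of_nat (Suc i)) = 0" if i: "i < n" "poly d (a + of_nat i) = 0" "i \<noteq> 0" for i
    proof (rule ccontr)
      assume "poly d (a + of_nat (Suc i)) \<noteq> 0"
      then have "a + of_nat i \<in># Xs"
        using A_submodule_roots(1)[OF Xs d(2,3) i(2)] by (simp add: add_ac)
      then show False using adjacent i Xs by (meson mset_subset_eqD)
    qed
    have down: "poly d (a + of_nat i) = 0" if i: "i \<noteq> 0" "i < n" "poly d (a + of_nat (Suc i)) = 0" for i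
    proof (rule ccontr)
      assume "poly d (a + of_nat i) \<noteq> 0"
      then have "a + of_nat i \<in># roots - Xs"
        using A_submodule_roots(2)[OF Xs d(2,3) i(3)] by (simp add: algebra_simps)
      then show False using adjacent i by (meson in_diffD)
    qed
    obtain j where j: "j \<noteq> 0" "j \<le> n" "poly d (a + of_nat j) = 0" using True root_d by metis
    have "poly d (a + of_nat i) = 0" if "j \<le> i" "i \<le> n" for i
      using that
    proof (induction i rule: dec_induct)
      case (step i)
      then show ?case using up[of i] j by simp
    qed (use j in simp)
    moreover have "poly d (a + of_nat i) = 0" if "i \<le> j" "i \<noteq> 0" for i
      using that
    proof (induction i rule: inc_induct)
      case (step i)
      then show ?case using down[of i] j by simp
    qed (use j in simp)
    ultimately have "poly d (a + of_nat (Suc i)) = 0" if "i < n" for i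
      using that by (metis Suc_leI linorder_linear nat.distinct(1))
    then have "f dvd d" by (rule string_poly_dvdI)
    then have "proj m \<in> {\<zero>\<^bsub>Q\<^esub>}" if "d dvd m" for m
      using proj_eq_zero_iff[of m] dvd_trans[OF _ that] by blast
    then have "L \<subseteq> {\<zero>\<^bsub>Q\<^esub>}" unfolding L_eq by blast
    then show ?thesis using submoduleD(2)[OF L] by blast
  next
    case False
    then have "Polynomial.degree d = 0"
      using alg_closed_imp_poly_has_root[of d] by blast
    then have "is_unit d" using is_unit_iff_degree[OF d0] by blast
    then have "{m. d dvd m} = UNIV" using unit_imp_dvd by blast
    then have "L = carrier Q" unfolding L_eq Q_carrier by (rule arg_cong)
    then show ?thesis ..
  qed
qed

text \<open>
  The string without its top factor has the right weight because multiplying it by \<open>h - top\<close> completes the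
  string.  Applying \<open>y\<close> shifts it up, which leaves out \<open>a + 1\<close> instead of \<open>top\<close>; as \<open>a\<close> is outside \<open>X\<close>, the factor
  missing at \<open>a + 1\<close> is supplied by \<open>p\<close>.
\<close>

lemma Q_highest_weight: "highest_weight_vector g Q top (proj (string_poly a (n - 1)))"
proof
  let ?e = "string_poly a (n - 1)"
  obtain k where k: "n = Suc k" using n not0_implies_Suc by blast
  have f_eq: "f = ?e * [:- top, 1:]" by (simp add: k string_poly_Suc del: of_nat_Suc)
  have proj_act: "Q.act c (proj m) = proj (A.act c m)" for c m
    using smith_module_hom_act[OF A.smith_module_axioms Q.smith_module_axioms proj_hom, of m c] by simp
  show "proj ?e \<in> carrier Q" by (simp add: Q_carrier)
  have "\<not> f dvd ?e"
  proof
    assume "f dvd ?e"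
    then have "Polynomial.degree f \<le> Polynomial.degree ?e" by (rule dvd_imp_degree_le) simp
    then show False by (simp add: degree_string_poly k)
  qed
  then show "proj ?e \<noteq> \<zero>\<^bsub>Q\<^esub>" by (simp add: proj_eq_zero_iff)
  have "free_eval gen_h [:- t, 1:] = gen_h - free_const t" for t :: 'k
    by (simp add: free_eval_pCons free_const_simps)
  then have "A.act (gen_h - free_const top) ?e = A.act (free_eval gen_h [:- top, 1:]) ?e"
    by (simp only:)
  also have "\<dots> = f"
    unfolding A_act_simps(5)[OF Xs] f_eq by (rule mult.commute)
  finally have "Q.act (gen_h - free_const top) (proj ?e) = proj f"
    by (simp only: proj_act)
  also have "\<dots> = \<zero>\<^bsub>Q\<^esub>"
    by (rule proj_eq_zero_iff[THEN iffD2, OF dvd_refl])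
  finally have "Q.act (gen_h - free_const top) (proj ?e) = \<zero>\<^bsub>Q\<^esub>" .
  then show "Q.act gen_h (proj ?e) = Q.act (free_const top) (proj ?e)"
    using \<open>proj ?e \<in> carrier Q\<close>
      Q.M.minus_equality[of "Q.act gen_h (proj ?e)" "\<ominus>\<^bsub>Q\<^esub> Q.act (free_const top) (proj ?e)"]
    by (simp only: Q.act_minus a_minus_def Q.act_closed Q.M.a_inv_closed Q.M.minus_minus)
  have "a + of_nat (n - 1) + 1 = top" by (simp add: k)
  then have e: "shift (- 1) ?e * [:- (a + 1), 1:] = f"
    using shift_down_string_poly[of a "n - 1"] f_eq by (simp only:)
  have "[:- a, 1:] dvd lower_factor Xs"
    using a by (simp add: poly_eq_0_iff_dvd[symmetric] poly_lower_factor_eq_0_iff)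
  then obtain r where "lower_factor Xs = [:- a, 1:] * r" by (rule dvdE)
  then have "shift (- 1) ?e * shift (- 1) (lower_factor Xs) = f * shift (- 1) r"
    using shift_linear[of "- a" "- 1"] by (simp only: pcompose_mult e[symmetric] mult_ac minus_add_distrib)
  then show "Q.act gen_y (proj ?e) = \<zero>\<^bsub>Q\<^esub>"
    by (simp add: proj_act A_act_simps[OF Xs] proj_eq_zero_iff)
qed

lemma K0_verma_top: "K0_class S (verma_simple g top) = K0_class S Q"
  by (rule highest_weight_vector.K0_verma_simple[OF Q_highest_weight Q_simple])

lemma Q_finitely_generated: "finitely_generated S Q"
proof (rule finitely_generated_cyclic[OF Q_left_module, of "proj 1"])
  show "proj 1 \<in> carrier Q" by (simp add: Q_carrier)
  have "\<exists>s\<in>carrier S. proj m = s \<odot>\<^bsub>Q\<^esub> proj 1" for m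
  proof -
    have "A.act (free_eval gen_h m) 1 = m" by (simp add: A_act_simps[OF Xs])
    then have "proj m = Q.act (free_eval gen_h m) (proj 1)"
      using smith_module_hom_act[OF A.smith_module_axioms Q.smith_module_axioms proj_hom, of 1 "free_eval gen_h m"]
      by simp
    then show ?thesis by (auto simp: Q.act_def smith_elem_simps(1))
  qed
  then have "carrier Q \<subseteq> (\<lambda>s. s \<odot>\<^bsub>Q\<^esub> proj 1) ` carrier S"
    unfolding Q_carrier by blast
  moreover have "(\<lambda>s. s \<odot>\<^bsub>Q\<^esub> proj 1) ` carrier S \<subseteq> carrier Q"
    using \<open>proj 1 \<in> carrier Q\<close> Q.smult_closed by blast
  ultimately show "carrier Q = (\<lambda>s. s \<odot>\<^bsub>Q\<^esub> proj 1) ` carrier S" by blast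
qed

lemma K0_verma_top_closed: "K0_class S (verma_simple g top) \<in> carrier (K0 S)"
  unfolding K0_verma_top by (rule K0_class_closed[OF Q_left_module Q_finitely_generated])

lemma K0_lowering:
  "K0_class S A = K0_class S (A_module u C Ys) \<otimes>\<^bsub>K0 S\<^esub> K0_class S (verma_simple g top)"
  unfolding K0_verma_top
proof (rule K0_short_exact[OF A_left_module[OF Ys] A_left_module[OF Xs] Q_left_module
      A_finitely_generated[OF Ys] A_finitely_generated[OF Xs] Q_finitely_generated])
  have "inj ((*) f)" by (auto simp: inj_on_def)
  moreover have "a_kernel A Q proj = N" by (simp add: a_kernel_def' proj_eq_zero_iff)
  ultimately show "short_exact S (A_module u C Ys) ((*) f) A proj Q"
    using f_hom proj_hom f_range by (simp add: short_exact_def A_simps[OF Ys] Q_carrier)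
qed

lemma less_iff_top_less:
  assumes "z \<in># roots" "z \<noteq> top"
  shows "a \<prec> z \<longleftrightarrow> top \<prec> z"
proof
  assume "a \<prec> z"
  then obtain m where m: "m \<noteq> 0" "z = a + of_nat m" by (auto simp: root_less_iff)
  then have "n < m" using adjacent[of m] assms by (metis linorder_neqE_nat)
  then have "z = top + of_nat (m - n)" by (simp add: m(2) of_nat_diff)
  then show "top \<prec> z" using \<open>n < m\<close> unfolding root_less_iff by (intro exI[of _ "m - n"]) simp
next
  have "a \<prec> top" using n by (auto simp: root_less_iff)
  then show "top \<prec> z \<Longrightarrow> a \<prec> z" by (rule root_less_trans)
qed

lemma le_top_iff_le:
  assumes "z \<in># roots" "z \<noteq> top"
  shows "z \<preceq> top \<longleftrightarrow> z \<preceq> a"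
proof
  assume "z \<preceq> top"
  then obtain m where m: "top = z + of_nat m" by (auto simp: root_le_iff)
  have "m \<noteq> 0" using m assms(2) by (intro notI) simp
  have "n \<le> m"
  proof (rule ccontr)
    assume "\<not> n \<le> m"
    then have "z = a + of_nat (n - m)" using m by (simp add: of_nat_diff algebra_simps)
    then show False using adjacent[of "n - m"] \<open>\<not> n \<le> m\<close> \<open>m \<noteq> 0\<close> assms(1) by simp
  qed
  then have "a = z + of_nat (m - n)" using m by (simp add: of_nat_diff algebra_simps)
  then show "z \<preceq> a" unfolding root_le_iff ..
next
  assume "z \<preceq> a"
  then obtain m where "a = z + of_nat m" by (auto simp: root_le_iff)
  then have "top = z + of_nat (m + n)" by simp
  then show "z \<preceq> top" unfolding root_le_iff ..
qed

text \<open>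
  Passing from \<open>X\<close> to \<open>Ys\<close> raises one element of the complement from \<open>a\<close> to \<open>top\<close> and lowers one element of \<open>X\<close>
  from \<open>top\<close> to \<open>a\<close>.  A root that is not \<open>top\<close> compares in the same way with \<open>a\<close> and \<open>top\<close>, so both counts at it are
  unchanged; at \<open>top\<close> both decrease by one.
\<close>

lemma varphi_lowering:
  assumes "z \<in># roots"
  shows "varphi u C Xs z = varphi u C Ys z + (if z = top then 1 else 0)"
proof -
  let ?K = "size {#x \<in># roots - Xs - {#a#}. x \<prec> z#}" and ?X = "size {#x \<in># Xs - {#top#}. z \<preceq> x#}"
  have Xs_phi: "varphi u C Xs z = min (?K + (if a \<prec> z then 1 else 0)) (?X + (if z \<preceq> top then 1 else 0))"
  proof -
    have "size {#x \<in># roots - Xs. x \<prec> z#} = ?K + (if a \<prec> z then 1 else 0)"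
      by (subst complement_Xs) simp
    moreover have "size {#x \<in># Xs. z \<preceq> x#} = ?X + (if z \<preceq> top then 1 else 0)"
      by (subst Xs_eq) simp
    ultimately show ?thesis by (simp only: varphi_def)
  qed
  have Ys_phi: "varphi u C Ys z = min (?K + (if top \<prec> z then 1 else 0)) (?X + (if z \<preceq> a then 1 else 0))"
    unfolding varphi_def complement_Ys by (simp add: Ys_def)
  show ?thesis
  proof (cases "z = top")
    case True
    have "a \<prec> top" using n by (auto simp: root_less_iff)
    moreover have "\<not> top \<prec> top" by (simp add: root_less_def)
    moreover have "top \<preceq> top" unfolding root_le_iff by (rule exI[of _ 0]) simp
    moreover have "\<not> top \<preceq> a"
    proof
      assume "top \<preceq> a"
      then obtain m where "a = a + (of_nat n + of_nat m)" by (auto simp: root_le_iff add.assoc)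
      then have "of_nat (n + m) = (0 :: 'k)" by (metis add_cancel_right_right of_nat_add)
      then show False using n by (simp only: of_nat_eq_0_iff)
    qed
    ultimately show ?thesis using True unfolding Xs_phi Ys_phi by simp
  next
    case False
    then show ?thesis
      unfolding Xs_phi Ys_phi less_iff_top_less[OF assms False] le_top_iff_le[OF assms False] by simp
  qed
qed

end

section \<open>Filtration of the polynomial modules\<close>

context smith_data
begin

text \<open>
  If \<open>c\<close> is a root strictly between \<open>a\<close> and \<open>b\<close>, it belongs to \<open>X\<close> or to the complement, and one of
  the pairs \<open>(a, c)\<close> and \<open>(c, b)\<close> is again of the same kind.
\<close>

lemma ex_adjacent_pair:
  assumes "Xs \<subseteq># roots" "a \<in># roots - Xs" "a + of_nat n \<in># Xs" "n \<noteq> 0"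
  shows "\<exists>a' n'. lowering g u C Xs a' n'"
  using assms(2-)
proof (induction n arbitrary: a rule: less_induct)
  case (less n)
  show ?case
  proof (cases "\<exists>i. i \<noteq> 0 \<and> i < n \<and> a + of_nat i \<in># roots")
    case True
    then obtain i where i: "i \<noteq> 0" "i < n" "a + of_nat i \<in># roots" by blast
    show ?thesis
    proof (cases "a + of_nat i \<in># Xs")
      case True
      then show ?thesis using less.IH[OF i(2) less.prems(1)] i by simp
    next
      case False
      then have "a + of_nat i \<in># roots - Xs" using i(3) by (simp add: in_diff_count not_in_iff)
      moreover have "a + of_nat i + of_nat (n - i) \<in># Xs"
        using less.prems(2) i by (simp add: of_nat_diff)
      ultimately show ?thesis using less.IH[of "n - i"] i by simp
    qed
  next
    case False
    then have "lowering g u C Xs a n"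
      by unfold_locales (use assms(1) less.prems in auto)
    then show ?thesis by blast
  qed
qed

lemma no_pair_varphi_zero:
  assumes "\<And>a b. \<lbrakk>a \<in># roots - Xs; b \<in># Xs\<rbrakk> \<Longrightarrow> \<not> a \<prec> b"
  shows "varphi u C Xs z = 0"
proof (rule ccontr)
  assume "varphi u C Xs z \<noteq> 0"
  then have "{#x \<in># roots - Xs. x \<prec> z#} \<noteq> {#}" "{#x \<in># Xs. z \<preceq> x#} \<noteq> {#}"
    unfolding varphi_def by (metis size_empty min_0L, metis size_empty min_0R)
  then obtain a b where a: "a \<in># {#x \<in># roots - Xs. x \<prec> z#}" and b: "b \<in># {#x \<in># Xs. z \<preceq> x#}"
    using multiset_nonemptyE by metis
  have ab: "a \<in># roots - Xs" "a \<prec> z" "b \<in># Xs" "z \<preceq> b"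
    using a b by (simp_all only: set_mset_filter mem_Collect_eq)
  then have "a \<prec> b" using root_less_trans[of a z b] by (cases "z = b") (auto simp: root_less_def)
  then show False using assms ab by blast
qed

definition finite_dimensional_part :: "'k multiset \<Rightarrow> 'k smith K0_free set"
  where "finite_dimensional_part Xs = (\<Otimes>\<^bsub>K0 (smith_algebra g)\<^esub>\<beta> \<in> set_mset roots.
    K0_class (smith_algebra g) (verma_simple g \<beta>) [^]\<^bsub>K0 (smith_algebra g)\<^esub> varphi u C Xs \<beta>)"

text \<open>
  By induction on the sum of all \<open>\<phi>(\<beta>)\<close>, which decreases by one when a pair is exchanged.  The embedding \<open>f\<close>, a
  product of string polynomials, is kept to locate the socle.  The conclusion on carriers is part of the induction
  because a factor can be moved out of a finite product only when all factors are group elements, and \<open>[L(\<beta>)]\<close>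
  is seen to be one only at the step that splits off \<open>L(\<beta>)\<close>.
\<close>

lemma A_filtration:
  assumes "Xs \<subseteq># roots"
  shows "\<exists>Ys f. Ys \<subseteq># roots \<and> f \<noteq> 0
    \<and> (*) f \<in> left_module_hom (smith_algebra g) (A_module u C Ys) (A_module u C Xs)
    \<and> simple_module (smith_algebra g) (A_module u C Ys)
    \<and> (\<forall>\<beta>\<in>#roots. K0_class (smith_algebra g) (verma_simple g \<beta>) [^]\<^bsub>K0 (smith_algebra g)\<^esub> varphi u C Xs \<beta>
        \<in> carrier (K0 (smith_algebra g)))
    \<and> K0_class (smith_algebra g) (A_module u C Xs) =
        K0_class (smith_algebra g) (A_module u C Ys) \<otimes>\<^bsub>K0 (smith_algebra g)\<^esub> finite_dimensional_part Xs"
  using assms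
proof (induction "\<Sum>\<beta>\<in>set_mset roots. varphi u C Xs \<beta>" arbitrary: Xs rule: less_induct)
  case less
  let ?S = "smith_algebra g" and ?K = "\<lambda>\<beta>. K0_class (smith_algebra g) (verma_simple g \<beta>)"
  interpret G: comm_group "K0 ?S" by (rule K0_comm_group)
  show ?case
  proof (cases "\<exists>a b. a \<in># roots - Xs \<and> b \<in># Xs \<and> a \<prec> b")
    case False
    then have no_pair: "\<And>a b. \<lbrakk>a \<in># roots - Xs; b \<in># Xs\<rbrakk> \<Longrightarrow> \<not> a \<prec> b" by blast
    have z: "varphi u C Xs \<beta> = 0" for \<beta> by (rule no_pair_varphi_zero[OF no_pair])
    have "K0_class ?S (A_module u C Xs) \<in> carrier (K0 ?S)"
      by (rule K0_class_closed[OF A_left_module A_finitely_generated]) (rule less.prems)+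
    moreover have "(*) 1 \<in> left_module_hom ?S (A_module u C Xs) (A_module u C Xs)"
      by (rule left_module_homI) auto
    ultimately show ?thesis
      using less.prems A_simple[OF less.prems no_pair]
      by (intro exI[of _ Xs] exI[of _ 1]) (simp add: finite_dimensional_part_def z)
  next
    case True
    then obtain b c :: 'k where "b \<in># roots - Xs" "c \<in># Xs" "b \<prec> c" by blast
    moreover from this obtain m where "m \<noteq> 0" "c = b + of_nat m" by (auto simp: root_less_iff)
    ultimately obtain a n where "lowering g u C Xs a n"
      using ex_adjacent_pair[OF less.prems] by blast
    then interpret l: lowering g u C Xs a n .
    have top: "l.top \<in> set_mset roots" using l.top_in_roots by simp
    have phi: "varphi u C Xs \<beta> = varphi u C l.Ys \<beta> + (if \<beta> = l.top then 1 else 0)" if "\<beta> \<in># roots" for \<beta>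
      by (rule l.varphi_lowering[OF that])
    have "(\<Sum>\<beta>\<in>set_mset roots. varphi u C l.Ys \<beta>) < (\<Sum>\<beta>\<in>set_mset roots. varphi u C Xs \<beta>)"
      using top by (intro sum_strict_mono_ex1) (auto simp: phi)
    from less.hyps[OF this l.Ys] obtain Ys f where Ys: "Ys \<subseteq># roots" and f: "f \<noteq> 0"
      "(*) f \<in> left_module_hom ?S (A_module u C Ys) (A_module u C l.Ys)"
      and simple: "simple_module ?S (A_module u C Ys)"
      and closed: "\<And>\<beta>. \<beta> \<in># roots \<Longrightarrow> ?K \<beta> [^]\<^bsub>K0 ?S\<^esub> varphi u C l.Ys \<beta> \<in> carrier (K0 ?S)"
      and K0: "K0_class ?S (A_module u C l.Ys) = K0_class ?S (A_module u C Ys) \<otimes>\<^bsub>K0 ?S\<^esub> finite_dimensional_part l.Ys"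
      by blast
    have Kt: "?K l.top \<in> carrier (K0 ?S)" by (rule l.K0_verma_top_closed)
    have "(*) (l.f * f) = (*) l.f \<circ> (*) f" by (auto simp: mult.assoc)
    then have hom: "(*) (l.f * f) \<in> left_module_hom ?S (A_module u C Ys) (A_module u C Xs)"
      using left_module_hom_comp[OF f(2) l.f_hom] by simp
    have closed': "?K \<beta> [^]\<^bsub>K0 ?S\<^esub> varphi u C Xs \<beta> \<in> carrier (K0 ?S)" if "\<beta> \<in># roots" for \<beta>
      using closed[OF that] Kt by (cases "\<beta> = l.top") (simp_all add: phi[OF that])
    let ?P = "\<lambda>Z. finprod (K0 ?S) (\<lambda>\<beta>. ?K \<beta> [^]\<^bsub>K0 ?S\<^esub> varphi u C Z \<beta>)"
    let ?T = "set_mset roots - {l.top}"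
    have T: "set_mset roots = insert l.top ?T" using top by auto
    have rest: "?P Xs ?T = ?P l.Ys ?T"
      using closed by (intro G.finprod_cong') (auto simp: phi)
    have PT: "?P l.Ys ?T \<in> carrier (K0 ?S)"
      using closed by (intro G.finprod_closed) auto
    have P: "finite_dimensional_part Z = ?K l.top [^]\<^bsub>K0 ?S\<^esub> varphi u C Z l.top \<otimes>\<^bsub>K0 ?S\<^esub> ?P Z ?T"
      if "\<And>\<beta>. \<beta> \<in># roots \<Longrightarrow> ?K \<beta> [^]\<^bsub>K0 ?S\<^esub> varphi u C Z \<beta> \<in> carrier (K0 ?S)" for Z
      unfolding finite_dimensional_part_def by (subst T, subst G.finprod_insert) (use that top in auto)
    have PX: "finite_dimensional_part Xs = ?K l.top [^]\<^bsub>K0 ?S\<^esub> varphi u C Xs l.top \<otimes>\<^bsub>K0 ?S\<^esub> ?P l.Ys ?T"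
      using P[of Xs] closed' by (simp only: rest)
    have PY: "finite_dimensional_part l.Ys = ?K l.top [^]\<^bsub>K0 ?S\<^esub> varphi u C l.Ys l.top \<otimes>\<^bsub>K0 ?S\<^esub> ?P l.Ys ?T"
      using P[of l.Ys] closed by blast
    have "finite_dimensional_part Xs = finite_dimensional_part l.Ys \<otimes>\<^bsub>K0 ?S\<^esub> ?K l.top"
      unfolding PX PY using Kt PT top by (simp add: phi G.m_ac)
    moreover have "finite_dimensional_part l.Ys \<in> carrier (K0 ?S)"
      unfolding PY using Kt PT by simp
    moreover have "K0_class ?S (A_module u C Ys) \<in> carrier (K0 ?S)"
      by (rule K0_class_closed[OF A_left_module A_finitely_generated]) (rule Ys)+
    ultimately have "K0_class ?S (A_module u C Xs) = K0_class ?S (A_module u C Ys) \<otimes>\<^bsub>K0 ?S\<^esub> finite_dimensional_part Xs"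
      unfolding l.K0_lowering K0 using Kt by (simp add: G.m_assoc)
    then show ?thesis
      using Ys f(1) hom simple closed' by (intro exI[of _ Ys] exI[of _ "l.f * f"]) simp
  qed
qed

section \<open>The socle\<close>

text \<open>
  An isomorphism commutes with \<open>h\<close>, so it is multiplication by the image of \<open>1\<close>, which must be a constant; comparing
  the actions of \<open>x\<close> on \<open>1\<close> recovers the multiset.
\<close>

lemma A_iso_imp_eq:
  assumes Y: "Ys \<subseteq># roots" and Z: "Zs \<subseteq># roots"
    and F: "F \<in> left_module_hom (smith_algebra g) (A_module u C Ys) (A_module u C Zs)"
    and bij: "bij_betw F UNIV UNIV"
  shows "Ys = Zs"
proof -
  have act: "F (smith_module.act g (A_module u C Ys) a m) = smith_module.act g (A_module u C Zs) a (F m)" for a m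
    using smith_module_hom_act[OF A_smith_module[OF Y] A_smith_module[OF Z] F, of m a] by (simp add: Y)
  have F_mult: "F r = r * F 1" for r
    using act[of "free_eval gen_h r" 1] by (simp add: A_act_simps[OF Y] A_act_simps[OF Z])
  obtain r where "F r = 1" using bij by (metis UNIV_I bij_betw_def imageE)
  then have "is_unit (F 1)" using F_mult[of r] by (metis dvd_triv_right)
  then obtain c where c: "F 1 = [:c:]" "c \<noteq> 0" by (auto simp: is_unit_poly_iff dvd_field_iff)
  have "F (root_poly Ys) = F 1 * root_poly Zs"
    using act[of gen_x 1] by (simp add: A_act_simps[OF Y] A_act_simps[OF Z] c pcompose_1)
  then have "F 1 * root_poly Ys = F 1 * root_poly Zs"
    using F_mult[of "root_poly Ys"] by (simp only: mult.commute)
  moreover have "F 1 \<noteq> 0" using c by simp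
  ultimately have "root_poly Ys = root_poly Zs" using mult_left_cancel[of "F 1"] by blast
  then show ?thesis using proots_root_poly by metis
qed

lemma simple_module_iso:
  assumes M: "simple_module R M" and N: "left_module R N"
    and F: "F \<in> left_module_hom R M N" and bij: "bij_betw F (carrier M) (carrier N)"
  shows "simple_module R N"
  unfolding simple_module_def
proof (intro conjI allI impI N)
  have lM: "left_module R M" using M by (simp add: simple_module_def)
  interpret M: left_module R M by (rule lM)
  interpret N: left_module R N by (rule N)
  have F0: "F \<zero>\<^bsub>M\<^esub> = \<zero>\<^bsub>N\<^esub>" by (rule left_module_hom_zero[OF lM N F])
  have im: "F ` carrier M = carrier N" and inj: "inj_on F (carrier M)" using bij by (auto simp: bij_betw_def)
  obtain m where m: "m \<in> carrier M" "m \<noteq> \<zero>\<^bsub>M\<^esub>"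
    using M M.M.zero_closed unfolding simple_module_def by blast
  then have "F m \<noteq> \<zero>\<^bsub>N\<^esub>" using inj F0 M.M.zero_closed by (metis inj_onD)
  then show "carrier N \<noteq> {\<zero>\<^bsub>N\<^esub>}" using left_module_homD(1)[OF F m(1)] by blast
  fix L assume L: "submodule L R N"
  let ?L = "{x \<in> carrier M. F x \<in> L}"
  have FL: "F ` ?L = L" using submoduleD(1)[OF L] im by auto
  have "?L = {\<zero>\<^bsub>M\<^esub>} \<or> ?L = carrier M"
    using M submodule_preimage[OF lM F N L] unfolding simple_module_def by blast
  then show "L = {\<zero>\<^bsub>N\<^esub>} \<or> L = carrier N"
  proof
    assume "?L = {\<zero>\<^bsub>M\<^esub>}"
    then have "F ` ?L = {F \<zero>\<^bsub>M\<^esub>}" by simp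
    then show ?thesis using FL F0 by simp
  next
    assume "?L = carrier M"
    then show ?thesis using FL im by simp
  qed
qed

text \<open>
  Two nonzero submodules of \<open>A\<^sub>C(X)\<close> are nonzero ideals of a polynomial ring, so they meet.  Hence there
  is only one simple submodule.
\<close>

lemma socle_eq_image:
  assumes X: "Xs \<subseteq># roots" and Y: "Ys \<subseteq># roots" and f: "f \<noteq> 0"
    and hom: "(*) f \<in> left_module_hom (smith_algebra g) (A_module u C Ys) (A_module u C Xs)"
    and simple: "simple_module (smith_algebra g) (A_module u C Ys)"
  shows "socle (smith_algebra g) (A_module u C Xs) = range ((*) f)"
    and "(*) f \<in> left_module_hom (smith_algebra g) (A_module u C Ys) ((A_module u C Xs)\<lparr>carrier := range ((*) f)\<rparr>)"
    and "submodule (range ((*) f)) (smith_algebra g) (A_module u C Xs)"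
proof -
  let ?S = "smith_algebra g" and ?A = "A_module u C Xs" and ?N = "range ((*) f)"
  interpret A: smith_module g ?A by (rule A_smith_module[OF X])
  have "submodule UNIV ?S (A_module u C Ys)"
    using smith_module.smith_submoduleI[OF A_smith_module[OF Y], of UNIV] by (simp add: Y)
  then show N: "submodule ?N ?S ?A"
    by (rule submodule_image[OF A_left_module[OF Y] A_left_module[OF X] hom])
  show hom': "(*) f \<in> left_module_hom ?S (A_module u C Ys) (?A\<lparr>carrier := ?N\<rparr>)"
    using left_module_homD[OF hom] by (intro left_module_homI) (auto simp: X Y)
  have "bij_betw ((*) f) (carrier (A_module u C Ys)) (carrier (?A\<lparr>carrier := ?N\<rparr>))"
    using f by (auto simp: bij_betw_def inj_on_def Y)
  then have N_simple: "simple_module ?S (?A\<lparr>carrier := ?N\<rparr>)"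
    by (rule simple_module_iso[OF simple A.submodule_is_left_module[OF N] hom'])
  have sub: "L = {0} \<or> L = L'"
    if L: "submodule L ?S ?A" "L \<subseteq> L'" and L': "submodule L' ?S ?A" "simple_module ?S (?A\<lparr>carrier := L'\<rparr>)" for L L'
  proof -
    have "submodule L ?S (?A\<lparr>carrier := L'\<rparr>)"
      by (rule submoduleI[OF A.submodule_is_left_module[OF L'(1)]]) (use L submoduleD[OF L(1)] in auto)
    then show ?thesis using L'(2) by (simp add: simple_module_def X)
  qed
  have "L = ?N" if L: "submodule L ?S ?A" "simple_module ?S (?A\<lparr>carrier := L\<rparr>)" for L
  proof -
    have "L \<noteq> {0}" using L(2) by (simp add: simple_module_def X)
    then obtain m where m: "m \<in> L" "m \<noteq> 0" using submoduleD(2)[OF L(1)] by (auto simp: X)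
    have "f * m \<in> L" using A.submodule_act[OF L(1) m(1), of "free_eval gen_h f"] by (simp add: A_act_simps[OF X])
    then have fm: "f * m \<in> L \<inter> ?N" "f * m \<noteq> 0" using f m by auto
    have "submodule (L \<inter> ?N) ?S ?A"
      by (rule submoduleI[OF A_left_module[OF X]]) (use submoduleD[OF L(1)] submoduleD[OF N] in auto)
    then have "L \<inter> ?N = L" "L \<inter> ?N = ?N"
      using sub[OF _ _ L] sub[OF _ _ N N_simple] fm by blast+
    then show ?thesis by blast
  qed
  then have "{L. submodule L ?S ?A \<and> simple_module ?S (?A\<lparr>carrier := L\<rparr>)} = {?N}"
    using N N_simple by blast
  then have "socle ?S ?A = generate (add_monoid ?A) ?N" by (simp add: socle_def)
  also have "\<dots> = ?N"
    using group.generate_subgroup_incl[OF A.M.a_group order_refl submoduleD(5)[OF N]]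
    by (auto intro: generate.incl)
  finally show "socle ?S ?A = ?N" .
qed

lemma socle_multiset_eq:
  assumes X: "Xs \<subseteq># roots" and Y: "Ys \<subseteq># roots" and f: "f \<noteq> 0"
    and hom: "(*) f \<in> left_module_hom (smith_algebra g) (A_module u C Ys) (A_module u C Xs)"
    and simple: "simple_module (smith_algebra g) (A_module u C Ys)"
  shows "socle_multiset g u C Xs = Ys"
proof -
  let ?S = "smith_algebra g"
  let ?N = "(A_module u C Xs)\<lparr>carrier := range ((*) f)\<rparr>"
  note soc = socle_eq_image[OF assms]
  have bij: "bij_betw ((*) f) (carrier (A_module u C Ys)) (carrier ?N)"
    using f by (auto simp: bij_betw_def inj_on_def Y)
  have "module_isomorphic ?S ?N (A_module u C Ys)"
    unfolding module_isomorphic_def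
    using bij_betw_inv_into[OF bij] left_module_hom_inv[OF A_left_module[OF Y] soc(2) bij] by blast
  moreover have "Z = Ys" if Z: "Z \<subseteq># roots" "module_isomorphic ?S ?N (A_module u C Z)" for Z
  proof -
    obtain F where F: "F \<in> left_module_hom ?S ?N (A_module u C Z)" "bij_betw F (carrier ?N) (carrier (A_module u C Z))"
      using Z(2) by (auto simp: module_isomorphic_def)
    show ?thesis
      using A_iso_imp_eq[OF Y Z(1) left_module_hom_comp[OF soc(2) F(1)]] bij_betw_trans[OF bij F(2)]
      by (simp add: A_simps Y Z(1))
  qed
  ultimately show ?thesis
    unfolding socle_multiset_def soc(1) using Y by (intro the_equality) blast+
qed

end

theorem theorem3p28:
  fixes g u :: "'k::{alg_closed_field, field_char_0} poly" and C :: 'k and Xs :: "'k multiset"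
  assumes "g \<noteq> 0"
    and "g = shift (-1) u - u"
    and "Xs \<subseteq># proots (u + [:C:])"
  shows "K0_class (smith_algebra g) (A_module u C Xs) =
    K0_class (smith_algebra g) (A_module u C (socle_multiset g u C Xs))
      \<otimes>\<^bsub>K0 (smith_algebra g)\<^esub>
    (\<Otimes>\<^bsub>K0 (smith_algebra g)\<^esub>\<beta> \<in> set_mset (proots (u + [:C:])).
      K0_class (smith_algebra g) (verma_simple g \<beta>) [^]\<^bsub>K0 (smith_algebra g)\<^esub> varphi u C Xs \<beta>)"
proof -
  interpret smith_data g u C by (rule smith_data.intro) (rule assms)+
  show ?thesis
    using A_filtration[OF assms(3)] socle_multiset_eq[OF assms(3)] by (auto simp: finite_dimensional_part_def)
qed

end
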